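(* Let $d\ge2$ and let $k,a$ be integers with $1\le a<k$ and $a+k$ even. Let $F$ be the associated Sierpinski carpet with spectral dimension $d_s=d_s(F)$, and let $G=(V,E)$ be the associated graphical Sierpinski carpet. Suppose $d_s>2$ and let $\zeta=d_s/(d_s-2)$. Then there exists $c_1$ such that for every set $A$ of vertices of $G$, $$|A|\le c_1R(A)^{-\zeta},$$ where $|A|$ is the cardinality of $A$ and $R(A)$ is the resistance from $A$ to infinity in $G$.
   Context: Construction. Let $F_0=[0,1]^d$, with center $\mathbf z_0=(1/2,\dots,1/2)$. Divide $F_0$ into $k^d$ equal closed subcubes and remove the central block of $a^d$ subcubes: $F_1=F_0\setminus\big(\tfrac{k-a}{2k},\tfrac{k+a}{2k}\big)^d$. Repeat the same operation on each of the $k^d-a^d$ remaining subcubes to obtain $F_2$, and iterate to obtain a decreasing sequence of closed sets $F_n$. The Sierpinski carpet is $F=\bigcap_{n\ge0}F_n$, and the pre-Sierpinski carpet is $\widehat F=\bigcup_{n\ge1}k^nF_n\subset[0,\infty)^d$. The graphical Sierpinski carpet is the graph $G=(V,E)$ with vertex set $V=(\mathbf z_0+\mathbb Z^d)\cap\widehat F$ and edge set $E=\{\{x,y\}:x,y\in V,\ |x-y|=1\}$. Spectral dimension. Let $q(t,x,y)$ be the transition density (with respect to Lebesgue measure) of Brownian motion on $\widehat F$ with normal reflection on $\partial\widehat F$. The spectral dimension $d_s(F)$ is the unique number for which there are constants $0<c\le C<\infty$ with $c\,t^{-d_s/2}\le q(t,x,x)\le C\,t^{-d_s/2}$ for all $x\in\widehat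 F$, $t>1$ (it exists and lies in $(1,d_f)$, where $d_f=\log(k^d-a^d)/\log k$). Resistance. For a set $B$ of vertices of $G$, the resistance $R(B)$ from $B$ to infinity is defined by $$R(B)^{-1}=\inf\Big\{\sum_{\{x,y\}\in E}(f(x)-f(y))^2:\ f:V\to\mathbb R,\ f\equiv1\text{ on }B,\ f(x)\to0\text{ as }|x|\to\infty\Big\},$$ with the infimum of the empty set equal to $+\infty$. *)

theory Defs
  imports "HOL-Probability.Probability"
begin

section \<open>The carpet and its graph\<close>

definition subcube :: "nat \<Rightarrow> nat \<Rightarrow> real ^ 'd \<Rightarrow> (real ^ 'd) set" where
  "subcube k n z = cbox ((1 / real k ^ n) *\<^sub>R z) ((1 / real k ^ n) *\<^sub>R (z + 1))"

text \<open>The open central block, of side \<open>a/k\<close> times that of the cube.\<close>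
definition central_block :: "nat \<Rightarrow> nat \<Rightarrow> nat \<Rightarrow> real ^ 'd \<Rightarrow> (real ^ 'd) set" where
  "central_block k a n z =
     box ((1 / real k ^ n) *\<^sub>R (z + vec ((real k - real a) / (2 * real k))))
         ((1 / real k ^ n) *\<^sub>R (z + vec ((real k + real a) / (2 * real k))))"

text \<open>The level-\<open>n\<close> subcubes that have not been removed are the grid cubes contained in
  the \<open>n\<close>-th stage.\<close>
fun carpet_stage :: "nat \<Rightarrow> nat \<Rightarrow> nat \<Rightarrow> (real ^ 'd) set" where
  "carpet_stage k a 0 = cbox 0 1"
| "carpet_stage k a (Suc n) = carpet_stage k a n -
     \<Union>{central_block k a n z | z. (\<forall>i. z $ i \<in> \<int>) \<and> subcube k n z \<subseteq> carpet_stage k a n}"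

definition pre_carpet :: "nat \<Rightarrow> nat \<Rightarrow> (real ^ 'd) set" where
  "pre_carpet k a = (\<Union>n\<in>{1..}. (\<lambda>x. (real k ^ n) *\<^sub>R x) ` carpet_stage k a n)"

definition carpet_vertices :: "nat \<Rightarrow> nat \<Rightarrow> (real ^ 'd) set" where
  "carpet_vertices k a = {x \<in> pre_carpet k a. \<forall>i. x $ i - 1 / 2 \<in> \<int>}"

definition carpet_edges :: "nat \<Rightarrow> nat \<Rightarrow> (real ^ 'd) set set" where
  "carpet_edges k a =
     {{x, y} | x y. x \<in> carpet_vertices k a \<and> y \<in> carpet_vertices k a \<and> dist x y = 1}"


section \<open>Resistance to infinity\<close>

text \<open>On an edge \<open>{x, y}\<close> the difference \<open>Max - Min\<close> is \<open>\<bar>f x - f y\<bar>\<close>.\<close>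
definition graph_energy :: "'a set set \<Rightarrow> ('a \<Rightarrow> real) \<Rightarrow> ennreal" where
  "graph_energy E f = (\<integral>\<^sup>+ e. ennreal ((Max (f ` e) - Min (f ` e))\<^sup>2) \<partial>count_space E)"

text \<open>In \<^typ>\<open>ennreal\<close>, \<open>Inf {} = \<infinity>\<close>, \<open>inverse 0 = \<infinity>\<close> and \<open>inverse \<infinity> = 0\<close>.\<close>
definition resistance :: "('a::real_normed_vector) set \<Rightarrow> 'a set set \<Rightarrow> 'a set \<Rightarrow> ennreal" where
  "resistance V E B = inverse
     (INF f \<in> {f. (\<forall>x\<in>B. f x = 1) \<and> (f \<longlongrightarrow> 0) (inf at_infinity (principal V))}. graph_energy E f)"

definition ennreal_powr :: "ennreal \<Rightarrow> real \<Rightarrow> ennreal" where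
  "ennreal_powr r p =
     (if p = 0 then 1
      else if r = 0 then (if p > 0 then 0 else \<infinity>)
      else if r = \<infinity> then (if p > 0 then \<infinity> else 0)
      else ennreal (enn2real r powr p))"


section \<open>The Sobolev energy\<close>

definition square_integrable_on ::
    "('a::euclidean_space \<Rightarrow> 'b::euclidean_space) \<Rightarrow> 'a set \<Rightarrow> bool" where
  "square_integrable_on f D \<longleftrightarrow>
     set_borel_measurable lborel D f \<and> set_integrable lborel D (\<lambda>x. (norm (f x))\<^sup>2)"

definition weak_gradient_on ::
    "'a::euclidean_space set \<Rightarrow> ('a \<Rightarrow> real) \<Rightarrow> ('a \<Rightarrow> 'a) \<Rightarrow> bool" where
  "weak_gradient_on D u g \<longleftrightarrow>
     (\<forall>\<phi> \<phi>'. (\<forall>x. GDERIV \<phi> x :> \<phi>' x) \<and> continuous_on UNIV \<phi>' \<and>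
        compact (closure {x. \<phi> x \<noteq> 0}) \<and> closure {x. \<phi> x \<noteq> 0} \<subseteq> D \<longrightarrow>
        (LINT x:D|lborel. u x *\<^sub>R \<phi>' x) = - (LINT x:D|lborel. \<phi> x *\<^sub>R g x))"

text \<open>For \<open>u\<close> in \<open>L\<^sup>2(D)\<close> this is half the squared \<open>L\<^sup>2\<close>-norm of the weak gradient (unique up to
  null sets) if \<open>u \<in> W\<^sup>1\<^sup>,\<^sup>2(D)\<close>, and \<open>\<infinity>\<close>, as an infimum over the empty set, otherwise.\<close>
definition sobolev_energy :: "'a::euclidean_space set \<Rightarrow> ('a \<Rightarrow> real) \<Rightarrow> ennreal" where
  "sobolev_energy D u =
     (INF g \<in> {g. square_integrable_on g D \<and> weak_gradient_on D u g}.
        ennreal (1 / 2 * (LINT x:D|lborel. (norm (g x))\<^sup>2)))"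


section \<open>Reflecting Brownian motion and spectral dimension\<close>

text \<open>Continuous paths in \<open>S\<close>, with the \<open>\<sigma>\<close>-algebra generated by the coordinates at the times
  in \<open>I\<close>. Paths are functions on all of \<open>\<real>\<close>; their values at negative times are irrelevant.\<close>
definition path_space :: "'a::euclidean_space set \<Rightarrow> real set \<Rightarrow> (real \<Rightarrow> 'a) measure" where
  "path_space S I =
     (let \<Omega> = {\<omega>. continuous_on {0..} \<omega> \<and> \<omega> ` {0..} \<subseteq> S}
      in sigma \<Omega> {{\<omega> \<in> \<Omega>. \<omega> t \<in> B} | t B. t \<in> I \<and> B \<in> sets borel})"

definition transition ::
    "('a::euclidean_space \<Rightarrow> (real \<Rightarrow> 'a) measure) \<Rightarrow> real \<Rightarrow> 'a \<Rightarrow> 'a set \<Rightarrow> ennreal" where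
  "transition P t x B = emeasure (P x) {\<omega> \<in> space (P x). \<omega> t \<in> B}"

text \<open>The laws \<open>P x\<close> of Brownian motion on \<open>S\<close>, started at \<open>x\<close>, with normal reflection on the
  boundary. As is standard for domains whose boundary is not smooth, it is characterised as the
  continuous Markov process that is symmetric with respect to Lebesgue measure and has Dirichlet
  form \<open>\<E>(u,u) = \<onehalf> \<integral>|\<nabla>u|\<^sup>2\<close> with domain \<open>W\<^sup>1\<^sup>,\<^sup>2(interior S)\<close>; the Dirichlet form of a process with
  transition semigroup \<open>T\<^sub>t\<close> is \<open>\<E>(u,u) = lim\<^sub>t\<^sub>\<rightarrow>\<^sub>0 \<langle>u - T\<^sub>t u, u\<rangle> / t\<close>, with domain the \<open>u\<close> in
  \<open>L\<^sup>2(S)\<close> for which this limit is finite. The boundary of \<open>S\<close> is assumed to be a null set.\<close>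
definition reflecting_brownian_motion ::
    "'a::euclidean_space set \<Rightarrow> ('a \<Rightarrow> (real \<Rightarrow> 'a) measure) \<Rightarrow> bool" where
  "reflecting_brownian_motion S P \<longleftrightarrow>
     P \<in> restrict_space borel S \<rightarrow>\<^sub>M prob_algebra (path_space S {0..}) \<and>
     (\<forall>x\<in>S. transition P 0 x {x} = 1) \<and>
     (\<forall>x\<in>S. \<forall>s\<ge>0. \<forall>t\<ge>0. \<forall>A\<in>sets (path_space S {0..s}). \<forall>B\<in>sets borel.
        emeasure (P x) {\<omega> \<in> A. \<omega> (s + t) \<in> B} = (\<integral>\<^sup>+ \<omega>\<in>A. transition P t (\<omega> s) B \<partial>P x)) \<and>
     (\<forall>t\<ge>0. \<forall>A\<in>sets borel. \<forall>B\<in>sets borel.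
        (\<integral>\<^sup>+ x\<in>A \<inter> S. transition P t x B \<partial>lborel) = (\<integral>\<^sup>+ x\<in>B \<inter> S. transition P t x A \<partial>lborel)) \<and>
     (\<forall>u. square_integrable_on u S \<longrightarrow>
        ((\<lambda>t. ennreal ((LINT x:S|lborel. (u x - (\<integral>\<omega>. u (\<omega> t) \<partial>P x)) * u x) / t))
          \<longlongrightarrow> sobolev_energy (interior S) u) (at_right 0))"

text \<open>The continuous version of the density, so that the values on the diagonal are meaningful.
  Since the density is required from every starting point, it is also this condition that
  excludes exceptional starting points, about which the Dirichlet form carries no information.\<close>
definition transition_density ::
    "'a::euclidean_space set \<Rightarrow> ('a \<Rightarrow> (real \<Rightarrow> 'a) measure) \<Rightarrow> (real \<Rightarrow> 'a \<Rightarrow> 'a \<Rightarrow> real) \<Rightarrow> bool" where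
  "transition_density S P q \<longleftrightarrow>
     (\<forall>t>0. continuous_on (S \<times> S) (\<lambda>(x, y). q t x y) \<and>
        (\<forall>x\<in>S. (\<forall>y\<in>S. 0 \<le> q t x y) \<and>
          (\<forall>B\<in>sets borel. transition P t x B = (\<integral>\<^sup>+ y\<in>B \<inter> S. ennreal (q t x y) \<partial>lborel))))"

text \<open>The argument \<open>S\<close> is the pre-carpet. There is at most one such \<open>ds\<close>, because the continuous
  density \<open>q\<close> is determined by \<open>S\<close>.\<close>
definition has_spectral_dimension :: "'a::euclidean_space set \<Rightarrow> real \<Rightarrow> bool" where
  "has_spectral_dimension S ds \<longleftrightarrow>
     (\<exists>P q. reflecting_brownian_motion S P \<and> transition_density S P q \<and>
        (\<exists>c C. 0 < c \<and> c \<le> C \<and>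
          (\<forall>x\<in>S. \<forall>t>1. c * t powr (- ds / 2) \<le> q t x x \<and> q t x x \<le> C * t powr (- ds / 2))))"

end

theory Submission
  imports Defs
begin

text \<open>The on-diagonal heat kernel bound extends off the diagonal, because the kernel is positive
  definite, and together with \<open>\<parallel>u\<parallel>\<^sup>2 - \<langle>u, T\<^sub>t u\<rangle> \<le> t \<E>(u, u)\<close> it gives a Nash type inequality
  \<open>\<parallel>u\<parallel>\<^sub>2\<^sup>2 \<le> t \<E>(u, u) + C t\<^sup>-\<^sup>d\<^sup>s\<^sup>/\<^sup>2 \<parallel>u\<parallel>\<^sub>1\<^sup>2\<close> for \<open>t > 1\<close>. A function \<open>g\<close> on the vertices is
  averaged with smooth weights into a function on the pre-carpet of comparable norms, whose energy
  is at most a multiple of the graph energy of \<open>g\<close>; this uses that neighbouring cells of the carpet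
  are joined by short paths of cells. Choosing \<open>t\<close> as a power of the volume of the support
  yields a Faber--Krahn inequality on the graph. Applied to the truncations of \<open>f\<close> between the
  heights \<open>2\<^sup>-\<^sup>j\<^sup>-\<^sup>1\<close> and \<open>2\<^sup>-\<^sup>j\<close>, it shows that the level sets of \<open>f\<close> would grow geometrically,
  without bound, if \<open>\<bar>A\<bar>\<close> were large compared to the energy of \<open>f\<close> to the power \<open>\<zeta>\<close>.\<close>

section \<open>Holes of the carpet\<close>

text \<open>The kernel bound is available only for t > 1. This is harmless because functions on the
  graph have no scale below the unit cell: the inequality is used at
  \<open>t = (Kc * m) powr (2 / ds)\<close>, where m >= 1 counts vertices and
  \<open>Kc >= 2\<close>. No spectral theory is involved. The identity <u, T_2t u> = ||T_t u||^2
  gives positive definiteness and also shows that the difference quotients defining the Dirichlet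
  form do not decrease when t is halved. The geometric obstacle is that averaging compares values of
  \<open>g\<close> at vertices whose cells touch only in a corner, whereas the energy sees only
  edges. Parity of \<open>a + k\<close> forces k - a >= 2, so each hole keeps a margin of a full
  subcube inside its surrounding cube. Hence two holes never come close enough to cut both ways
  around a corner, and d edges always suffice. The condition ds > 2 says that the exponent p = ds/2
  of the level set recursion exceeds 1; \<zeta> = p / (p - 1) is the exponent of the threshold above
  which that recursion explodes.\<close>

text \<open>The holes of level \<open>m\<close> of the pre-carpet consist of the points all of whose coordinates lie
  in the following set.\<close>
definition hole_line :: "nat \<Rightarrow> nat \<Rightarrow> nat \<Rightarrow> real set" where
  "hole_line k a m =
     (\<Union>z::int. {real k ^ m * of_int z + real k ^ (m - 1) * of_int ((int k - int a) div 2)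
               <..< real k ^ m * of_int z + real k ^ (m - 1) * of_int ((int k + int a) div 2)})"

text \<open>Multiples of \<open>K\<close> never fall inside the open cell from \<open>K * z\<close>
  to \<open>K * z + K\<close>, so all its points lie on the same side of each of them.\<close>

lemma grid_interval_iff:
  fixes K s t :: real and z l r :: int
  assumes "0 < K" "K * z < s" "s < K * z + K" "K * z < t" "t < K * z + K"
  shows "K * l < s \<and> s < K * r \<longleftrightarrow> K * l < t \<and> t < K * r"
proof -
  have "K * l < x \<longleftrightarrow> l \<le> z" "x < K * r \<longleftrightarrow> z < r" if "K * z < x" "x < K * z + K" for x
  proof -
    have m: "K * of_int i \<le> K * of_int j \<longleftrightarrow> i \<le> j" for i j :: int
      using assms(1) by simp
    have e: "K * z + K = K * of_int (z + 1)" by (simp add: algebra_simps)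
    show "K * l < x \<longleftrightarrow> l \<le> z"
      using that m[of l z] m[of "z+1" l] unfolding e by (smt (verit))
    show "x < K * r \<longleftrightarrow> z < r"
      using that m[of r z] m[of "z+1" r] unfolding e by (smt (verit))
  qed
  then show ?thesis using assms by blast
qed

locale carpet_params =
  fixes k a :: nat
  assumes a_pos: "1 \<le> a" and a_less: "a < k" and even_ak: "even (a + k)"
begin

text \<open>In units of subcubes the removed interval of a cube runs from \<open>lo\<close> to
  \<open>hi\<close>. Both divisions are exact because \<open>a + k\<close> is even.\<close>

definition lo :: int where "lo = (int k - int a) div 2"
definition hi :: int where "hi = (int k + int a) div 2"

lemma lo_hi: "2 * lo = int k - int a" "2 * hi = int k + int a" "1 \<le> lo" "hi \<le> int k - 1" "lo < hi"
proof -
  have ev: "even (int a + int k)" using even_ak by (metis even_of_nat of_nat_add)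
  then have "even (int k - int a)" "even (int k + int a)" by presburger+
  then show 1: "2 * lo = int k - int a" "2 * hi = int k + int a"
    unfolding lo_def hi_def by simp_all
  \<comment> \<open>From \<open>a < k\<close> alone the difference is at least 1; parity raises it
    to 2. This is the margin that keeps holes away from the boundary of their cube.\<close>
  have "int k - int a \<ge> 2" using a_less ev by presburger
  then show "1 \<le> lo" "hi \<le> int k - 1" using 1 by linarith+
  show "lo < hi" using 1 a_pos by linarith
qed

lemma k_ge: "3 \<le> k"
  using lo_hi a_pos by linarith

lemma hole_line_iff:
  "t \<in> hole_line k a (Suc m) \<longleftrightarrow>
     (\<exists>z::int. real k ^ m * of_int (int k * z + lo) < t \<and> t < real k ^ m * of_int (int k * z + hi))"
  unfolding hole_line_def lo_def[symmetric] hi_def[symmetric]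
  by (simp add: algebra_simps)

lemma hole_line_scale:
  "real k ^ n * t \<in> hole_line k a (Suc (m + n)) \<longleftrightarrow> t \<in> hole_line k a (Suc m)"
proof -
  have "real k ^ n > 0" using k_ge by simp
  then have "real k ^ (m + n) * x < real k ^ n * t \<longleftrightarrow> real k ^ m * x < t"
    "real k ^ n * t < real k ^ (m + n) * x \<longleftrightarrow> t < real k ^ m * x" for x
    by (simp_all add: power_add mult.assoc mult.left_commute)
  then show ?thesis unfolding hole_line_iff by blast
qed

text \<open>The endpoints of the intervals of index \<open>Suc (m + n)\<close> are multiples of
  k^(m+n), hence of k^m, so none of them splits an open cell of side k^m.\<close>

lemma hole_line_cell:
  assumes "real k ^ m * of_int z < s" "s < real k ^ m * of_int z + real k ^ m"
    and "real k ^ m * of_int z < t" "t < real k ^ m * of_int z + real k ^ m"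
  shows "s \<in> hole_line k a (Suc (m + n)) \<longleftrightarrow> t \<in> hole_line k a (Suc (m + n))"
proof -
  have e: "real k ^ (m + n) * of_int j = real k ^ m * of_int (int k ^ n * j)" for j
    by (simp add: power_add)
  have "real k ^ m > 0" using k_ge by simp
  from grid_interval_iff[OF this assms] show ?thesis
    unfolding hole_line_iff e by blast
qed

text \<open>An open interval with integer endpoints that meets a closed unit cell contains the
  interior of the cell. Only one direction is possible, since an endpoint of the cell may lie on the
  boundary of the hole.\<close>

lemma hole_line_unit_cell:
  assumes "of_int z \<le> t" "t \<le> of_int z + 1" "t \<in> hole_line k a (Suc m)"
  shows "of_int z + 1/2 \<in> hole_line k a (Suc m)"
proof -
  from assms(3) obtain w :: int where "real_of_int (int k ^ m * (int k * w + lo)) < t"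
    "t < real_of_int (int k ^ m * (int k * w + hi))"
    unfolding hole_line_iff by auto
  moreover from this assms(1,2)
  have "int k ^ m * (int k * w + lo) \<le> z" "z + 1 \<le> int k ^ m * (int k * w + hi)"
    by linarith+
  then have "real_of_int (int k ^ m * (int k * w + lo)) \<le> of_int z"
    "of_int z + 1 \<le> real_of_int (int k ^ m * (int k * w + hi))"
    by (metis of_int_le_iff, metis of_int_1 of_int_add of_int_le_iff)
  ultimately show ?thesis unfolding hole_line_iff
    by (intro exI[of _ w]) (simp; linarith)
qed

lemma hole_line_unit_cell_iff:
  assumes "of_int z < t" "t < of_int z + 1"
  shows "t \<in> hole_line k a (Suc m) \<longleftrightarrow> of_int z + 1/2 \<in> hole_line k a (Suc m)"
  using hole_line_cell[of 0 z t "of_int z + 1/2" m] assms by simp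

text \<open>Intervals with negative \<open>z\<close> stay below 0 because \<open>hi < k\<close>, and
  the others start no earlier than k^m because \<open>1 \<le> lo\<close>. Thus only finitely many
  levels concern a given point of the orthant.\<close>

lemma hole_line_ge:
  assumes "0 \<le> t" "t \<in> hole_line k a (Suc m)"
  shows "real k ^ m < t"
proof -
  from assms(2) obtain z :: int where z: "real k ^ m * of_int (int k * z + lo) < t"
    "t < real k ^ m * of_int (int k * z + hi)"
    unfolding hole_line_iff by auto
  have kp: "real k ^ m > 0" using k_ge by simp
  have "0 < real_of_int (int k * z + hi)"
    using z(2) assms(1) kp by (smt (verit) zero_less_mult_pos)
  then have "int k * z + hi > 0" by linarith
  have "z \<ge> 0"
  proof (rule ccontr)
    assume "\<not> z \<ge> 0"
    then have "int k * z \<le> int k * (-1)" by (intro mult_left_mono) auto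
    then show False using lo_hi(4) \<open>int k * z + hi > 0\<close> by linarith
  qed
  then have "int k * z \<ge> 0" by simp
  then have "real_of_int (int k * z + lo) \<ge> 1" using lo_hi(3) by linarith
  then have "real k ^ m * 1 \<le> real k ^ m * of_int (int k * z + lo)"
    using kp by (intro mult_left_mono) auto
  then show ?thesis using z(1) by linarith
qed

text \<open>Distinct holes have disjoint closures: a unit cell in a hole of a finer level is so far from
  the boundary of the surrounding cube that its neighbours lie in the same coarser holes.\<close>
lemma hole_line_neighbour:
  assumes "s - 1/2 \<in> \<int>" "t - 1/2 \<in> \<int>" "\<bar>s - t\<bar> \<le> 1"
    and "s \<in> hole_line k a (Suc n)" "n < m"
  shows "s \<in> hole_line k a (Suc m) \<longleftrightarrow> t \<in> hole_line k a (Suc m)"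
proof -
  obtain i where i: "s = of_int i + 1/2" using assms(1) by (metis Ints_cases diff_add_cancel)
  obtain j where j: "t = of_int j + 1/2" using assms(2) by (metis Ints_cases diff_add_cancel)
  from assms(4) obtain z :: int where "real_of_int (int k ^ n * (int k * z + lo)) < s"
    "s < real_of_int (int k ^ n * (int k * z + hi))"
    unfolding hole_line_iff by auto
  then have "int k ^ n * (int k * z + lo) \<le> i" "i + 1 \<le> int k ^ n * (int k * z + hi)"
    unfolding i by linarith+
  moreover have "int k ^ n * (int k * z + 1) \<le> int k ^ n * (int k * z + lo)"
    "int k ^ n * (int k * z + hi) \<le> int k ^ n * (int k * z + (int k - 1))"
    using lo_hi by (intro mult_left_mono; simp)+
  moreover have "int k ^ n \<ge> 1" using k_ge by simp
  moreover have "\<bar>i - j\<bar> \<le> 1" using assms(3) unfolding i j by linarith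
  ultimately have "int k ^ Suc n * z \<le> i" "i + 1 \<le> int k ^ Suc n * z + int k ^ Suc n"
     "int k ^ Suc n * z \<le> j" "j + 1 \<le> int k ^ Suc n * z + int k ^ Suc n"
    by (simp_all add: algebra_simps)
  then have "real_of_int (int k ^ Suc n * z) \<le> i" "real_of_int (i + 1) \<le> real_of_int (int k ^ Suc n * z + int k ^ Suc n)"
     "real_of_int (int k ^ Suc n * z) \<le> j" "real_of_int (j + 1) \<le> real_of_int (int k ^ Suc n * z + int k ^ Suc n)"
    by (simp_all only: of_int_le_iff)
  then have "s \<in> hole_line k a (Suc (Suc n + (m - Suc n))) \<longleftrightarrow> t \<in> hole_line k a (Suc (Suc n + (m - Suc n)))"
    by (intro hole_line_cell[of "Suc n" z]) (simp_all add: i j)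
  then show ?thesis using assms(5) by simp
qed

text \<open>The coordinates of the grid point \<open>z\<close> can be chosen independently, so the
  search for one block splits into one search per coordinate. Scaling by k^(n+1) turns the corners
  of the blocks into integer points.\<close>

lemma central_block_iff:
  "(\<exists>z::real^'d. (\<forall>i. z $ i \<in> \<int>) \<and> x \<in> central_block k a n z) \<longleftrightarrow>
     (\<forall>i. real k ^ Suc n * x $ i \<in> hole_line k a (Suc 0))" (is "?L \<longleftrightarrow> ?R")
proof -
  have kp: "real k > 0" "real k ^ n > 0" using k_ge by simp_all
  have lr: "(real k - real a) = 2 * of_int lo" "(real k + real a) = 2 * of_int hi"
    using lo_hi(1,2) by linarith+
  have *: "(1 / real k ^ n * (of_int w + (real k - real a) / (2 * real k)) < x $ i \<and>
     x $ i < 1 / real k ^ n * (of_int w + (real k + real a) / (2 * real k))) \<longleftrightarrow>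
      (of_int (int k * w + lo) < real k ^ Suc n * x $ i \<and> real k ^ Suc n * x $ i < of_int (int k * w + hi))"
    for w :: int and i
    unfolding lr using kp by (simp add: field_simps)
  show ?thesis
  proof
    assume ?L
    then obtain z where z: "\<And>i. z $ i \<in> \<int>" "x \<in> central_block k a n z" by blast
    show ?R
    proof
      fix i
      obtain w :: int where w: "z $ i = of_int w" using z(1) by (metis Ints_cases)
      have "1 / real k ^ n * (of_int w + (real k - real a) / (2 * real k)) < x $ i \<and>
          x $ i < 1 / real k ^ n * (of_int w + (real k + real a) / (2 * real k))"
        using z(2) unfolding central_block_def mem_box_cart w[symmetric] by simp
      then show "real k ^ Suc n * x $ i \<in> hole_line k a (Suc 0)"
        unfolding hole_line_iff * by (intro exI[of _ w]) simp
    qed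
  next
    assume ?R
    then have "\<forall>i. \<exists>w::int. of_int (int k * w + lo) < real k ^ Suc n * x $ i \<and>
        real k ^ Suc n * x $ i < of_int (int k * w + hi)"
      unfolding hole_line_iff by simp
    then obtain w :: "'d \<Rightarrow> int" where
      "\<And>i. of_int (int k * w i + lo) < real k ^ Suc n * x $ i \<and>
        real k ^ Suc n * x $ i < of_int (int k * w i + hi)" by metis
    then have "\<And>i. 1 / real k ^ n * (of_int (w i) + (real k - real a) / (2 * real k)) < x $ i \<and>
     x $ i < 1 / real k ^ n * (of_int (w i) + (real k + real a) / (2 * real k))"
      using * by blast
    then show ?L unfolding central_block_def mem_box_cart
      by (intro exI[of _ "\<chi> i. of_int (w i)"]) simp
  qed
qed

text \<open>The recursive definition removes a block only if its whole subcube survived so far. This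
  condition is automatic for a block containing a surviving point: relative to coarser holes all
  points of the open subcube behave alike, and holes are open. So the removal can be tested point by
  point, which is the content of \<open>sub\<close>.\<close>

lemma mem_carpet_stage_iff:
  "(x :: real^'d) \<in> carpet_stage k a n \<longleftrightarrow>
     x \<in> cbox 0 1 \<and> (\<forall>j<n. \<exists>i. real k ^ Suc j * x $ i \<notin> hole_line k a (Suc 0))"
proof (induction n arbitrary: x)
  case 0
  show ?case by simp
next
  case (Suc n)
  have kn: "real k ^ n > 0" using k_ge by simp
  have sub: "subcube k n z \<subseteq> carpet_stage k a n"
    if z: "\<forall>i. z $ i \<in> \<int>" and xz: "x \<in> central_block k a n z" and x: "x \<in> carpet_stage k a n"
    for z :: "real^'d"
  proof
    fix y assume y: "y \<in> subcube k n z"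
    have xs: "z $ i < real k ^ n * x $ i \<and> real k ^ n * x $ i < z $ i + 1" for i
    proof -
      have "0 < (real k - real a) / (2 * real k)" "(real k + real a) / (2 * real k) < 1"
        using a_less a_pos by (simp_all add: field_simps)
      moreover have "1 / real k ^ n * (z $ i + (real k - real a) / (2 * real k)) < x $ i"
        "x $ i < 1 / real k ^ n * (z $ i + (real k + real a) / (2 * real k))"
        using xz unfolding central_block_def mem_box_cart by simp_all
      then have "z $ i + (real k - real a) / (2 * real k) < real k ^ n * x $ i"
        "real k ^ n * x $ i < z $ i + (real k + real a) / (2 * real k)"
        using kn by (simp_all add: field_simps)
      ultimately show ?thesis by linarith
    qed
    have ys: "z $ i \<le> real k ^ n * y $ i \<and> real k ^ n * y $ i \<le> z $ i + 1" for i
    proof -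
      have "1 / real k ^ n * z $ i \<le> y $ i" "y $ i \<le> 1 / real k ^ n * (z $ i + 1)"
        using y unfolding subcube_def mem_box_cart by simp_all
      then show ?thesis using kn by (simp add: field_simps)
    qed
    have x01: "0 \<le> x $ i \<and> x $ i \<le> 1" for i
      using x unfolding Suc.IH by (auto simp: mem_box_cart)
    have "0 \<le> y $ i \<and> y $ i \<le> 1" for i
    proof -
      obtain w :: int where w: "z $ i = of_int w" using z by (metis Ints_cases)
      have "0 \<le> real k ^ n * x $ i" "real k ^ n * x $ i \<le> real k ^ n"
        using x01[of i] kn by (simp_all add: mult_left_le)
      then have "real_of_int w < real_of_int (int k ^ n)" "0 < real_of_int w + 1"
        using xs[of i] w unfolding of_int_power of_int_of_nat_eq by linarith+
      then have "w + 1 \<le> int k ^ n" "0 \<le> w" by linarith+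
      then have "real_of_int (w + 1) \<le> real_of_int (int k ^ n)" "0 \<le> real_of_int w"
        by (simp_all only: of_int_le_iff of_int_0_le_iff)
      then have "0 \<le> real k ^ n * y $ i" "real k ^ n * y $ i \<le> real k ^ n * 1"
        using ys[of i] w by (simp_all)
      then show ?thesis using kn by (simp add: zero_le_mult_iff)
    qed
    moreover have "\<exists>i. real k ^ Suc j * y $ i \<notin> hole_line k a (Suc 0)" if j: "j < n" for j
    proof -
      from x j obtain i where i: "real k ^ Suc j * x $ i \<notin> hole_line k a (Suc 0)"
        unfolding Suc.IH by blast
      obtain w :: int where w: "z $ i = of_int w" using z by (metis Ints_cases)
      define r where "r = n - Suc j"
      \<comment> \<open>Scaling by k^n makes the subcube a unit cell, and the hole condition of
        stage \<open>j\<close> becomes one of index \<open>Suc r\<close>.\<close>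
      have sc: "real k ^ n * s \<in> hole_line k a (Suc r) \<longleftrightarrow> real k ^ Suc j * s \<in> hole_line k a (Suc 0)" for s
      proof -
        have "n = r + Suc j" using j unfolding r_def by simp
        then have "real k ^ n * s = real k ^ r * (real k ^ Suc j * s)"
          by (simp only: power_add mult.assoc)
        then show ?thesis using hole_line_scale[of r "real k ^ Suc j * s" 0] by (simp only: add_0)
      qed
      \<comment> \<open>The midpoint of the cell mediates: \<open>x\<close> is inside the open cell,
        so the midpoint avoids the hole as well; \<open>y\<close> may lie on the boundary, but if it
        were in the hole, so would be the midpoint.\<close>
      have "real k ^ Suc j * y $ i \<notin> hole_line k a (Suc 0)"
        using i hole_line_unit_cell[of w "real k ^ n * y $ i" r]
          hole_line_unit_cell_iff[of w "real k ^ n * x $ i" r] xs[of i] ys[of i]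
        unfolding sc w by auto
      then show ?thesis ..
    qed
    ultimately show "y \<in> carpet_stage k a n"
      unfolding Suc.IH by (auto simp: mem_box_cart)
  qed
  have "x \<in> carpet_stage k a (Suc n) \<longleftrightarrow> x \<in> carpet_stage k a n \<and>
     \<not> (\<exists>z::real^'d. (\<forall>i. z $ i \<in> \<int>) \<and> x \<in> central_block k a n z)"
    using sub unfolding carpet_stage.simps by blast
  then show ?case unfolding central_block_iff Suc.IH using less_Suc_eq by auto
qed

text \<open>Scaling by k^n reverses the order of the levels: stage \<open>j\<close> yields the holes
  of index \<open>Suc (n - Suc j)\<close>. By \<open>hole_line_ge\<close> the levels m >= n do not
  meet the cube of side k^n, so the condition for a single \<open>n\<close> already implies the one
  for all levels.\<close>

lemma mem_pre_carpet_iff: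
  "(x :: real^'d) \<in> pre_carpet k a \<longleftrightarrow>
     (\<forall>i. 0 \<le> x $ i) \<and> (\<forall>m. \<exists>i. x $ i \<notin> hole_line k a (Suc m))"
proof -
  have kp: "real k ^ n > 0" for n using k_ge by simp
  have sc: "x \<in> (\<lambda>x. (real k ^ n) *\<^sub>R x) ` carpet_stage k a n \<longleftrightarrow>
     (\<forall>i. 0 \<le> x $ i \<and> x $ i \<le> real k ^ n) \<and> (\<forall>m<n. \<exists>i. x $ i \<notin> hole_line k a (Suc m))" for n
  proof -
    have "x \<in> (\<lambda>x. (real k ^ n) *\<^sub>R x) ` carpet_stage k a n \<longleftrightarrow> (1 / real k ^ n) *\<^sub>R x \<in> carpet_stage k a n"
      using kp[of n] by (force simp: image_iff)
    also have "\<dots> \<longleftrightarrow> (\<forall>i. 0 \<le> x $ i \<and> x $ i \<le> real k ^ n) \<and>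
        (\<forall>j<n. \<exists>i. real k ^ Suc j * (1 / real k ^ n * x $ i) \<notin> hole_line k a (Suc 0))"
    proof -
      have "0 \<le> 1 / real k ^ n * t \<longleftrightarrow> 0 \<le> t" "1 / real k ^ n * t \<le> 1 \<longleftrightarrow> t \<le> real k ^ n" for t
        using kp[of n] by (auto simp: zero_le_divide_iff divide_le_eq dest: leD)
      then show ?thesis unfolding mem_carpet_stage_iff by (simp add: mem_box_cart)
    qed
    also have "(\<forall>j<n. \<exists>i. real k ^ Suc j * (1 / real k ^ n * x $ i) \<notin> hole_line k a (Suc 0)) \<longleftrightarrow>
       (\<forall>j<n. \<exists>i. x $ i \<notin> hole_line k a (Suc (n - Suc j)))"
    proof -
      have "real k ^ Suc j * (1 / real k ^ n * t) \<in> hole_line k a (Suc 0) \<longleftrightarrow>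
            t \<in> hole_line k a (Suc (n - Suc j))" if "j < n" for j t
      proof -
        have "real k ^ (n - Suc j) * (real k ^ Suc j * (1 / real k ^ n * t)) =
            real k ^ (n - Suc j + Suc j) * (1 / real k ^ n * t)"
          by (simp only: power_add mult.assoc)
        also have "\<dots> = t" using that k_ge by simp
        finally show ?thesis
          using hole_line_scale[of "n - Suc j" "real k ^ Suc j * (1 / real k ^ n * t)" 0] by simp
      qed
      then show ?thesis by simp
    qed
    also have "\<dots> \<longleftrightarrow> (\<forall>m<n. \<exists>i. x $ i \<notin> hole_line k a (Suc m))"
    proof
      assume H: "\<forall>j<n. \<exists>i. x $ i \<notin> hole_line k a (Suc (n - Suc j))"
      show "\<forall>m<n. \<exists>i. x $ i \<notin> hole_line k a (Suc m)"
      proof (intro allI impI)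
        fix m assume "m < n"
        then show "\<exists>i. x $ i \<notin> hole_line k a (Suc m)"
          using H[rule_format, of "n - Suc m"] by (simp add: Suc_diff_Suc)
      qed
    qed simp
    finally show ?thesis .
  qed
  show ?thesis
  proof
    assume "x \<in> pre_carpet k a"
    then obtain n where n: "n \<ge> 1" "x \<in> (\<lambda>x. (real k ^ n) *\<^sub>R x) ` carpet_stage k a n"
      unfolding pre_carpet_def by auto
    then have x: "\<And>i. 0 \<le> x $ i \<and> x $ i \<le> real k ^ n" "\<And>m. m < n \<Longrightarrow> \<exists>i. x $ i \<notin> hole_line k a (Suc m)"
      unfolding sc by blast+
    have "\<exists>i. x $ i \<notin> hole_line k a (Suc m)" for m
    proof (cases "m < n")
      case False
      have "x $ i \<notin> hole_line k a (Suc m)" for i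
      proof
        assume "x $ i \<in> hole_line k a (Suc m)"
        then have "real k ^ m < real k ^ n" using hole_line_ge[of "x $ i" m] x(1)[of i] by linarith
        moreover have "real k ^ n \<le> real k ^ m" using False k_ge by (intro power_increasing) auto
        ultimately show False by simp
      qed
      then show ?thesis by blast
    qed (use x in auto)
    then show "(\<forall>i. 0 \<le> x $ i) \<and> (\<forall>m. \<exists>i. x $ i \<notin> hole_line k a (Suc m))" using x by blast
  next
    assume R: "(\<forall>i. 0 \<le> x $ i) \<and> (\<forall>m. \<exists>i. x $ i \<notin> hole_line k a (Suc m))"
    obtain n where n: "norm x < real k ^ n"
      using real_arch_pow[of "real k" "norm x"] k_ge by auto
    have "x $ i \<le> real k ^ Suc n" for i
    proof -
      have "x $ i \<le> norm x" using component_le_norm_cart[of x i] by linarith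
      also note n
      also have "real k ^ n \<le> real k ^ Suc n" using k_ge by (intro power_increasing) auto
      finally show ?thesis by simp
    qed
    then have "x \<in> (\<lambda>x. (real k ^ Suc n) *\<^sub>R x) ` carpet_stage k a (Suc n)"
      unfolding sc using R by blast
    then show "x \<in> pre_carpet k a" unfolding pre_carpet_def by (intro UN_I[of "Suc n"]) auto
  qed
qed


section \<open>Vertices, unit cells and lattice paths\<close>

abbreviation pre :: "(real^'d) set" where "pre \<equiv> pre_carpet k a"
abbreviation V :: "(real^'d) set" where "V \<equiv> carpet_vertices k a"

text \<open>Adjacency by a king's move, diagonals included. These are the vertices whose bumps can
  reach the cell of \<open>v\<close>.\<close>

definition close :: "real^'d \<Rightarrow> real^'d \<Rightarrow> bool" where
  "close v w \<longleftrightarrow> (\<forall>i. \<bar>v $ i - w $ i\<bar> \<le> 1)"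

definition vtx :: "real^'d \<Rightarrow> real^'d" where
  "vtx x = (\<chi> i. of_int \<lfloor>x $ i\<rfloor> + 1/2)"

lemma mem_vertices_iff:
  "(v::real^'d) \<in> V \<longleftrightarrow> (\<forall>i. v $ i - 1/2 \<in> \<int>) \<and> (\<forall>i. 0 \<le> v $ i) \<and>
     (\<forall>m. \<exists>i. v $ i \<notin> hole_line k a (Suc m))"
  unfolding carpet_vertices_def mem_pre_carpet_iff by auto

text \<open>On a face between a kept and a removed cell the floor may select the removed one;
  interior points exclude this. A small shift along the all-ones vector brings \<open>x\<close> into
  the open cell selected by the floor without leaving the carpet, and open cells lie entirely inside
  or outside each hole.\<close>

lemma vtx_interior:
  assumes "(x::real^'d) \<in> interior pre"
  shows "vtx x \<in> V"
proof -
  have "((\<lambda>e. x + e *\<^sub>R 1) \<longlongrightarrow> x + 0 *\<^sub>R 1) (at_right (0::real))"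
    by (intro tendsto_intros)
  then have 1: "\<forall>\<^sub>F e in at_right 0. x + e *\<^sub>R 1 \<in> interior pre"
    using assms by (intro topological_tendstoD[where l = "x + 0 *\<^sub>R 1"]) auto
  have 2: "\<forall>\<^sub>F e in at_right 0. \<forall>i. x $ i + e < of_int \<lfloor>x $ i\<rfloor> + 1"
  proof (rule eventually_all_finite)
    fix i
    have "((\<lambda>e. x $ i + e) \<longlongrightarrow> x $ i + 0) (at_right (0::real))"
      by (intro tendsto_intros)
    then show "\<forall>\<^sub>F e in at_right 0. x $ i + e < of_int \<lfloor>x $ i\<rfloor> + 1"
      by (rule order_tendstoD) linarith
  qed
  have 3: "\<forall>\<^sub>F e in at_right 0. (0::real) < e" by (simp add: eventually_at_right_less)
  have "\<forall>\<^sub>F e in at_right 0. x + e *\<^sub>R 1 \<in> interior pre \<and> (\<forall>i. x $ i + e < of_int \<lfloor>x $ i\<rfloor> + 1) \<and> 0 < e"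
    using 1 2 3 by (intro eventually_conj)
  then obtain e where e: "x + e *\<^sub>R 1 \<in> interior pre" "\<And>i. x $ i + e < of_int \<lfloor>x $ i\<rfloor> + 1" "0 < e"
    using eventually_happens by fastforce
  define y where "y = x + e *\<^sub>R 1"
  have y: "y \<in> pre" "\<And>i. of_int \<lfloor>x $ i\<rfloor> < y $ i" "\<And>i. y $ i < of_int \<lfloor>x $ i\<rfloor> + 1"
    using e interior_subset unfolding y_def by (auto, linarith)
  have v: "vtx x $ i = of_int \<lfloor>x $ i\<rfloor> + 1/2" for i by (simp add: vtx_def)
  have "0 \<le> vtx x $ i" for i
  proof -
    have "0 \<le> y $ i" using y(1) unfolding mem_pre_carpet_iff by blast
    then have "\<lfloor>x $ i\<rfloor> \<ge> 0" using y(3)[of i] by linarith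
    then show ?thesis unfolding v by simp
  qed
  moreover have "\<exists>i. vtx x $ i \<notin> hole_line k a (Suc m)" for m
    using y(1) hole_line_unit_cell_iff[OF y(2,3)] unfolding mem_pre_carpet_iff v by blast
  ultimately show ?thesis unfolding mem_vertices_iff by (simp add: v)
qed

lemma cell_subset_pre_carpet:
  assumes "(v::real^'d) \<in> V" and "\<And>i. \<bar>x $ i - v $ i\<bar> \<le> 1/2"
  shows "x \<in> pre"
proof -
  have "\<exists>z::int. v $ i = of_int z + 1/2" for i
    using assms(1) unfolding mem_vertices_iff by (metis Ints_cases diff_add_cancel)
  then obtain z :: "'d \<Rightarrow> int" where z: "\<And>i. v $ i = of_int (z i) + 1/2" by metis
  have x: "of_int (z i) \<le> x $ i" "x $ i \<le> of_int (z i) + 1" for i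
    using assms(2)[of i] unfolding z by linarith+
  have "0 \<le> x $ i" for i
  proof -
    have "0 \<le> v $ i" using assms(1) unfolding mem_vertices_iff by blast
    then have "z i \<ge> 0" unfolding z by linarith
    then show ?thesis using x(1)[of i] by linarith
  qed
  moreover have "\<exists>i. x $ i \<notin> hole_line k a (Suc m)" for m
    using assms(1) hole_line_unit_cell[OF x] unfolding mem_vertices_iff z by blast
  ultimately show ?thesis unfolding mem_pre_carpet_iff by blast
qed

text \<open>The cells of the box spanned by \<open>v\<close> and \<open>v'\<close> that are missing all lie in the largest hole
  meeting the box. Changing last a coordinate in which \<open>v\<close> is outside the range of that hole
  gives a path from \<open>v\<close> to \<open>v'\<close>.\<close>
lemma ex_path_coordinate:
  assumes "(v::real^'d) \<in> V" "v' \<in> V" "close v v'"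
  shows "\<exists>i. \<forall>T. i \<notin> T \<longrightarrow> (\<chi> j. if j \<in> T then v' $ j else v $ j) \<in> V"
proof -
  define w where "w T = (\<chi> j. if j \<in> T then v' $ j else v $ j)" for T
  define inhole where "inhole x m \<longleftrightarrow> (\<forall>i. x $ i \<in> hole_line k a (Suc m))" for x :: "real^'d" and m
  have w_half: "w T $ j - 1/2 \<in> \<int>" "0 \<le> w T $ j" for T j
    using assms(1,2) unfolding mem_vertices_iff w_def by auto
  have wV: "w T \<in> V \<longleftrightarrow> (\<forall>m. \<not> inhole (w T) m)" for T
    unfolding mem_vertices_iff inhole_def using w_half by blast
  have w_close: "\<bar>w T $ j - w U $ j\<bar> \<le> 1" for T U j
    using assms(3) unfolding close_def w_def by (auto simp: abs_minus_commute)
  show ?thesis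
  proof (cases "\<forall>T. w T \<in> V")
    case True
    then show ?thesis unfolding w_def by blast
  next
    case False
    define Ms where "Ms = {m. \<exists>T. inhole (w T) m}"
    have "Ms \<noteq> {}" using False wV unfolding Ms_def by auto
    obtain n where n: "norm v + norm v' < real k ^ n"
      using real_arch_pow[of "real k" "norm v + norm v'"] k_ge by auto
    have "Ms \<subseteq> {..n}"
    proof
      fix m assume "m \<in> Ms"
      then obtain T where T: "inhole (w T) m" unfolding Ms_def by auto
      define j :: 'd where "j = undefined"
      have "real k ^ m < w T $ j"
        using T w_half(2) hole_line_ge unfolding inhole_def by blast
      also have "\<dots> \<le> norm v + norm v'"
        using component_le_norm_cart[of v j] component_le_norm_cart[of v' j] unfolding w_def by auto
      finally have "real k ^ m < real k ^ n" using n by simp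
      then have "m < n" using k_ge by (intro power_less_imp_less_exp[of "real k"]) auto
      then show "m \<in> {..n}" by simp
    qed
    then have fin: "finite Ms" using finite_subset by blast
    define m where "m = Max Ms"
    have "m \<in> Ms" unfolding m_def using fin \<open>Ms \<noteq> {}\<close> by (rule Max_in)
    then obtain U where U: "inhole (w U) m" unfolding Ms_def by auto
    have "w {} = v" unfolding w_def by (simp add: vec_eq_iff)
    then obtain i where i: "v $ i \<notin> hole_line k a (Suc m)"
      using assms(1) unfolding mem_vertices_iff by blast
    have "w T \<in> V" if "i \<notin> T" for T
      unfolding wV
    proof (intro allI notI)
      fix m' assume m': "inhole (w T) m'"
      then have "m' \<in> Ms" unfolding Ms_def by auto
      then have "m' \<le> m" unfolding m_def using fin by (rule Max_ge[rotated])
      have "w T $ i = v $ i" using that unfolding w_def by simp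
      then have nm: "\<not> inhole (w T) m" using i unfolding inhole_def by metis
      then have "m' < m" using m' \<open>m' \<le> m\<close> by (metis le_neq_implies_less)
      \<comment> \<open>\<open>w T\<close> would lie in a finer hole, hence well inside a cube of
        that level, so it agrees with its neighbour \<open>w U\<close> about the coarser level
        \<open>m\<close>. This contradicts the choice of \<open>i\<close>.\<close>
      then have "w T $ j \<in> hole_line k a (Suc m)" for j
        using hole_line_neighbour[OF w_half(1)[of T j] w_half(1)[of U j] w_close] m' U
        unfolding inhole_def by blast
      then show False using nm unfolding inhole_def by blast
    qed
    then show ?thesis unfolding w_def by blast
  qed
qed

text \<open>The path changes one coordinate at a time, \<open>i\<close> last, so it has at most
  CARD('d) edges. It never leaves the neighbourhood of \<open>v\<close>, hence \<open>M\<close> need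
  only bound the edges there; this keeps the later energy estimate local.\<close>

lemma diff_close_vertices:
  fixes g :: "real^'d \<Rightarrow> real" and M :: real
  assumes v: "v \<in> V" "v' \<in> V" "close v v'" and M: "0 \<le> M"
    and edge: "\<And>x y. x \<in> V \<Longrightarrow> y \<in> V \<Longrightarrow> dist x y = 1 \<Longrightarrow> close v x \<Longrightarrow> close v y \<Longrightarrow> \<bar>g x - g y\<bar> \<le> M"
  shows "\<bar>g v' - g v\<bar> \<le> CARD('d) * M"
proof -
  define w where "w T = (\<chi> j. if j \<in> T then v' $ j else v $ j)" for T
  obtain i where i: "\<And>T. i \<notin> T \<Longrightarrow> w T \<in> V"
    using ex_path_coordinate[OF v] unfolding w_def by blast
  have w0: "w {} = v" and w1: "w UNIV = v'" by (simp_all add: w_def vec_eq_iff)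
  have w_close: "close v (w T)" for T
    using v(3) unfolding close_def w_def by auto
  have step: "\<bar>g (w (insert j T)) - g (w T)\<bar> \<le> M" if "j \<notin> T" "w T \<in> V" "w (insert j T) \<in> V" for j T
  proof (cases "v' $ j = v $ j")
    case True
    then have "w (insert j T) = w T" unfolding w_def by (auto simp: vec_eq_iff)
    then show ?thesis using M by simp
  next
    case False
    have "v' $ j - 1/2 \<in> \<int>" "v $ j - 1/2 \<in> \<int>" using v(1,2) unfolding mem_vertices_iff by blast+
    then have "(v' $ j - 1/2) - (v $ j - 1/2) \<in> \<int>" by (rule Ints_diff)
    then obtain z :: int where z: "v' $ j - v $ j = of_int z" by (auto elim: Ints_cases)
    have "\<bar>v $ j - v' $ j\<bar> \<le> 1" using v(3) unfolding close_def by blast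
    then have "\<bar>z\<bar> = 1" using z False by linarith
    then have a1: "\<bar>v' $ j - v $ j\<bar> = 1" unfolding z by linarith
    have "w (insert j T) - w T = axis j (v' $ j - v $ j)"
      using that(1) unfolding w_def by (auto simp: vec_eq_iff axis_def)
    then have "dist (w (insert j T)) (w T) = 1"
      using a1 by (simp add: dist_norm norm_eq_sqrt_inner inner_axis_axis flip: power2_eq_square)
    then show ?thesis using edge[of "w (insert j T)" "w T"] that w_close by blast
  qed
  have ind: "finite T \<Longrightarrow> i \<notin> T \<Longrightarrow> \<bar>g (w T) - g v\<bar> \<le> card T * M" for T
  proof (induction T rule: finite_induct)
    case empty
    then show ?case by (simp add: w0)
  next
    case (insert j T)
    then have "\<bar>g (w T) - g v\<bar> \<le> card T * M" "\<bar>g (w (insert j T)) - g (w T)\<bar> \<le> M"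
      using i step[of j T] by auto
    then show ?case using insert by (simp add: algebra_simps)
  qed
  define n where "n = card (UNIV - {i})"
  have "\<bar>g (w (UNIV - {i})) - g v\<bar> \<le> real n * M" unfolding n_def by (rule ind) auto
  moreover have "insert i (UNIV - {i}) = UNIV" by auto
  then have "\<bar>g v' - g (w (UNIV - {i}))\<bar> \<le> M"
    using step[of i "UNIV - {i}"] i v(2) w1 by auto
  moreover have "CARD('d) = Suc n"
    unfolding n_def by (rule card_Suc_Diff1[symmetric]) auto
  then have "real CARD('d) * M = real n * M + M" by (simp only: of_nat_Suc) (simp add: distrib_right)
  ultimately show ?thesis by linarith
qed

end

section \<open>The symmetric semigroup\<close>

text \<open>Symmetry and the semigroup law are assumed only in integrated form, tested on sets,
  which is how a Markov process supplies them. Pointwise symmetry of the kernel is not part of the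
  interface.\<close>

locale symmetric_kernel =
  fixes k :: "real \<Rightarrow> 'a::euclidean_space \<Rightarrow> 'a \<Rightarrow> ennreal"
  assumes measurable_kernel: "\<And>t. 0 < t \<Longrightarrow> (\<lambda>(x, y). k t x y) \<in> borel_measurable (lborel \<Otimes>\<^sub>M lborel)"
    and mass_le_1: "\<And>t x. 0 < t \<Longrightarrow> (\<integral>\<^sup>+y. k t x y \<partial>lborel) \<le> 1"
    and symmetric_sets: "\<And>t A B. 0 < t \<Longrightarrow> A \<in> sets borel \<Longrightarrow> B \<in> sets borel \<Longrightarrow>
      (\<integral>\<^sup>+x. indicator A x * (\<integral>\<^sup>+y. k t x y * indicator B y \<partial>lborel) \<partial>lborel) =
      (\<integral>\<^sup>+x. indicator B x * (\<integral>\<^sup>+y. k t x y * indicator A y \<partial>lborel) \<partial>lborel)"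
    and semigroup_sets: "\<And>s t x B. 0 < s \<Longrightarrow> 0 < t \<Longrightarrow> B \<in> sets borel \<Longrightarrow>
      (\<integral>\<^sup>+y. k (s + t) x y * indicator B y \<partial>lborel) =
      (\<integral>\<^sup>+z. k s x z * (\<integral>\<^sup>+y. k t z y * indicator B y \<partial>lborel) \<partial>lborel)"
begin

definition T :: "real \<Rightarrow> ('a \<Rightarrow> ennreal) \<Rightarrow> 'a \<Rightarrow> ennreal" where
  "T t u x = (\<integral>\<^sup>+y. k t x y * u y \<partial>lborel)"

lemma measurable_k [measurable (raw)]:
  assumes "0 < t" "f \<in> M \<rightarrow>\<^sub>M borel" "g \<in> M \<rightarrow>\<^sub>M borel"
  shows "(\<lambda>x. k t (f x) (g x)) \<in> borel_measurable M"
proof -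
  have "(\<lambda>x. (f x, g x)) \<in> M \<rightarrow>\<^sub>M lborel \<Otimes>\<^sub>M lborel" using assms by simp
  from measurable_compose[OF this measurable_kernel[OF assms(1)]] show ?thesis by simp
qed

lemma measurable_T [measurable]:
  assumes [measurable]: "u \<in> borel_measurable borel" and [simp, measurable]: "0 < t"
  shows "T t u \<in> borel_measurable borel"
  unfolding T_def by measurable

lemma density_eq_imp_nn_integral_eq:
  assumes [measurable]: "f \<in> borel_measurable borel" "g \<in> borel_measurable borel" "u \<in> borel_measurable borel"
    and eq: "\<And>A. A \<in> sets borel \<Longrightarrow> (\<integral>\<^sup>+x. f x * indicator A x \<partial>lborel) = (\<integral>\<^sup>+x. g x * indicator A x \<partial>lborel)"
  shows "(\<integral>\<^sup>+x. f x * u x \<partial>lborel) = (\<integral>\<^sup>+x. g x * u x \<partial>lborel)"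
proof -
  have "density lborel f = density lborel g"
    by (rule measure_eqI) (simp_all add: emeasure_density eq)
  then have "(\<integral>\<^sup>+x. u x \<partial>density lborel f) = (\<integral>\<^sup>+x. u x \<partial>density lborel g)" by simp
  then show ?thesis by (simp add: nn_integral_density)
qed

text \<open>The identity for pairs of sets is extended to functions in one argument at a time. Each
  extension says that two densities agreeing on all sets have the same integrals; \<open>T'\<close>
  is the transposed operator, which Fubini moves to the other side.\<close>

lemma T_symmetric:
  assumes t [simp, measurable]: "0 < t"
    and [measurable]: "u \<in> borel_measurable borel" "v \<in> borel_measurable borel"
  shows "(\<integral>\<^sup>+x. u x * T t v x \<partial>lborel) = (\<integral>\<^sup>+x. v x * T t u x \<partial>lborel)"
proof -
  define T' where "T' f y = (\<integral>\<^sup>+x. f x * k t x y \<partial>lborel)" for f y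
  have [measurable]: "T' f \<in> borel_measurable borel" if [measurable]: "f \<in> borel_measurable borel" for f
    unfolding T'_def by measurable
  have fub: "(\<integral>\<^sup>+x. f x * T t g x \<partial>lborel) = (\<integral>\<^sup>+y. T' f y * g y \<partial>lborel)"
    if [measurable]: "f \<in> borel_measurable borel" "g \<in> borel_measurable borel" for f g
  proof -
    have "(\<integral>\<^sup>+x. f x * T t g x \<partial>lborel) = (\<integral>\<^sup>+x. \<integral>\<^sup>+y. f x * (k t x y * g y) \<partial>lborel \<partial>lborel)"
      unfolding T_def by (intro nn_integral_cong) (simp add: nn_integral_cmult)
    also have "\<dots> = (\<integral>\<^sup>+y. \<integral>\<^sup>+x. f x * (k t x y * g y) \<partial>lborel \<partial>lborel)"
      by (intro lborel_pair.Fubini') measurable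
    also have "\<dots> = (\<integral>\<^sup>+y. T' f y * g y \<partial>lborel)"
      unfolding T'_def by (intro nn_integral_cong) (simp add: nn_integral_multc flip: mult.assoc)
    finally show ?thesis .
  qed
  have 1: "(\<integral>\<^sup>+x. T t (indicator B) x * f x \<partial>lborel) = (\<integral>\<^sup>+x. T' (indicator B) x * f x \<partial>lborel)"
    if [measurable]: "B \<in> sets borel" "f \<in> borel_measurable borel" for B f
  proof (rule density_eq_imp_nn_integral_eq)
    fix A :: "'a set" assume [measurable]: "A \<in> sets borel"
    have "(\<integral>\<^sup>+x. T t (indicator B) x * indicator A x \<partial>lborel) = (\<integral>\<^sup>+x. indicator B x * T t (indicator A) x \<partial>lborel)"
      using symmetric_sets[of t A B] unfolding T_def by (simp add: mult.commute)
    also have "\<dots> = (\<integral>\<^sup>+x. T' (indicator B) x * indicator A x \<partial>lborel)" by (rule fub) measurable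
    finally show "(\<integral>\<^sup>+x. T t (indicator B) x * indicator A x \<partial>lborel) =
      (\<integral>\<^sup>+x. T' (indicator B) x * indicator A x \<partial>lborel)" .
  qed measurable
  have "(\<integral>\<^sup>+x. T' u x * v x \<partial>lborel) = (\<integral>\<^sup>+x. T t u x * v x \<partial>lborel)"
  proof (rule density_eq_imp_nn_integral_eq)
    fix B :: "'a set" assume [measurable]: "B \<in> sets borel"
    have "(\<integral>\<^sup>+x. T' u x * indicator B x \<partial>lborel) = (\<integral>\<^sup>+x. u x * T t (indicator B) x \<partial>lborel)"
      by (rule fub[symmetric]) measurable
    also have "\<dots> = (\<integral>\<^sup>+x. T' (indicator B) x * u x \<partial>lborel)"
      using 1[of B u] by (simp add: mult.commute)
    also have "\<dots> = (\<integral>\<^sup>+x. indicator B x * T t u x \<partial>lborel)" by (rule fub[symmetric]) measurable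
    finally show "(\<integral>\<^sup>+x. T' u x * indicator B x \<partial>lborel) = (\<integral>\<^sup>+x. T t u x * indicator B x \<partial>lborel)"
      by (simp add: mult.commute)
  qed measurable
  then show ?thesis using fub[of u v] by (simp add: mult.commute)
qed

lemma T_semigroup:
  assumes [simp, measurable]: "0 < s" "0 < t" and u [measurable]: "u \<in> borel_measurable borel"
  shows "T (s + t) u x = T s (T t u) x"
proof -
  have [simp, measurable]: "0 < s + t" by (simp add: add_pos_pos)
  define r where "r y = (\<integral>\<^sup>+z. k s x z * k t z y \<partial>lborel)" for y
  have [measurable]: "r \<in> borel_measurable borel" unfolding r_def by measurable
  have fub: "T s (T t f) x = (\<integral>\<^sup>+y. r y * f y \<partial>lborel)" if [measurable]: "f \<in> borel_measurable borel" for f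
  proof -
    have "T s (T t f) x = (\<integral>\<^sup>+z. \<integral>\<^sup>+y. k s x z * (k t z y * f y) \<partial>lborel \<partial>lborel)"
      unfolding T_def by (intro nn_integral_cong) (simp add: nn_integral_cmult)
    also have "\<dots> = (\<integral>\<^sup>+y. \<integral>\<^sup>+z. k s x z * (k t z y * f y) \<partial>lborel \<partial>lborel)"
      by (intro lborel_pair.Fubini') measurable
    also have "\<dots> = (\<integral>\<^sup>+y. r y * f y \<partial>lborel)"
      unfolding r_def by (intro nn_integral_cong) (simp add: nn_integral_multc flip: mult.assoc)
    finally show ?thesis .
  qed
  have "T (s + t) u x = (\<integral>\<^sup>+y. r y * u y \<partial>lborel)" unfolding T_def
  proof (rule density_eq_imp_nn_integral_eq)
    fix B :: "'a set" assume [measurable]: "B \<in> sets borel"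
    have "(\<integral>\<^sup>+y. k (s + t) x y * indicator B y \<partial>lborel) = T s (T t (indicator B)) x"
      unfolding T_def by (rule semigroup_sets) simp_all
    also have "\<dots> = (\<integral>\<^sup>+y. r y * indicator B y \<partial>lborel)" by (rule fub) measurable
    finally show "(\<integral>\<^sup>+y. k (s + t) x y * indicator B y \<partial>lborel) = (\<integral>\<^sup>+y. r y * indicator B y \<partial>lborel)" .
  qed measurable
  then show ?thesis using fub[OF u] by simp
qed

section \<open>The quadratic form of the semigroup and its positivity\<close>

definition form :: "real \<Rightarrow> ('a \<Rightarrow> ennreal) \<Rightarrow> ('a \<Rightarrow> ennreal) \<Rightarrow> ennreal" where
  "form t u v = (\<integral>\<^sup>+x. u x * T t v x \<partial>lborel)"

text \<open>This is the source of positivity: by symmetry half of the time can be moved to the other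
  argument, which leaves an inner product.\<close>

lemma form_double:
  assumes [simp]: "0 < t"
    and [measurable]: "u \<in> borel_measurable borel" "v \<in> borel_measurable borel"
  shows "form (2 * t) u v = (\<integral>\<^sup>+x. T t u x * T t v x \<partial>lborel)"
proof -
  have "form (2 * t) u v = (\<integral>\<^sup>+x. u x * T t (T t v) x \<partial>lborel)"
    unfolding form_def using T_semigroup[of t t v] by simp
  also have "\<dots> = (\<integral>\<^sup>+x. T t v x * T t u x \<partial>lborel)" by (rule T_symmetric) simp_all
  finally show ?thesis by (simp add: mult.commute)
qed

lemma ennreal_two_mult_le: "2 * (x * y) \<le> x * x + y * (y::ennreal)"
proof (cases x; cases y)
  fix a b :: real assume "x = ennreal a" "0 \<le> a" "y = ennreal b" "0 \<le> b"
  moreover have "2 * (a * b) \<le> a * a + b * b"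
    using sum_squares_bound[of a b] by (simp add: power2_eq_square)
  then have "ennreal (2 * (a * b)) \<le> ennreal (a * a + b * b)" by (rule ennreal_leI)
  ultimately show ?thesis by (simp add: ennreal_mult ennreal_plus)
qed (auto simp: ennreal_mult_top ennreal_top_mult)

text \<open>Positive definiteness in an additive form that needs neither subtraction nor square
  roots in \<open>ennreal\<close>: with t = 2s it is the pointwise inequality 2ab <= a^2 + b^2 for
  the functions at time \<open>s\<close>.\<close>

lemma two_form_le:
  assumes t: "0 < t"
    and [measurable]: "u \<in> borel_measurable borel" "v \<in> borel_measurable borel"
  shows "2 * form t u v \<le> form t u u + form t v v"
proof -
  define s where "s = t / 2"
  have [simp]: "0 < s" and ts: "t = 2 * s" using t by (simp_all add: s_def)
  have "2 * form t u v = (\<integral>\<^sup>+x. 2 * (T s u x * T s v x) \<partial>lborel)"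
    unfolding ts by (simp add: form_double nn_integral_cmult)
  also have "\<dots> \<le> (\<integral>\<^sup>+x. T s u x * T s u x + T s v x * T s v x \<partial>lborel)"
    by (intro nn_integral_mono ennreal_two_mult_le)
  also have "\<dots> = form t u u + form t v v"
    unfolding ts by (simp add: form_double nn_integral_add)
  finally show ?thesis .
qed

text \<open>This is \<open>\<parallel>u - T\<^sub>t u\<parallel>\<^sup>2 \<ge> 0\<close>.\<close>
lemma two_form_le_double:
  assumes [simp]: "0 < t" and [measurable]: "u \<in> borel_measurable borel"
  shows "2 * form t u u \<le> (\<integral>\<^sup>+x. u x * u x \<partial>lborel) + form (2 * t) u u"
proof -
  have "2 * form t u u = (\<integral>\<^sup>+x. 2 * (u x * T t u x) \<partial>lborel)"
    unfolding form_def by (simp add: nn_integral_cmult)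
  also have "\<dots> \<le> (\<integral>\<^sup>+x. u x * u x + T t u x * T t u x \<partial>lborel)"
    by (intro nn_integral_mono ennreal_two_mult_le)
  also have "\<dots> = (\<integral>\<^sup>+x. u x * u x \<partial>lborel) + form (2 * t) u u"
    by (simp add: form_double nn_integral_add)
  finally show ?thesis .
qed

lemma T_le:
  assumes "0 < t" "\<And>y. u y \<le> b"
  shows "T t u x \<le> b"
proof -
  have "T t u x \<le> (\<integral>\<^sup>+y. k t x y * b \<partial>lborel)"
    unfolding T_def using assms by (intro nn_integral_mono mult_left_mono) auto
  also have "\<dots> = (\<integral>\<^sup>+y. k t x y \<partial>lborel) * b" using assms(1) by (intro nn_integral_multc) measurable
  also have "\<dots> \<le> 1 * b" using mass_le_1[OF assms(1)] by (intro mult_right_mono) auto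
  finally show ?thesis by simp
qed

text \<open>Off-diagonal values are controlled by diagonal ones because the kernel is positive definite;
  this is tested on indicators of small balls.\<close>
lemma kernel_le_of_diagonal:
  fixes q :: "'a \<Rightarrow> 'a \<Rightarrow> real"
  assumes t: "0 < t" and U: "open U"
    and cont: "continuous_on (U \<times> U) (\<lambda>(x, y). q x y)"
    and q: "\<And>x y. x \<in> U \<Longrightarrow> y \<in> U \<Longrightarrow> k t x y = ennreal (q x y)"
    and diag: "\<And>x. x \<in> U \<Longrightarrow> q x x \<le> c" and c: "0 \<le> c"
    and xy: "x0 \<in> U" "y0 \<in> U"
  shows "q x0 y0 \<le> c"
proof (rule ccontr)
  assume "\<not> q x0 y0 \<le> c"
  \<comment> \<open>Near the diagonal points the kernel stays below \<open>b\<close>, near (x0, y0)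
    it stays above \<open>b'\<close>; the gap between the two produces the contradiction.\<close>
  then obtain b b' where b: "c < b" "b < b'" "b' < q x0 y0" by (metis dense not_le)
  have UU: "open (U \<times> U)" using U by (simp add: open_Times)
  have nbhd: "\<exists>r>0. \<forall>x\<in>ball x1 r. \<forall>y\<in>ball y1 r. x \<in> U \<and> y \<in> U \<and> P (q x y)"
    if "x1 \<in> U" "y1 \<in> U" "P (q x1 y1)" "open {z. P z}" for x1 y1 P
  proof -
    have "open ((\<lambda>(x, y). q x y) -` {z. P z} \<inter> U \<times> U)"
      using continuous_on_open_vimage[OF UU, of "\<lambda>(x, y). q x y"] cont that by blast
    moreover have "(x1, y1) \<in> (\<lambda>(x, y). q x y) -` {z. P z} \<inter> U \<times> U" using that by simp
    ultimately obtain A B where "open A" "open B" "(x1, y1) \<in> A \<times> B"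
        and AB5: "A \<times> B \<subseteq> (\<lambda>(x, y). q x y) -` {z. P z} \<inter> U \<times> U"
      by (rule open_prod_elim)
    then have AB: "open A" "open B" "x1 \<in> A" "y1 \<in> B" by auto
    obtain r1 r2 where r: "r1 > 0" "r2 > 0" "ball x1 r1 \<subseteq> A" "ball y1 r2 \<subseteq> B"
      using AB using open_contains_ball by meson
    have "x \<in> U \<and> y \<in> U \<and> P (q x y)" if "x \<in> ball x1 (min r1 r2)" "y \<in> ball y1 (min r1 r2)" for x y
    proof -
      have "x \<in> A" "y \<in> B" using that r(3,4) by auto
      then have "(x, y) \<in> A \<times> B" by simp
      then have "(x, y) \<in> (\<lambda>(x, y). q x y) -` {z. P z} \<inter> U \<times> U" using AB5 by blast
      then show ?thesis by simp
    qed
    then show ?thesis using r(1,2) by (intro exI[of _ "min r1 r2"]) auto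
  qed
  obtain r1 where r1: "r1 > 0" "\<And>x y. x \<in> ball x0 r1 \<Longrightarrow> y \<in> ball x0 r1 \<Longrightarrow> x \<in> U \<and> y \<in> U \<and> q x y < b"
    using nbhd[of x0 x0 "\<lambda>z. z < b"] xy diag[of x0] b(1) open_lessThan[of b, unfolded lessThan_def] by force
  obtain r2 where r2: "r2 > 0" "\<And>x y. x \<in> ball y0 r2 \<Longrightarrow> y \<in> ball y0 r2 \<Longrightarrow> x \<in> U \<and> y \<in> U \<and> q x y < b"
    using nbhd[of y0 y0 "\<lambda>z. z < b"] xy diag[of y0] b(1) open_lessThan[of b, unfolded lessThan_def] by force
  obtain r3 where r3: "r3 > 0" "\<And>x y. x \<in> ball x0 r3 \<Longrightarrow> y \<in> ball y0 r3 \<Longrightarrow> x \<in> U \<and> y \<in> U \<and> b' < q x y"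
    using nbhd[of x0 y0 "\<lambda>z. b' < z"] xy b(3) open_greaterThan[of b', unfolded greaterThan_def] by force
  \<comment> \<open>One radius for all balls gives them equal volume \<open>m\<close>, so that the
    factor \<open>m * m\<close> cancels in the end.\<close>
  define r where "r = min r1 (min r2 r3)"
  have r: "r > 0" using r1 r2 r3 by (simp add: r_def)
  define m where "m = measure lborel (ball x0 r)"
  have mx: "emeasure lborel (ball z r) = ennreal m" for z :: 'a
  proof -
    have "emeasure lborel (ball z r) = emeasure lborel (ball x0 r)"
      using r by (simp add: emeasure_ball)
    then show ?thesis unfolding m_def using emeasure_lborel_ball_finite[of x0 r] by (simp add: emeasure_eq_ennreal_measure)
  qed
  have m: "m > 0" unfolding m_def using r by (simp add: content_ball_pos)
  have two_int: "(\<integral>\<^sup>+x. indicator (ball z r) x * (\<integral>\<^sup>+y. ennreal d * indicator (ball w r) y \<partial>lborel) \<partial>lborel) = ennreal (d * m * m)"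
    if "0 \<le> d" for d and z w :: 'a
  proof -
    have "(\<integral>\<^sup>+x. indicator (ball z r) x * (\<integral>\<^sup>+y. ennreal d * indicator (ball w r) y \<partial>lborel) \<partial>lborel)
       = (\<integral>\<^sup>+x. (ennreal d * ennreal m) * indicator (ball z r) x \<partial>lborel)"
      by (intro nn_integral_cong) (simp add: nn_integral_cmult_indicator mx mult.commute)
    also have "\<dots> = ennreal d * ennreal m * ennreal m"
      by (simp add: nn_integral_cmult_indicator mx)
    finally have "(\<integral>\<^sup>+x. indicator (ball z r) x * (\<integral>\<^sup>+y. ennreal d * indicator (ball w r) y \<partial>lborel) \<partial>lborel)
       = ennreal d * ennreal m * ennreal m" .
    then show ?thesis using m that by (simp add: ennreal_mult mult_ac)
  qed
  have up: "form t (indicator (ball z r)) (indicator (ball z r)) \<le> ennreal (b * m * m)"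
    if "\<And>x y. x \<in> ball z r \<Longrightarrow> y \<in> ball z r \<Longrightarrow> k t x y \<le> ennreal b" for z
  proof -
    have "form t (indicator (ball z r)) (indicator (ball z r)) \<le>
       (\<integral>\<^sup>+x. indicator (ball z r) x * (\<integral>\<^sup>+y. ennreal b * indicator (ball z r) y \<partial>lborel) \<partial>lborel)"
      unfolding form_def T_def using that
      by (auto intro!: nn_integral_mono split: split_indicator)
    then show ?thesis using two_int b c by simp
  qed
  have "ennreal (b' * m * m) = (\<integral>\<^sup>+x. indicator (ball x0 r) x * (\<integral>\<^sup>+y. ennreal b' * indicator (ball y0 r) y \<partial>lborel) \<partial>lborel)"
    using two_int b c by simp
  also have "\<dots> \<le> form t (indicator (ball x0 r)) (indicator (ball y0 r))"
  proof -
    have "ennreal b' \<le> k t x y" if "x \<in> ball x0 r" "y \<in> ball y0 r" for x y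
      using r3(2)[of x y] that q[of x y] unfolding r_def by (auto intro: ennreal_leI)
    then show ?thesis unfolding form_def T_def
      by (auto intro!: nn_integral_mono split: split_indicator)
  qed
  finally have "2 * ennreal (b' * m * m) \<le> 2 * form t (indicator (ball x0 r)) (indicator (ball y0 r))"
    by (intro mult_left_mono) auto
  also have "\<dots> \<le> form t (indicator (ball x0 r)) (indicator (ball x0 r)) + form t (indicator (ball y0 r)) (indicator (ball y0 r))"
    using t by (intro two_form_le borel_measurable_indicator) simp_all
  also have "\<dots> \<le> ennreal (b * m * m) + ennreal (b * m * m)"
  proof (intro add_mono up)
    fix x y
    show "k t x y \<le> ennreal b" if "x \<in> ball x0 r" "y \<in> ball x0 r"
      using r1(2)[of x y] that q[of x y] unfolding r_def by (auto intro: ennreal_leI)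
    show "k t x y \<le> ennreal b" if "x \<in> ball y0 r" "y \<in> ball y0 r"
      using r2(2)[of x y] that q[of x y] unfolding r_def by (auto intro: ennreal_leI)
  qed
  finally have "ennreal (b' * m * m) + ennreal (b' * m * m) \<le> ennreal (b * m * m) + ennreal (b * m * m)"
    unfolding mult_2 .
  then have "ennreal (b' * m * m + b' * m * m) \<le> ennreal (b * m * m + b * m * m)"
    using b c m by (subst (1 2) ennreal_plus) auto
  then have "b' * m * m \<le> b * m * m" using b c m by (simp add: ennreal_le_iff del: ennreal_plus)
  then show False using m b by (simp add: mult_le_cancel_right)
qed

lemma form_le_of_kernel_le:
  assumes "0 < t" and [measurable]: "u \<in> borel_measurable borel"
    and le: "\<And>x y. u x \<noteq> 0 \<Longrightarrow> u y \<noteq> 0 \<Longrightarrow> k t x y \<le> c"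
  shows "form t u u \<le> c * ((\<integral>\<^sup>+x. u x \<partial>lborel) * (\<integral>\<^sup>+x. u x \<partial>lborel))"
proof -
  have "form t u u \<le> (\<integral>\<^sup>+x. u x * (\<integral>\<^sup>+y. c * u y \<partial>lborel) \<partial>lborel)"
    unfolding form_def
  proof (intro nn_integral_mono)
    fix x
    show "u x * T t u x \<le> u x * (\<integral>\<^sup>+y. c * u y \<partial>lborel)"
    proof (cases "u x = 0")
      case False
      have "k t x y * u y \<le> c * u y" for y
        using le[OF False, of y] by (cases "u y = 0") (auto intro: mult_right_mono)
      then show ?thesis unfolding T_def by (intro mult_left_mono nn_integral_mono) auto
    qed simp
  qed
  also have "\<dots> = c * ((\<integral>\<^sup>+x. u x \<partial>lborel) * (\<integral>\<^sup>+x. u x \<partial>lborel))"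
    by (simp add: nn_integral_cmult nn_integral_multc mult_ac)
  finally show ?thesis .
qed

end

section \<open>Reflecting Brownian motion\<close>

lemma space_path_space: "space (path_space S I) = {\<omega>. continuous_on {0..} \<omega> \<and> \<omega> ` {0..} \<subseteq> S}"
  unfolding path_space_def Let_def by (rule space_measure_of) auto

lemma measurable_coordinate:
  assumes "t \<in> I"
  shows "(\<lambda>\<omega>. \<omega> t) \<in> path_space S I \<rightarrow>\<^sub>M borel"
proof (rule measurableI)
  fix B :: "'a set" assume B: "B \<in> sets borel"
  let ?\<Omega> = "{\<omega>. continuous_on {0..} \<omega> \<and> \<omega> ` {0..} \<subseteq> S}"
  have "(\<lambda>\<omega>. \<omega> t) -` B \<inter> space (path_space S I) = {\<omega> \<in> ?\<Omega>. \<omega> t \<in> B}"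
    unfolding space_path_space by auto
  also have "\<dots> \<in> sets (path_space S I)"
    unfolding path_space_def Let_def using assms B
    by (intro in_measure_of) auto
  finally show "(\<lambda>\<omega>. \<omega> t) -` B \<inter> space (path_space S I) \<in> sets (path_space S I)" .
qed simp

locale reflecting_bm =
  fixes S :: "'a::euclidean_space set" and P and q :: "real \<Rightarrow> 'a \<Rightarrow> 'a \<Rightarrow> real"
  assumes closed_S: "closed S"
    and rbm: "reflecting_brownian_motion S P"
    and dens: "transition_density S P q"
begin

text \<open>The density \<open>q\<close> is unconstrained outside \<open>S\<close>. Extension by 0
  gives a kernel on the whole space, to which \<open>symmetric_kernel\<close> applies.\<close>

definition K :: "real \<Rightarrow> 'a \<Rightarrow> 'a \<Rightarrow> ennreal" where
  "K t x y = ennreal (q t x y) * indicator S x * indicator S y"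

lemma borel_S [measurable]: "S \<in> sets borel"
  using closed_S by (rule borel_closed)

lemma path_measure:
  assumes "x \<in> S"
  shows "prob_space (P x)" "sets (P x) = sets (path_space S {0..})"
proof -
  have "P x \<in> space (prob_algebra (path_space S {0..}))"
    using rbm assms unfolding reflecting_brownian_motion_def
    by (auto dest!: measurable_space[of P _ _ x] simp: space_restrict_space)
  then show "prob_space (P x)" "sets (P x) = sets (path_space S {0..})"
    by (auto simp: space_prob_algebra)
qed

lemma measurable_P_coordinate:
  assumes "x \<in> S" "0 \<le> t"
  shows "(\<lambda>\<omega>. \<omega> t) \<in> P x \<rightarrow>\<^sub>M borel"
  using measurable_coordinate[of t "{0..}" S] assms(2) measurable_cong_sets[OF path_measure(2)[OF assms(1)] refl]
  by auto

lemma space_P: "x \<in> S \<Longrightarrow> space (P x) = {\<omega>. continuous_on {0..} \<omega> \<and> \<omega> ` {0..} \<subseteq> S}"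
  using sets_eq_imp_space_eq[OF path_measure(2)] space_path_space by metis

lemma transition_eq:
  assumes "x \<in> S" "0 < t" "B \<in> sets borel"
  shows "transition P t x B = (\<integral>\<^sup>+y. K t x y * indicator B y \<partial>lborel)"
proof -
  have "transition P t x B = (\<integral>\<^sup>+y\<in>B \<inter> S. ennreal (q t x y) \<partial>lborel)"
    using dens assms unfolding transition_density_def by blast
  also have "\<dots> = (\<integral>\<^sup>+y. K t x y * indicator B y \<partial>lborel)"
    using assms(1) unfolding K_def by (intro nn_integral_cong) (auto split: split_indicator)
  finally show ?thesis .
qed

lemma measurable_K: "0 < t \<Longrightarrow> (\<lambda>(x, y). K t x y) \<in> borel_measurable (lborel \<Otimes>\<^sub>M lborel)"
proof -
  assume t: "0 < t"
  have "(\<lambda>p. indicator (S \<times> S) p *\<^sub>R (case p of (x, y) \<Rightarrow> q t x y)) \<in> borel_measurable borel"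
    using dens t closed_S unfolding transition_density_def
    by (intro borel_measurable_continuous_on_indicator) (auto intro: borel_closed closed_Times)
  then have "(\<lambda>p. ennreal (indicator (S \<times> S) p *\<^sub>R (case p of (x, y) \<Rightarrow> q t x y))) \<in> borel_measurable borel"
    by simp
  also have "(\<lambda>p. ennreal (indicator (S \<times> S) p *\<^sub>R (case p of (x, y) \<Rightarrow> q t x y))) = (\<lambda>(x, y). K t x y)"
    unfolding K_def by (auto simp: fun_eq_iff split: split_indicator)
  finally show ?thesis by (simp add: lborel_prod)
qed

lemma measurable_K' [measurable (raw)]:
  assumes "0 < t" "f \<in> M \<rightarrow>\<^sub>M borel" "g \<in> M \<rightarrow>\<^sub>M borel"
  shows "(\<lambda>x. K t (f x) (g x)) \<in> borel_measurable M"
proof -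
  have "(\<lambda>x. (f x, g x)) \<in> M \<rightarrow>\<^sub>M lborel \<Otimes>\<^sub>M lborel" using assms by simp
  from measurable_compose[OF this measurable_K[OF assms(1)]] show ?thesis by simp
qed

lemma nn_integral_path:
  assumes x: "x \<in> S" and t [measurable]: "0 < t" and f [measurable]: "f \<in> borel_measurable borel"
  shows "(\<integral>\<^sup>+\<omega>. f (\<omega> t) \<partial>P x) = (\<integral>\<^sup>+y. K t x y * f y \<partial>lborel)"
proof -
  have m: "(\<lambda>\<omega>. \<omega> t) \<in> P x \<rightarrow>\<^sub>M borel" using x t by (intro measurable_P_coordinate) auto
  have "distr (P x) borel (\<lambda>\<omega>. \<omega> t) = density lborel (K t x)"
  proof (rule measure_eqI)
    fix B :: "'a set" assume "B \<in> sets (distr (P x) borel (\<lambda>\<omega>. \<omega> t))"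
    then have [measurable]: "B \<in> sets borel" by simp
    have "emeasure (distr (P x) borel (\<lambda>\<omega>. \<omega> t)) B = transition P t x B"
      using m unfolding transition_def
      by (subst emeasure_distr) (auto intro!: arg_cong2[where f = emeasure])
    then show "emeasure (distr (P x) borel (\<lambda>\<omega>. \<omega> t)) B = emeasure (density lborel (K t x)) B"
      using x t by (simp add: transition_eq emeasure_density)
  qed simp
  then have "(\<integral>\<^sup>+y. f y \<partial>distr (P x) borel (\<lambda>\<omega>. \<omega> t)) = (\<integral>\<^sup>+y. f y \<partial>density lborel (K t x))" by simp
  then show ?thesis using m by (simp add: nn_integral_distr nn_integral_density)
qed

sublocale symmetric_kernel K
proof
  show "0 < t \<Longrightarrow> (\<lambda>(x, y). K t x y) \<in> borel_measurable (lborel \<Otimes>\<^sub>M lborel)" for t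
    by (rule measurable_K)
next
  fix t :: real and x :: 'a assume t: "0 < t"
  show "(\<integral>\<^sup>+y. K t x y \<partial>lborel) \<le> 1"
  proof (cases "x \<in> S")
    case True
    have "(\<integral>\<^sup>+y. K t x y \<partial>lborel) = emeasure (P x) (space (P x))"
      using nn_integral_path[OF True t, of "\<lambda>_. 1"] by simp
    then show ?thesis using prob_space.emeasure_space_1[OF path_measure(1)[OF True]] by simp
  qed (simp add: K_def)
next
  fix t :: real and A B :: "'a set" assume t: "0 < t" and [measurable]: "A \<in> sets borel" "B \<in> sets borel"
  have *: "(\<integral>\<^sup>+x\<in>A \<inter> S. transition P t x B \<partial>lborel) =
      (\<integral>\<^sup>+x. indicator A x * (\<integral>\<^sup>+y. K t x y * indicator B y \<partial>lborel) \<partial>lborel)"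
    if [measurable]: "A \<in> sets borel" "B \<in> sets borel" for A B
  proof (rule nn_integral_cong)
    fix x
    show "transition P t x B * indicator (A \<inter> S) x = indicator A x * (\<integral>\<^sup>+y. K t x y * indicator B y \<partial>lborel)"
      using transition_eq[of x t B] t by (cases "x \<in> S") (auto simp: K_def split: split_indicator)
  qed
  have "(\<integral>\<^sup>+x\<in>A \<inter> S. transition P t x B \<partial>lborel) = (\<integral>\<^sup>+x\<in>B \<inter> S. transition P t x A \<partial>lborel)"
    using rbm t unfolding reflecting_brownian_motion_def by simp
  then show "(\<integral>\<^sup>+x. indicator A x * (\<integral>\<^sup>+y. K t x y * indicator B y \<partial>lborel) \<partial>lborel) =
      (\<integral>\<^sup>+x. indicator B x * (\<integral>\<^sup>+y. K t x y * indicator A y \<partial>lborel) \<partial>lborel)"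
    by (simp add: *)
next
  fix s t :: real and x :: 'a and B :: "'a set"
  assume st: "0 < s" "0 < t" and [measurable]: "B \<in> sets borel"
  note [measurable] = st
  show "(\<integral>\<^sup>+y. K (s + t) x y * indicator B y \<partial>lborel) =
      (\<integral>\<^sup>+z. K s x z * (\<integral>\<^sup>+y. K t z y * indicator B y \<partial>lborel) \<partial>lborel)"
  proof (cases "x \<in> S")
    case True
    \<comment> \<open>The Markov property is used with the sure event, which belongs to the past up
      to time \<open>s\<close>; this is the Chapman-Kolmogorov equation.\<close>
    have top: "space (P x) \<in> sets (path_space S {0..s})"
      unfolding space_P[OF True] space_path_space[of S "{0..s}", symmetric] by simp
    have "(\<integral>\<^sup>+y. K (s + t) x y * indicator B y \<partial>lborel) = transition P (s + t) x B"
      using True st by (simp add: transition_eq)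
    also have "\<dots> = (\<integral>\<^sup>+\<omega>\<in>space (P x). transition P t (\<omega> s) B \<partial>P x)"
      using rbm True st top unfolding reflecting_brownian_motion_def transition_def by simp
    also have "\<dots> = (\<integral>\<^sup>+\<omega>. (\<integral>\<^sup>+y. K t (\<omega> s) y * indicator B y \<partial>lborel) \<partial>P x)"
    proof (rule nn_integral_cong)
      fix \<omega> assume w: "\<omega> \<in> space (P x)"
      then have "\<omega> s \<in> S" using True st by (auto simp: space_P)
      then show "transition P t (\<omega> s) B * indicator (space (P x)) \<omega> = (\<integral>\<^sup>+y. K t (\<omega> s) y * indicator B y \<partial>lborel)"
        using w st by (simp add: transition_eq)
    qed
    also have "\<dots> = (\<integral>\<^sup>+z. K s x z * (\<integral>\<^sup>+y. K t z y * indicator B y \<partial>lborel) \<partial>lborel)"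
      using True st by (intro nn_integral_path) measurable
    finally show ?thesis .
  qed (simp add: K_def)
qed

text \<open>By \<open>two_form_le_double\<close> the quotient (||u||^2 - <u, T_t u>) / t does not
  decrease when \<open>t\<close> is halved. It is therefore bounded by its limit along t / 2^n,
  which is the Dirichlet form of \<open>u\<close>.\<close>

lemma energy_ge_difference_quotient:
  fixes u :: "'a \<Rightarrow> real"
  assumes [measurable]: "u \<in> borel_measurable borel"
    and u: "\<And>x. 0 \<le> u x" "\<And>x. u x \<le> b" and uS: "\<And>x. x \<notin> S \<Longrightarrow> u x = 0"
    and fin: "(\<integral>\<^sup>+x. ennreal (u x) \<partial>lborel) < \<infinity>"
    and e: "sobolev_energy (interior S) u \<le> ennreal e" "0 \<le> e" and t: "0 < t"
  shows "(\<integral>\<^sup>+x. ennreal ((u x)\<^sup>2) \<partial>lborel) \<le> form t u u + ennreal (t * e)"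
proof -
  have b: "0 \<le> b" using u by (meson order_trans)
  have int_u: "integrable lborel u"
    using fin u by (intro integrableI_nonneg) auto
  have int_mult: "integrable lborel (\<lambda>x. u x * g x)"
    if [measurable]: "g \<in> borel_measurable borel" and "\<And>x. 0 \<le> g x" "\<And>x. g x \<le> b" for g
  proof (rule Bochner_Integration.integrable_bound)
    show "integrable lborel (\<lambda>x. b * u x)" using int_u by simp
    have "norm (u x * g x) \<le> norm (b * u x)" for x
      using that(2,3)[of x] u(1)[of x] b by (simp add: abs_mult mult.commute mult_right_mono)
    then show "AE x in lborel. norm (u x * g x) \<le> norm (b * u x)" by simp
  qed measurable
  have sq: "square_integrable_on u S"
  proof -
    have "indicator S x *\<^sub>R (norm (u x))\<^sup>2 = u x * u x" for x
      using uS by (auto simp: power2_eq_square split: split_indicator)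
    then show ?thesis using int_mult[of u] u
      unfolding square_integrable_on_def set_borel_measurable_def set_integrable_def by simp
  qed
  define Tr where "Tr t x = enn2real (T t u x)" for t x
  have T_le_b: "T t u x \<le> ennreal b" if "0 < t" for t x
    using that u by (intro T_le) (auto intro: ennreal_leI)
  have Tr: "ennreal (Tr t x) = T t u x" "0 \<le> Tr t x" "Tr t x \<le> b" if "0 < t" for t x
  proof -
    show "ennreal (Tr t x) = T t u x" unfolding Tr_def
      using T_le_b[OF that, of x] le_less_trans[OF _ ennreal_less_top] by (simp add: less_top)
    then show "Tr t x \<le> b" using T_le_b[OF that, of x] b by (metis ennreal_le_iff)
  qed (simp add: Tr_def)
  have [measurable]: "Tr t \<in> borel_measurable borel" if [measurable]: "0 < t" for t
    unfolding Tr_def by measurable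
  define A where "A = (\<integral>x. u x * u x \<partial>lborel)"
  define F where "F t = (\<integral>x. u x * Tr t x \<partial>lborel)" for t
  have A: "(\<integral>\<^sup>+x. ennreal (u x) * ennreal (u x) \<partial>lborel) = ennreal A"
    unfolding A_def using int_mult[of u] u
    by (subst nn_integral_eq_integral[symmetric]) (auto simp: ennreal_mult)
  have F: "form t u u = ennreal (F t)" if "0 < t" for t
    unfolding F_def form_def using int_mult[of "Tr t"] u Tr[OF that] that
    by (subst nn_integral_eq_integral[symmetric]) (auto simp: ennreal_mult)
  have F0: "0 \<le> F t" if "0 < t" for t
    unfolding F_def using u Tr[OF that] by (intro integral_nonneg_AE) auto
  have A0: "0 \<le> A" unfolding A_def by (intro integral_nonneg_AE) auto
  have quot: "(LINT x:S|lborel. (u x - (\<integral>\<omega>. u (\<omega> t) \<partial>P x)) * u x) = A - F t" if "0 < t" for t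
  proof -
    have "indicator S x *\<^sub>R ((u x - (\<integral>\<omega>. u (\<omega> t) \<partial>P x)) * u x) = u x * u x - u x * Tr t x" for x
    proof (cases "x \<in> S")
      case True
      have "(\<lambda>\<omega>. u (\<omega> t)) \<in> borel_measurable (P x)"
        using measurable_compose[OF measurable_P_coordinate[OF True, of t] assms(1)] that by simp
      then have "(\<integral>\<omega>. u (\<omega> t) \<partial>P x) = enn2real (\<integral>\<^sup>+\<omega>. ennreal (u (\<omega> t)) \<partial>P x)"
        using u by (intro integral_eq_nn_integral) auto
      also have "\<dots> = Tr t x" unfolding Tr_def T_def
        using nn_integral_path[OF True that, of "\<lambda>y. ennreal (u y)"] by simp
      finally show ?thesis using True by (simp add: algebra_simps)
    qed (simp add: uS)
    then show ?thesis unfolding set_lebesgue_integral_def A_def F_def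
      using int_mult[of u] int_mult[of "Tr t"] Tr[OF that] u that by simp
  qed
  define h where "h t = (A - F t) / t" for t
  have lim: "((\<lambda>t. ennreal ((LINT x:S|lborel. (u x - (\<integral>\<omega>. u (\<omega> t) \<partial>P x)) * u x) / t))
          \<longlongrightarrow> sobolev_energy (interior S) u) (at_right 0)"
    using rbm sq unfolding reflecting_brownian_motion_def by blast
  have half: "h t \<le> h (t / 2)" if "0 < t" for t
  proof -
    have "2 * form (t / 2) u u \<le> (\<integral>\<^sup>+x. ennreal (u x) * ennreal (u x) \<partial>lborel) + form t u u"
      using two_form_le_double[of "t / 2" u] that by simp
    then have "ennreal (2 * F (t / 2)) \<le> ennreal (A + F t)"
      using that A0 F0[of t] F0[of "t/2"] by (simp add: F A ennreal_mult)
    then have "2 * F (t / 2) \<le> A + F t" using that A0 F0[of t] by (simp add: ennreal_le_iff del: ennreal_plus)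
    then have "(A - F t) / t \<le> (2 * A - 2 * F (t / 2)) / t"
      using that by (intro divide_right_mono) auto
    also have "\<dots> = h (t / 2)" unfolding h_def using that by (simp add: field_simps)
    finally show ?thesis unfolding h_def .
  qed
  have pow: "h t \<le> h (t / 2 ^ n)" for n
  proof (induction n)
    case (Suc n)
    have "h (t / 2 ^ n) \<le> h (t / 2 ^ n / 2)" using t by (intro half) simp
    then show ?case using Suc by (simp add: field_simps)
  qed simp
  have "filterlim (\<lambda>n. t / 2 ^ n) (at_right 0) sequentially"
    unfolding filterlim_at_right_to_0
    using t by (intro filterlim_at_withinI) (auto intro!: LIMSEQ_divide_realpow_zero)
  from filterlim_compose[OF lim this]
  have "(\<lambda>n. ennreal (h (t / 2 ^ n))) \<longlonglongrightarrow> sobolev_energy (interior S) u"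
    using t unfolding h_def by (simp add: quot)
  then have "ennreal (h t) \<le> sobolev_energy (interior S) u"
    by (rule LIMSEQ_le_const) (auto intro: ennreal_leI pow)
  also note e(1)
  finally have "h t \<le> e" using e(2) by (simp add: ennreal_le_iff)
  then have "A \<le> F t + t * e" unfolding h_def using t by (simp add: field_simps)
  then have "ennreal A \<le> ennreal (F t + t * e)" by (rule ennreal_leI)
  also have "\<dots> = form t u u + ennreal (t * e)"
    using t e(2) F0[OF t] by (simp add: F)
  finally show ?thesis using u unfolding A[symmetric] power2_eq_square by (simp add: ennreal_mult)
qed

text \<open>Part of the L2 norm is paid for by the energy, the rest by the kernel bound. The
  function has to vanish off the interior because the off-diagonal bound was obtained from small
  balls, hence only at interior points.\<close>

lemma nash_inequality:
  fixes u :: "'a \<Rightarrow> real"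
  assumes [measurable]: "u \<in> borel_measurable borel"
    and u: "\<And>x. 0 \<le> u x" "\<And>x. u x \<le> b" and uS: "\<And>x. x \<notin> interior S \<Longrightarrow> u x = 0"
    and N: "(\<integral>\<^sup>+x. ennreal (u x) \<partial>lborel) \<le> ennreal N" "0 \<le> N"
    and e: "sobolev_energy (interior S) u \<le> ennreal e" "0 \<le> e" and t: "0 < t"
    and c: "\<And>x. x \<in> S \<Longrightarrow> q t x x \<le> c" "0 \<le> c"
  shows "(\<integral>\<^sup>+x. ennreal ((u x)\<^sup>2) \<partial>lborel) \<le> ennreal (t * e + c * N\<^sup>2)"
proof -
  have cont: "continuous_on (interior S \<times> interior S) (\<lambda>(x, y). q t x y)"
    using dens t unfolding transition_density_def
    by (auto intro: continuous_on_subset simp: subsetD[OF interior_subset])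
  have "q t x y \<le> c" if "x \<in> interior S" "y \<in> interior S" for x y
    using kernel_le_of_diagonal[OF t open_interior cont _ c(1) c(2) that] interior_subset[of S]
    by (auto simp: K_def subset_eq)
  then have le: "K t x y \<le> ennreal c" if "u x \<noteq> 0" "u y \<noteq> 0" for x y
    using that uS unfolding K_def by (metis (no_types, lifting) ennreal_leI indicator_simps mult.right_neutral mult_zero_right zero_le)
  have "form t u u \<le> ennreal c * ((\<integral>\<^sup>+x. ennreal (u x) \<partial>lborel) * (\<integral>\<^sup>+x. ennreal (u x) \<partial>lborel))"
    using t le u by (intro form_le_of_kernel_le) (auto simp: ennreal_eq_0_iff)
  also have "\<dots> \<le> ennreal c * (ennreal N * ennreal N)"
    using N by (intro mult_left_mono mult_mono) auto
  also have "\<dots> = ennreal (c * N\<^sup>2)" using N c by (simp add: ennreal_mult power2_eq_square)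
  finally have "form t u u \<le> ennreal (c * N\<^sup>2)" .
  moreover have "(\<integral>\<^sup>+x. ennreal ((u x)\<^sup>2) \<partial>lborel) \<le> form t u u + ennreal (t * e)"
  proof (rule energy_ge_difference_quotient[OF _ u _ _ e t])
    show "(\<integral>\<^sup>+x. ennreal (u x) \<partial>lborel) < \<infinity>" using N(1) by (simp add: le_less_trans)
  qed (use uS interior_subset in auto)
  ultimately have "(\<integral>\<^sup>+x. ennreal ((u x)\<^sup>2) \<partial>lborel) \<le> ennreal (c * N\<^sup>2) + ennreal (t * e)"
    using add_right_mono order_trans by blast
  also have "\<dots> = ennreal (t * e + c * N\<^sup>2)"
    using c(2) e(2) t N(2) by (simp add: ennreal_plus[symmetric] add.commute del: ennreal_plus)
  finally show ?thesis .
qed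

end

section \<open>Weak gradients of differentiable functions\<close>

lemma integrable_bounded_support:
  fixes f :: "'a::euclidean_space \<Rightarrow> 'b::euclidean_space"
  assumes [measurable]: "f \<in> borel_measurable borel"
    and "\<And>x. norm (f x) \<le> B" and "\<And>x. R < norm x \<Longrightarrow> f x = 0"
  shows "integrable lborel f"
proof (rule integrableI_bounded_set[where A = "cball 0 R" and B = B])
  show "emeasure lborel (cball (0::'a) R) < \<infinity>" by (rule emeasure_lborel_cball_finite)
qed (use assms in auto)

lemma integral_lborel_translation:
  fixes f :: "'a::euclidean_space \<Rightarrow> real"
  assumes [measurable]: "f \<in> borel_measurable borel"
  shows "(\<integral>x. f (x + c) \<partial>lborel) = (\<integral>x. f x \<partial>lborel)"
proof -
  have "(\<integral>x. f x \<partial>lborel) = (\<integral>x. f x \<partial>distr lborel borel ((+) c))"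
    by (simp add: lborel_distr_plus)
  also have "\<dots> = (\<integral>x. f (c + x) \<partial>lborel)" by (rule integral_distr) simp_all
  finally show ?thesis by (simp add: add.commute)
qed

text \<open>Difference quotients have integral zero by translation invariance.\<close>
lemma integral_gradient_eq_0:
  fixes w :: "'a::euclidean_space \<Rightarrow> real"
  assumes G: "\<And>x. GDERIV w x :> G x" and [measurable]: "G \<in> borel_measurable borel"
    and B: "\<And>x. norm (G x) \<le> B" and supp: "\<And>x. R < norm x \<Longrightarrow> w x = 0"
  shows "(\<integral>x. G x \<partial>lborel) = 0"
proof -
  have der: "(w has_derivative (\<lambda>h. h \<bullet> G x)) (at x)" for x
    using G unfolding gderiv_def by blast
  have cont: "continuous_on UNIV w"
    using has_derivative_continuous[OF der] by (intro continuous_at_imp_continuous_on) auto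
  then have [measurable]: "w \<in> borel_measurable borel" by (rule borel_measurable_continuous_onI)
  have B0: "0 \<le> B" using B[of 0] norm_ge_zero order_trans by blast
  have lip: "\<bar>w y - w x\<bar> \<le> B * norm (y - x)" for x y
  proof -
    have "norm (w y - w x) \<le> B * norm (y - x)"
    proof (rule differentiable_bound[of UNIV w "\<lambda>x h. h \<bullet> G x"])
      show "onorm (\<lambda>h. h \<bullet> G x) \<le> B" for x
      proof (rule onorm_le)
        fix h show "norm (h \<bullet> G x) \<le> B * norm h"
          using Cauchy_Schwarz_ineq2[of h "G x"] mult_left_mono[OF B[of x], of "norm h"]
          by (simp add: mult.commute)
      qed
    qed (use der in auto)
    then show ?thesis by simp
  qed
  have "continuous_on (cball 0 R) w" using cont continuous_on_subset by blast
  then have "bounded (w ` cball 0 R)" by (intro compact_imp_bounded compact_continuous_image) auto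
  then obtain b where b: "\<And>x. x \<in> cball 0 R \<Longrightarrow> norm (w x) \<le> b" unfolding bounded_iff by blast
  have wb: "norm (w x) \<le> max b 0" for x
    using b[of x] supp[of x] by (cases "norm x \<le> R") auto
  have int_w: "integrable lborel w"
    using wb supp by (intro integrable_bounded_support) auto
  have G0: "G x = 0" if "R < norm x" for x
  proof -
    have "open {x::'a. R < norm x}" by (intro open_Collect_less continuous_intros)
    moreover have "((\<lambda>_. 0) has_derivative (\<lambda>h. 0)) (at x)" by simp
    ultimately have "(w has_derivative (\<lambda>h. 0)) (at x)"
      using has_derivative_transform_within_open[of "\<lambda>_. 0" "\<lambda>_. 0" x UNIV "{x. R < norm x}" w] that supp by auto
    then have "(\<lambda>h. h \<bullet> G x) = (\<lambda>h. 0)" using der has_derivative_unique by blast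
    then have "G x \<bullet> G x = 0" by metis
    then show ?thesis by simp
  qed
  have int_G: "integrable lborel G" using B G0 by (intro integrable_bounded_support) auto
  have *: "(\<integral>x. G x \<bullet> e \<partial>lborel) = 0" if e: "e \<in> Basis" for e
  proof -
    define h where "h n = 1 / real (Suc n)" for n
    have h: "0 < h n" "h n \<le> 1" for n unfolding h_def by auto
    define F where "F n x = (w (x + h n *\<^sub>R e) - w x) / h n" for n x
    have [measurable]: "F n \<in> borel_measurable borel" for n unfolding F_def by measurable
    have lim: "(\<lambda>n. F n x) \<longlonglongrightarrow> G x \<bullet> e" for x
    proof -
      have "((\<lambda>t. w (x + t *\<^sub>R e)) has_derivative (\<lambda>t. (t *\<^sub>R e) \<bullet> G x)) (at 0)"
        by (rule has_derivative_compose[of "\<lambda>t. x + t *\<^sub>R e" "\<lambda>t. t *\<^sub>R e" 0 UNIV w "\<lambda>h. h \<bullet> G x"])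
           (auto intro!: derivative_eq_intros simp: der)
      then have "((\<lambda>t. w (x + t *\<^sub>R e)) has_field_derivative (e \<bullet> G x)) (at 0)"
        unfolding has_field_derivative_def by (rule has_derivative_eq_rhs) (simp add: fun_eq_iff)
      then have "((\<lambda>t. (w (x + t *\<^sub>R e) - w x) / t) \<longlongrightarrow> e \<bullet> G x) (at 0)"
        unfolding DERIV_def by simp
      moreover have "filterlim h (at 0) sequentially"
        unfolding h_def using h
        by (intro filterlim_atI) (auto intro: LIMSEQ_Suc[OF lim_1_over_n] simp del: of_nat_Suc)
      ultimately show ?thesis unfolding F_def
        by (auto dest: filterlim_compose simp: inner_commute)
    qed
    \<comment> \<open>\<open>B\<close> is a Lipschitz constant of \<open>w\<close>, and steps of
      length at most 1 enlarge the support by at most 1. So one bounded function of compact support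
      dominates all difference quotients.\<close>
    have dom: "norm (F n x) \<le> B * indicator (cball 0 (R + 1)) x" for n x
    proof (cases "norm x \<le> R + 1")
      case True
      have "norm (F n x) = \<bar>w (x + h n *\<^sub>R e) - w x\<bar> / h n"
        unfolding F_def using h[of n] by simp
      also have "\<dots> \<le> B * h n / h n"
        using lip[of "x + h n *\<^sub>R e" x] h[of n] e by (intro divide_right_mono) auto
      finally show ?thesis using True h[of n] by simp
    next
      case False
      have "norm x \<le> norm (x + h n *\<^sub>R e) + norm (h n *\<^sub>R e)"
        using norm_triangle_ineq4[of "x + h n *\<^sub>R e" "h n *\<^sub>R e"] by simp
      then have "R < norm (x + h n *\<^sub>R e)" "R < norm x" using False h[of n] e by auto
      then show ?thesis unfolding F_def using supp B0 by simp
    qed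
    have "(\<lambda>n. \<integral>x. F n x \<partial>lborel) \<longlonglongrightarrow> (\<integral>x. G x \<bullet> e \<partial>lborel)"
    proof (rule integral_dominated_convergence)
      show "integrable lborel (\<lambda>x. B * indicator (cball (0::'a) (R + 1)) x)"
        using emeasure_lborel_cball_finite[of 0 "R+1"]
        by (intro integrable_mult_right integrable_real_indicator) auto
    qed (use lim dom in auto)
    moreover have "(\<integral>x. F n x \<partial>lborel) = 0" for n
    proof -
      have i: "integrable lborel (\<lambda>x. w (x + h n *\<^sub>R e))"
      proof (rule integrable_bounded_support[where B = "max b 0" and R = "R + 1"])
        fix x :: 'a assume "R + 1 < norm x"
        moreover have "norm x \<le> norm (x + h n *\<^sub>R e) + norm (h n *\<^sub>R e)"
          using norm_triangle_ineq4[of "x + h n *\<^sub>R e" "h n *\<^sub>R e"] by simp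
        ultimately show "w (x + h n *\<^sub>R e) = 0" using h[of n] e by (intro supp) auto
      qed (use wb in auto)
      then show ?thesis unfolding F_def using int_w integral_lborel_translation[of w "h n *\<^sub>R e"] by simp
    qed
    ultimately show ?thesis by (simp add: LIMSEQ_const_iff)
  qed
  have "(\<integral>x. G x \<partial>lborel) \<bullet> e = 0 \<bullet> e" if "e \<in> Basis" for e
    using integral_inner_left[OF int_G] *[OF that] by (metis inner_zero_left)
  then show ?thesis by (rule euclidean_eqI)
qed

text \<open>Nothing is known about \<open>u\<close> outside \<open>D\<close>, yet the product with
  \<phi> is differentiable everywhere: \<phi> vanishes on the open complement of \<open>C\<close>,
  which covers the complement of \<open>D\<close>. So the gradient of the product integrates to 0,
  and the product rule gives the claim.\<close>

lemma integration_by_parts: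
  fixes u \<phi> :: "'a::euclidean_space \<Rightarrow> real"
  assumes D: "open D" and [measurable]: "u \<in> borel_measurable borel" "g \<in> borel_measurable borel"
    and der: "\<And>x. x \<in> D \<Longrightarrow> GDERIV u x :> g x"
    and ub: "\<And>x. x \<in> D \<Longrightarrow> \<bar>u x\<bar> \<le> b" and gb: "\<And>x. x \<in> D \<Longrightarrow> norm (g x) \<le> b'"
    and p: "\<And>x. GDERIV \<phi> x :> \<phi>' x" and c': "continuous_on UNIV \<phi>'"
    and comp: "compact (closure {x. \<phi> x \<noteq> 0})" and sub: "closure {x. \<phi> x \<noteq> 0} \<subseteq> D"
  shows "(LINT x:D|lborel. u x *\<^sub>R \<phi>' x) = - (LINT x:D|lborel. \<phi> x *\<^sub>R g x)"
proof -
  define C where "C = closure {x. \<phi> x \<noteq> 0}"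
  have C: "compact C" "closed C" "C \<subseteq> D"
    unfolding C_def by (rule comp, rule closed_closure, rule sub)
  have [measurable]: "D \<in> sets borel" using D by simp
  have p0: "\<phi> x = 0" if "x \<notin> C" for x
    using that closure_subset[of "{x. \<phi> x \<noteq> 0}"] unfolding C_def by auto
  have pd: "(\<phi> has_derivative (\<lambda>h. h \<bullet> \<phi>' x)) (at x)" for x
    using p unfolding gderiv_def by blast
  then have c: "continuous_on UNIV \<phi>"
    using has_derivative_continuous[OF pd] by (intro continuous_at_imp_continuous_on) auto
  have [measurable]: "\<phi> \<in> borel_measurable borel" "\<phi>' \<in> borel_measurable borel"
    using c c' by (auto intro: borel_measurable_continuous_onI)
  have zero_der: "(f has_derivative (\<lambda>h. 0)) (at x)" if "x \<notin> C" "\<And>y. y \<notin> C \<Longrightarrow> f y = (0::real)" for f :: "'a \<Rightarrow> real" and x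
    using has_derivative_transform_within_open[of "\<lambda>_. 0" "\<lambda>_. 0" x UNIV "- C" f] that C(2) by auto
  have p'0: "\<phi>' x = 0" if "x \<notin> C" for x
  proof -
    have "(\<lambda>h. h \<bullet> \<phi>' x) = (\<lambda>h. 0)"
      by (rule has_derivative_unique[OF pd zero_der[OF that p0]])
    then have "\<phi>' x \<bullet> \<phi>' x = 0" by metis
    then show ?thesis by simp
  qed
  obtain R where R: "\<And>x. x \<in> C \<Longrightarrow> norm x \<le> R"
    using compact_imp_bounded[OF C(1)] by (auto simp: bounded_iff)
  have bdd: "\<exists>B. \<forall>x\<in>C. norm (f x) \<le> B" if "continuous_on UNIV f" for f :: "'a \<Rightarrow> 'b::real_normed_vector"
  proof -
    have "bounded (f ` C)"
      using C(1) continuous_on_subset[OF that] by (intro compact_imp_bounded compact_continuous_image) auto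
    then show ?thesis by (simp add: bounded_iff)
  qed
  obtain B1 where B1: "\<And>x. x \<in> C \<Longrightarrow> norm (\<phi> x) \<le> B1" using bdd[OF c] by auto
  obtain B2 where B2: "\<And>x. x \<in> C \<Longrightarrow> norm (\<phi>' x) \<le> B2" using bdd[OF c'] by auto
  have 1: "norm (indicator D x *\<^sub>R (u x *\<^sub>R \<phi>' x)) \<le> \<bar>b\<bar> * \<bar>B2\<bar>" for x
  proof (cases "x \<in> C")
    case True
    then have "x \<in> D" using C by blast
    have "norm (u x *\<^sub>R \<phi>' x) \<le> \<bar>b\<bar> * \<bar>B2\<bar>"
      using ub[OF \<open>x \<in> D\<close>] B2[OF True] by (simp, intro mult_mono) auto
    then show ?thesis using \<open>x \<in> D\<close> by simp
  qed (simp add: p'0)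
  have 2: "norm (indicator D x *\<^sub>R (\<phi> x *\<^sub>R g x)) \<le> \<bar>B1\<bar> * \<bar>b'\<bar>" for x
  proof (cases "x \<in> C")
    case True
    then have "x \<in> D" using C by blast
    have "norm (\<phi> x *\<^sub>R g x) \<le> \<bar>B1\<bar> * \<bar>b'\<bar>"
      using gb[OF \<open>x \<in> D\<close>] B1[OF True] by (simp, intro mult_mono) auto
    then show ?thesis using \<open>x \<in> D\<close> by simp
  qed (simp add: p0)
  have out: "x \<notin> C" if "R < norm x" for x using R[of x] that by linarith
  have i1: "integrable lborel (\<lambda>x. indicator D x *\<^sub>R (u x *\<^sub>R \<phi>' x))"
    by (rule integrable_bounded_support[OF _ 1, where R = R]) (simp_all add: p'0 out)
  have i2: "integrable lborel (\<lambda>x. indicator D x *\<^sub>R (\<phi> x *\<^sub>R g x))"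
    by (rule integrable_bounded_support[OF _ 2, where R = R]) (simp_all add: p0 out)
  have "(\<integral>x. indicator D x *\<^sub>R (u x *\<^sub>R \<phi>' x) + indicator D x *\<^sub>R (\<phi> x *\<^sub>R g x) \<partial>lborel) = 0"
  proof (rule integral_gradient_eq_0)
    fix x
    show "GDERIV (\<lambda>x. u x * \<phi> x) x :> indicator D x *\<^sub>R (u x *\<^sub>R \<phi>' x) + indicator D x *\<^sub>R (\<phi> x *\<^sub>R g x)"
    proof (cases "x \<in> D")
      case True
      then show ?thesis using GDERIV_mult[OF der p] by simp
    next
      case False
      then have "x \<notin> C" using C(3) by blast
      then show ?thesis using zero_der[of x "\<lambda>x. u x * \<phi> x"] False by (simp add: p0 gderiv_def)
    qed
    show "norm (indicator D x *\<^sub>R (u x *\<^sub>R \<phi>' x) + indicator D x *\<^sub>R (\<phi> x *\<^sub>R g x)) \<le> \<bar>b\<bar> * \<bar>B2\<bar> + \<bar>B1\<bar> * \<bar>b'\<bar>"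
      using norm_triangle_mono[OF 1 2] .
    show "u x * \<phi> x = 0" if "R < norm x" using that by (simp add: p0 out)
  qed measurable
  then show "(LINT x:D|lborel. u x *\<^sub>R \<phi>' x) = - (LINT x:D|lborel. \<phi> x *\<^sub>R g x)"
    unfolding set_lebesgue_integral_def using i1 i2 by (simp add: eq_neg_iff_add_eq_0)
qed

lemma weak_gradient_of_gderiv:
  fixes u :: "'a::euclidean_space \<Rightarrow> real"
  assumes "open D" and "u \<in> borel_measurable borel" "g \<in> borel_measurable borel"
    and "\<And>x. x \<in> D \<Longrightarrow> GDERIV u x :> g x"
    and "\<And>x. x \<in> D \<Longrightarrow> \<bar>u x\<bar> \<le> b" and "\<And>x. x \<in> D \<Longrightarrow> norm (g x) \<le> b'"
  shows "weak_gradient_on D u g"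
  unfolding weak_gradient_on_def
proof (intro allI impI, elim conjE)
  fix \<phi> and \<phi>' :: "'a \<Rightarrow> 'a"
  assume p: "\<forall>x. GDERIV \<phi> x :> \<phi>' x" and c: "continuous_on UNIV \<phi>'"
    and s: "compact (closure {x. \<phi> x \<noteq> 0})" "closure {x. \<phi> x \<noteq> 0} \<subseteq> D"
  show "(LINT x:D|lborel. u x *\<^sub>R \<phi>' x) = - (LINT x:D|lborel. \<phi> x *\<^sub>R g x)"
  proof (rule integration_by_parts[where D = D and u = u and g = g and b = b and b' = b' and \<phi> = \<phi> and \<phi>' = \<phi>'])
    show "GDERIV \<phi> x :> \<phi>' x" for x using p ..
  qed (fact assms c s)+
qed

section \<open>A bump function\<close>

text \<open>The exponent makes the bump vanish outside the cube \<open>(-1, 1)\<^sup>d\<close> and still be bounded below on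
  the cube of half that size.\<close>
definition bump_base :: "real^'d \<Rightarrow> real" where
  "bump_base x = 1 - (\<Sum>i\<in>UNIV. (x $ i) ^ (2 * CARD('d)))"

text \<open>Squaring the positive part removes its kink, so the bump is continuously
  differentiable.\<close>

definition bump :: "real^'d \<Rightarrow> real" where
  "bump x = (max 0 (bump_base x))\<^sup>2"

definition bump_gradient :: "real^'d \<Rightarrow> real^'d" where
  "bump_gradient x = - (2 * max 0 (bump_base x)) *\<^sub>R
     (\<chi> i. real (2 * CARD('d)) * (x $ i) ^ (2 * CARD('d) - 1))"

lemma has_real_derivative_max_0_square:
  "((\<lambda>s::real. (max 0 s)\<^sup>2) has_real_derivative 2 * max 0 s) (at s)"
proof -
  consider "s > 0" | "s < 0" | "s = 0" by linarith
  then show ?thesis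
  proof cases
    case 1
    have "((\<lambda>s::real. s\<^sup>2) has_real_derivative 2 * max 0 s) (at s)"
      using 1 by (auto intro!: derivative_eq_intros)
    then show ?thesis
      by (rule has_field_derivative_transform_within_open[of _ _ _ "{0<..}"]) (use 1 in auto)
  next
    case 2
    have "((\<lambda>s::real. 0) has_real_derivative 2 * max 0 s) (at s)" using 2 by simp
    then show ?thesis
      by (rule has_field_derivative_transform_within_open[of _ _ _ "{..<0}"]) (use 2 in auto)
  next
    case 3
    have "((\<lambda>h::real. (max 0 h)\<^sup>2 / h) \<longlongrightarrow> 0) (at 0)"
    proof (rule Lim_null_comparison[of _ "\<lambda>h. \<bar>h\<bar>"])
      have "norm ((max 0 h)\<^sup>2 / h) \<le> \<bar>h\<bar>" for h :: real
        by (auto simp: max_def power2_eq_square)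
      then show "\<forall>\<^sub>F h in at 0. norm ((max 0 h)\<^sup>2 / h) \<le> \<bar>h::real\<bar>" by simp
      show "((\<lambda>h::real. \<bar>h\<bar>) \<longlongrightarrow> 0) (at 0)" by (intro tendsto_rabs_zero tendsto_ident_at)
    qed
    then show ?thesis using 3 unfolding DERIV_def by simp
  qed
qed

lemma GDERIV_bump: "GDERIV bump x :> bump_gradient x" for x :: "real^'d"
proof -
  let ?n = "2 * CARD('d)"
  have "(bump_base has_derivative (\<lambda>h. - (\<Sum>i\<in>UNIV. real ?n * (x $ i) ^ (?n - 1) * h $ i))) (at x)"
    unfolding bump_base_def[abs_def]
    by (auto intro!: derivative_eq_intros bounded_linear.has_derivative[OF bounded_linear_vec_nth]
        ext sum.cong simp: mult_ac sum_negf)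
  from has_derivative_compose[OF this has_real_derivative_max_0_square[of "bump_base x", unfolded has_field_derivative_def]]
  have "(bump has_derivative (\<lambda>h. 2 * max 0 (bump_base x) * - (\<Sum>i\<in>UNIV. real ?n * (x $ i) ^ (?n - 1) * h $ i))) (at x)"
    unfolding bump_def[abs_def] .
  moreover have "2 * max 0 (bump_base x) * - (\<Sum>i\<in>UNIV. real ?n * (x $ i) ^ (?n - 1) * h $ i) = h \<bullet> bump_gradient x" for h
    unfolding bump_gradient_def inner_vec_def
    by (simp add: sum_distrib_left sum_negf[symmetric] mult_ac)
  ultimately show ?thesis unfolding gderiv_def by simp
qed

lemma continuous_on_bump_gradient: "continuous_on UNIV bump_gradient"
  unfolding bump_gradient_def[abs_def] bump_base_def
  by (intro continuous_intros continuous_on_vec_lambda)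

lemma measurable_bump [measurable]: "bump \<in> borel_measurable borel" "bump_gradient \<in> borel_measurable borel"
proof -
  have "continuous_on UNIV bump"
    unfolding bump_def[abs_def] bump_base_def by (intro continuous_intros)
  then show "bump \<in> borel_measurable borel" by (rule borel_measurable_continuous_onI)
  show "bump_gradient \<in> borel_measurable borel"
    by (rule borel_measurable_continuous_onI[OF continuous_on_bump_gradient])
qed

lemma bump_nonneg: "0 \<le> bump x" by (simp add: bump_def)

lemma bump_le_1: "bump x \<le> 1"
proof -
  have "0 \<le> (\<Sum>i\<in>UNIV. (x $ i) ^ (2 * CARD('a)))" by (intro sum_nonneg) (simp add: power_mult)
  then have "max 0 (bump_base x) \<le> 1" unfolding bump_base_def by simp
  then show ?thesis unfolding bump_def by (simp add: power_le_one)
qed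

lemma bump_base_pos_imp:
  assumes "0 < bump_base (x::real^'d)"
  shows "\<bar>x $ i\<bar> < 1"
proof (rule ccontr)
  assume "\<not> \<bar>x $ i\<bar> < 1"
  then have "1 \<le> \<bar>x $ i\<bar> ^ (2 * CARD('d))" by simp
  then have "1 \<le> (x $ i) ^ (2 * CARD('d))" by (simp add: power_even_abs)
  also have "\<dots> \<le> (\<Sum>i\<in>UNIV. (x $ i) ^ (2 * CARD('d)))"
    by (rule member_le_sum) (simp_all add: power_mult)
  finally show False using assms unfolding bump_base_def by simp
qed

lemma bump_nonzero_imp: "bump x \<noteq> 0 \<Longrightarrow> \<bar>x $ i\<bar> < 1"
  using bump_base_pos_imp[of x i] unfolding bump_def by (cases "0 < bump_base x") auto

lemma bump_gradient_nonzero_imp: "bump_gradient x \<noteq> 0 \<Longrightarrow> \<bar>x $ i\<bar> < 1"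
  using bump_base_pos_imp[of x i] unfolding bump_gradient_def by (cases "0 < bump_base x") auto

text \<open>With exponent 2d the sum in \<open>bump_base\<close> is at most d / 4^d, hence at most
  1/4. The base is then at least 3/4, and 9/16 is its square.\<close>

lemma bump_ge:
  assumes "\<And>i. \<bar>(x::real^'d) $ i\<bar> \<le> 1/2"
  shows "9/16 \<le> bump x"
proof -
  have ind: "real (Suc n) * 4 \<le> 4 ^ Suc n" for n by (induction n) auto
  then have n: "real CARD('d) * 4 \<le> 4 ^ CARD('d)"
    using ind[of "CARD('d) - 1"] by simp
  have "(x $ i) ^ (2 * CARD('d)) \<le> (1/4) ^ CARD('d)" for i
  proof -
    have "\<bar>x $ i\<bar> ^ (2 * CARD('d)) \<le> (1/2) ^ (2 * CARD('d))" using assms by (intro power_mono) auto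
    then show ?thesis by (simp add: power_even_abs power_mult power2_eq_square)
  qed
  then have "(\<Sum>i\<in>UNIV. (x $ i) ^ (2 * CARD('d))) \<le> real CARD('d) * (1/4) ^ CARD('d)"
    using sum_bounded_above[of UNIV "\<lambda>i. (x $ i) ^ (2 * CARD('d))"] by simp
  also have "\<dots> \<le> 1/4" using n by (simp add: power_divide field_simps)
  finally have "3/4 \<le> max 0 (bump_base x)" unfolding bump_base_def by simp
  then have "(3/4)\<^sup>2 \<le> bump x" unfolding bump_def by (intro power_mono) auto
  then show ?thesis by (simp add: power2_eq_square)
qed

text \<open>Where the gradient is not 0, all coordinates are below 1 in absolute value, so each of
  the d components of the inner vector is at most 2d. The remaining factor 2 comes from
  differentiating the square.\<close>

lemma norm_bump_gradient_le: "norm (bump_gradient (x::real^'d)) \<le> 4 * (real CARD('d))\<^sup>2"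
proof (cases "bump_gradient x = 0")
  case False
  let ?v = "\<chi> i. real (2 * CARD('d)) * (x $ i) ^ (2 * CARD('d) - 1) :: real^'d"
  have "norm ?v \<le> (\<Sum>i\<in>UNIV. \<bar>?v $ i\<bar>)" by (rule norm_le_l1_cart)
  also have "\<dots> \<le> (\<Sum>i\<in>(UNIV::'d set). real (2 * CARD('d)))"
  proof (rule sum_mono)
    fix i
    have "\<bar>x $ i\<bar> ^ (2 * CARD('d) - 1) \<le> 1"
      using bump_gradient_nonzero_imp[OF False, of i] by (intro power_le_one) auto
    then show "\<bar>?v $ i\<bar> \<le> real (2 * CARD('d))"
      by (simp add: abs_mult power_abs mult_left_le)
  qed
  finally have v: "norm ?v \<le> 2 * (real CARD('d))\<^sup>2" by (simp add: power2_eq_square)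
  have "bump_base x \<le> 1"
    unfolding bump_base_def by (simp add: sum_nonneg power_mult)
  then have "\<bar>2 * max 0 (bump_base x)\<bar> * norm ?v \<le> 2 * (2 * (real CARD('d))\<^sup>2)"
    using v by (intro mult_mono) auto
  then show ?thesis unfolding bump_gradient_def by simp
qed simp

section \<open>The test function of a finitely supported function on the vertices\<close>

lemma finite_vec_set:
  assumes "\<And>i. finite (A i)"
  shows "finite {x::real^'d. \<forall>i. x $ i \<in> A i}"
proof (rule finite_subset)
  show "{x::real^'d. \<forall>i. x $ i \<in> A i} \<subseteq> vec_lambda ` PiE UNIV A"
  proof
    fix x :: "real^'d" assume "x \<in> {x. \<forall>i. x $ i \<in> A i}"
    then have "vec_nth x \<in> PiE UNIV A" by auto
    then show "x \<in> vec_lambda ` PiE UNIV A" by (metis image_eqI vec_nth_inverse)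
  qed
  show "finite (vec_lambda ` PiE UNIV A)" using assms by (intro finite_imageI finite_PiE) auto
qed

lemma finite_half_integers_near: "finite {t::real. t - 1/2 \<in> \<int> \<and> \<bar>t - c\<bar> \<le> R}"
proof (rule finite_subset)
  show "{t::real. t - 1/2 \<in> \<int> \<and> \<bar>t - c\<bar> \<le> R} \<subseteq> (\<lambda>n. n + 1/2) ` {n \<in> \<int>. \<bar>n\<bar> \<le> \<bar>c\<bar> + R + 1/2}"
  proof
    fix t :: real assume "t \<in> {t. t - 1/2 \<in> \<int> \<and> \<bar>t - c\<bar> \<le> R}"
    then show "t \<in> (\<lambda>n. n + 1/2) ` {n \<in> \<int>. \<bar>n\<bar> \<le> \<bar>c\<bar> + R + 1/2}"
      by (intro image_eqI[of _ _ "t - 1/2"]) auto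
  qed
qed (intro finite_imageI finite_abs_int_segment)

lemma emeasure_lborel_cube:
  assumes "0 \<le> r"
  shows "emeasure lborel (cbox (v - vec r) (v + vec r :: real^'d)) = ennreal ((2 * r) ^ CARD('d))"
    and "emeasure lborel (box (v - vec r) (v + vec r :: real^'d)) = ennreal ((2 * r) ^ CARD('d))"
proof -
  have b: "vec s \<bullet> b = s" if "b \<in> Basis" for b :: "real^'d" and s
    using that by (auto simp: Basis_vec_def inner_axis)
  have "v + vec r - (v - vec r) = vec (2 * r)" by (simp add: vec_eq_iff)
  then have "(\<Prod>b\<in>Basis. (v + vec r - (v - vec r)) \<bullet> b) = (\<Prod>b\<in>(Basis::(real^'d) set). 2 * r)"
    by (intro prod.cong) (simp_all only: b)
  then have p: "(\<Prod>b\<in>Basis. (v + vec r - (v - vec r)) \<bullet> b) = (2 * r) ^ CARD('d)"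
    by (simp only: prod_constant DIM_cart) simp
  have le: "(v - vec r) \<bullet> b \<le> (v + vec r) \<bullet> b" if "b \<in> Basis" for b
    using assms b[OF that] by (simp add: inner_diff_left inner_add_left)
  show "emeasure lborel (cbox (v - vec r) (v + vec r :: real^'d)) = ennreal ((2 * r) ^ CARD('d))"
    using emeasure_lborel_cbox[OF le] unfolding p .
  show "emeasure lborel (box (v - vec r) (v + vec r :: real^'d)) = ennreal ((2 * r) ^ CARD('d))"
    using emeasure_lborel_box[OF le] unfolding p .
qed

lemma graph_energy_edge: "(Max (f ` {x, y}) - Min (f ` {x, y}))\<^sup>2 = (f x - f y)\<^sup>2" for f :: "'a \<Rightarrow> real"
  by (auto simp: max_def min_def power2_commute)

context carpet_params
begin

lemma finite_vertices_near: "finite {v \<in> V. \<forall>i. \<bar>v $ i - w $ i\<bar> \<le> R}" for w :: "real^'d"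
  by (rule finite_subset[OF _ finite_vec_set[where A = "\<lambda>i. {t. t - 1/2 \<in> \<int> \<and> \<bar>t - w $ i\<bar> \<le> R}"]])
     (auto simp: mem_vertices_iff finite_half_integers_near)

lemma close_sym: "close v w \<longleftrightarrow> close w v"
  unfolding close_def by (simp add: abs_minus_commute)

lemma finite_close: "finite {w \<in> V. close v w}" for v :: "real^'d"
  using finite_vertices_near[of v 1] unfolding close_def by (simp add: abs_minus_commute)

lemma vertices_diff_Ints:
  assumes "v \<in> V" "w \<in> V"
  shows "v $ i - w $ i \<in> \<int>"
proof -
  have "v $ i - 1/2 \<in> \<int>" "w $ i - 1/2 \<in> \<int>" using assms unfolding mem_vertices_iff by blast+
  then show ?thesis using Ints_diff[of "v $ i - 1/2" "w $ i - 1/2"] by simp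
qed

lemma closeI:
  assumes "v \<in> V" "w \<in> V" "\<And>i. \<bar>v $ i - w $ i\<bar> < 2"
  shows "close v w"
  unfolding close_def
proof
  fix i
  obtain z :: int where z: "v $ i - w $ i = of_int z"
    using vertices_diff_Ints[OF assms(1,2)] by (metis Ints_cases)
  then have "of_int \<bar>z\<bar> < (2::real)" using assms(3)[of i] by simp
  then have "\<bar>z\<bar> \<le> 1" by linarith
  then have "of_int \<bar>z\<bar> \<le> (1::real)" by linarith
  then show "\<bar>v $ i - w $ i\<bar> \<le> 1" unfolding z by simp
qed

lemma ex_card_close_le: "\<exists>K. \<forall>v\<in>(V :: (real^'d) set). card {w \<in> V. close v w} \<le> K"
proof -
  define Z where "Z = {z::real^'d. \<forall>i. z $ i \<in> {-1, 0, 1}}"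
  have "finite Z" unfolding Z_def by (intro finite_vec_set) simp
  have "card {w \<in> V. close v w} \<le> card Z" if v: "v \<in> V" for v :: "real^'d"
  proof -
    have "{w \<in> V. close v w} \<subseteq> (\<lambda>z. v + z) ` Z"
    proof
      fix w assume w: "w \<in> {w \<in> V. close v w}"
      have "w $ i - v $ i \<in> {-1, 0, 1}" for i
      proof -
        obtain z :: int where z: "w $ i - v $ i = of_int z"
          using vertices_diff_Ints[of w v i] v w by (auto elim: Ints_cases)
        moreover have "\<bar>w $ i - v $ i\<bar> \<le> 1" using w by (auto simp: close_def abs_minus_commute)
        ultimately have "z \<in> {-1, 0, 1}" by auto
        then show ?thesis using z by auto
      qed
      then show "w \<in> (\<lambda>z. v + z) ` Z" unfolding Z_def by (intro image_eqI[of _ _ "w - v"]) auto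
    qed
    then have "card {w \<in> V. close v w} \<le> card ((\<lambda>z. v + z) ` Z)"
      using \<open>finite Z\<close> by (intro card_mono) auto
    also have "\<dots> \<le> card Z" using \<open>finite Z\<close> by (rule card_image_le)
    finally show ?thesis .
  qed
  then show ?thesis by (intro exI[of _ "card Z"] ballI)
qed

lemma abs_diff_vtx: "\<bar>x $ i - vtx x $ i\<bar> \<le> 1/2"
  using floor_correct[of "x $ i"] unfolding vtx_def vec_lambda_beta abs_le_iff by linarith

end

text \<open>\<open>F\<close> carries the support of \<open>g\<close> and \<open>e\<close> bounds its
  energy. All constants below depend only on the dimension and the neighbour count \<open>K\<close>,
  not on \<open>g\<close>, \<open>F\<close> or \<open>e\<close>.\<close>

locale test_function = carpet_params +
  fixes g :: "real^'d \<Rightarrow> real" and F :: "(real^'d) set" and e :: real and K :: nat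
  assumes finite_F: "finite F" and F_V: "F \<subseteq> V"
    and g_nonneg: "\<And>v. 0 \<le> g v" and g_zero: "\<And>v. v \<in> V \<Longrightarrow> v \<notin> F \<Longrightarrow> g v = 0"
    and energy: "graph_energy (carpet_edges k a) g \<le> ennreal e" and e_nonneg: "0 \<le> e"
    and card_close: "\<And>v::real^'d. v \<in> V \<Longrightarrow> card {w \<in> V. close v w} \<le> K"
begin

text \<open>The distance 2 = 3/2 + 1/2 ensures that the cell centre of every \<open>active\<close>
  point belongs to \<open>W\<close>; finiteness keeps the sums elementary.\<close>

definition W where "W = {v \<in> V. \<exists>w\<in>F. \<forall>i. \<bar>v $ i - w $ i\<bar> \<le> 2}"
definition num where "num x = (\<Sum>v\<in>W. g v * bump (x - v))"
definition den where "den x = (\<Sum>v\<in>W. bump (x - v))"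
definition num' where "num' x = (\<Sum>v\<in>W. g v *\<^sub>R bump_gradient (x - v))"
definition den' where "den' x = (\<Sum>v\<in>W. bump_gradient (x - v))"
text \<open>A normalised weighted average of \<open>g\<close>. Away from \<open>F\<close> the
  denominator may vanish, but there the numerator is 0 and so is the quotient.\<close>

definition u where "u x = indicator (interior pre) x * (num x / den x)"
definition G where "G x = (1 / (den x)\<^sup>2) *\<^sub>R (den x *\<^sub>R num' x - num x *\<^sub>R den' x)"
text \<open>The numerator lives within distance 1 of \<open>F\<close>. The extra 1/2 makes
  \<open>u\<close> vanish in a whole ball around each inactive point, so that differentiability
  there is trivial.\<close>

definition active where "active x \<longleftrightarrow> (\<exists>w\<in>F. \<forall>i. \<bar>x $ i - w $ i\<bar> < 3/2)"

lemma finite_W: "finite W"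
proof -
  have "W = (\<Union>w\<in>F. {v \<in> V. \<forall>i. \<bar>v $ i - w $ i\<bar> \<le> 2})" unfolding W_def by auto
  then show ?thesis using finite_F by (simp add: finite_vertices_near)
qed

lemma W_V: "W \<subseteq> V" unfolding W_def by auto

lemma F_W: "F \<subseteq> W" unfolding W_def using F_V by force

lemma measurable_test [measurable]:
  "num \<in> borel_measurable borel" "den \<in> borel_measurable borel"
  "num' \<in> borel_measurable borel" "den' \<in> borel_measurable borel"
  "u \<in> borel_measurable borel" "G \<in> borel_measurable borel"
proof -
  have [measurable]: "interior pre \<in> sets borel" by simp
  show [measurable]: "num \<in> borel_measurable borel" "den \<in> borel_measurable borel"
    "num' \<in> borel_measurable borel" "den' \<in> borel_measurable borel"
    unfolding num_def[abs_def] den_def[abs_def] num'_def[abs_def] den'_def[abs_def] by measurable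
  show "u \<in> borel_measurable borel" "G \<in> borel_measurable borel"
    unfolding u_def[abs_def] G_def[abs_def] by measurable
qed

lemma shift_derivative: "((\<lambda>x. bump (x - v)) has_derivative (\<lambda>h. h \<bullet> bump_gradient (x - v))) (at x)"
  for v :: "real^'d"
  by (rule has_derivative_compose[of "\<lambda>x. x - v" "\<lambda>h. h" x UNIV bump "\<lambda>h. h \<bullet> bump_gradient (x - v)"])
     (auto intro!: derivative_eq_intros GDERIV_bump[unfolded gderiv_def])

lemma num_derivative: "(num has_derivative (\<lambda>h. h \<bullet> num' x)) (at x)"
proof -
  have "(num has_derivative (\<lambda>h. \<Sum>v\<in>W. g v * (h \<bullet> bump_gradient (x - v)))) (at x)"
    unfolding num_def[abs_def] by (intro has_derivative_sum has_derivative_mult_right shift_derivative)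
  then show ?thesis unfolding num'_def by (simp add: inner_sum_right)
qed

lemma den_derivative: "(den has_derivative (\<lambda>h. h \<bullet> den' x)) (at x)"
proof -
  have "(den has_derivative (\<lambda>h. \<Sum>v\<in>W. h \<bullet> bump_gradient (x - v))) (at x)"
    unfolding den_def[abs_def] by (intro has_derivative_sum shift_derivative)
  then show ?thesis unfolding den'_def by (simp add: inner_sum_right)
qed

lemma vtx_in_W:
  assumes "x \<in> interior pre" "active x"
  shows "vtx x \<in> W"
proof -
  obtain w where w: "w \<in> F" "\<And>i. \<bar>x $ i - w $ i\<bar> < 3/2" using assms(2) unfolding active_def by blast
  have "\<bar>vtx x $ i - w $ i\<bar> \<le> 2" for i using w(2)[of i] abs_diff_vtx[of x i] by linarith
  then show ?thesis using vtx_interior[OF assms(1)] w(1) unfolding W_def by blast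
qed

lemma den_nonneg: "0 \<le> den x" unfolding den_def by (intro sum_nonneg bump_nonneg)

lemma num_nonneg: "0 \<le> num x"
  unfolding num_def by (intro sum_nonneg mult_nonneg_nonneg bump_nonneg g_nonneg)

lemma den_ge:
  assumes "x \<in> interior pre" "active x"
  shows "9/16 \<le> den x"
proof -
  have "9/16 \<le> bump (x - vtx x)" using abs_diff_vtx by (intro bump_ge) auto
  also have "\<dots> \<le> den x" unfolding den_def using vtx_in_W[OF assms] finite_W
    by (intro member_le_sum bump_nonneg) auto
  finally show ?thesis .
qed

lemma inactive_zero:
  assumes "\<not> (\<exists>w\<in>F. \<forall>i. \<bar>x $ i - w $ i\<bar> < 1)"
  shows "num x = 0" "num' x = 0"
proof -
  have *: "g v = 0 \<or> (bump (x - v) = 0 \<and> bump_gradient (x - v) = 0)" if "v \<in> W" for v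
  proof (cases "v \<in> F")
    case True
    then obtain i where "\<not> \<bar>(x - v) $ i\<bar> < 1" using assms by auto
    then show ?thesis using bump_nonzero_imp bump_gradient_nonzero_imp by blast
  next
    case False
    then show ?thesis using g_zero[of v] that W_V by auto
  qed
  then show "num x = 0" unfolding num_def by (intro sum.neutral) force
  show "num' x = 0" unfolding num'_def using * by (intro sum.neutral) force
qed

lemma bump_far:
  fixes x w :: "real^'d"
  assumes "\<not> (\<forall>i. \<bar>(x - w) $ i\<bar> < 1)"
  shows "bump (x - w) = 0" "bump_gradient (x - w) = 0" "norm (bump_gradient (x - w)) = 0"
proof -
  show "bump (x - w) = 0" "bump_gradient (x - w) = 0"
    using assms bump_nonzero_imp[of "x - w"] bump_gradient_nonzero_imp[of "x - w"] by blast+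
  then show "norm (bump_gradient (x - w)) = 0" by simp
qed

lemma not_active_imp_not_near:
  assumes "\<not> active x"
  shows "\<not> (\<exists>w\<in>F. \<forall>i. \<bar>x $ i - w $ i\<bar> < 1)"
proof
  assume "\<exists>w\<in>F. \<forall>i. \<bar>x $ i - w $ i\<bar> < 1"
  then obtain w where w: "w \<in> F" "\<And>i. \<bar>x $ i - w $ i\<bar> < 1" by blast
  have "\<bar>x $ i - w $ i\<bar> < 3/2" for i using w(2)[of i] by linarith
  then show False using assms w(1) unfolding active_def by blast
qed

lemma inactive_G: "\<not> active x \<Longrightarrow> G x = 0"
  using inactive_zero[OF not_active_imp_not_near] unfolding G_def by simp

lemma u_derivative:
  assumes x: "x \<in> interior pre"
  shows "GDERIV u x :> G x"
proof (cases "active x")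
  case True
  have d: "den x \<noteq> 0" using den_ge[OF x True] by simp
  have "((\<lambda>x. num x / den x) has_derivative
      (\<lambda>h. - num x * (inverse (den x) * (h \<bullet> den' x) * inverse (den x)) + (h \<bullet> num' x) / den x)) (at x)"
    by (rule has_derivative_divide[OF num_derivative den_derivative d])
  moreover have "- num x * (inverse (den x) * (h \<bullet> den' x) * inverse (den x)) + (h \<bullet> num' x) / den x = h \<bullet> G x" for h
    unfolding G_def using d by (simp add: inner_diff_right field_simps power2_eq_square)
  ultimately have "((\<lambda>x. num x / den x) has_derivative (\<lambda>h. h \<bullet> G x)) (at x)" by simp
  then show ?thesis unfolding gderiv_def
    by (rule has_derivative_transform_within_open[OF _ open_interior[of pre]]) (use x in \<open>auto simp: u_def\<close>)
next
  case False
  \<comment> \<open>A point \<open>y\<close> within 1 of some vertex of \<open>F\<close> in every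
    coordinate would place \<open>x\<close> within 3/2 of it.\<close>
  have "u y = 0" if "y \<in> ball x (1/2)" for y
  proof -
    have "\<bar>x $ i - y $ i\<bar> < 1/2" for i
      using component_le_norm_cart[of "x - y" i] that by (simp add: dist_norm)
    then have "\<not> (\<exists>w\<in>F. \<forall>i. \<bar>y $ i - w $ i\<bar> < 1)"
      using False unfolding active_def by (smt (verit, ccfv_SIG) field_sum_of_halves)
    then show ?thesis using inactive_zero[of y] by (simp add: u_def)
  qed
  then have "(u has_derivative (\<lambda>h. 0)) (at x)"
    by (intro has_derivative_transform_within_open[of "\<lambda>_. 0" "\<lambda>_. 0" x UNIV "ball x (1/2)" u]) auto
  then show ?thesis unfolding gderiv_def using inactive_G[OF False] by simp
qed

lemma near_imp_close:
  assumes "x \<in> interior pre" "w \<in> W" "\<And>i. \<bar>(x - w) $ i\<bar> < 1"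
  shows "close (vtx x) w"
proof (rule closeI)
  show "vtx x \<in> V" by (rule vtx_interior[OF assms(1)])
  show "w \<in> V" using assms(2) W_V by blast
  fix i
  have "\<bar>x $ i - w $ i\<bar> < 1" using assms(3)[of i] by simp
  then show "\<bar>vtx x $ i - w $ i\<bar> < 2" using abs_diff_vtx[of x i] by linarith
qed

lemma card_near:
  assumes "x \<in> interior pre"
  shows "card {w \<in> W. \<forall>i. \<bar>(x - w) $ i\<bar> < 1} \<le> K"
proof -
  have "card {w \<in> W. \<forall>i. \<bar>(x - w) $ i\<bar> < 1} \<le> card {w \<in> V. close (vtx x) w}"
    using near_imp_close[OF assms] W_V by (intro card_mono finite_close) auto
  then show ?thesis using card_close[OF vtx_interior[OF assms]] by simp
qed

lemma sum_near_le:
  fixes f :: "real^'d \<Rightarrow> real" and B :: real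
  assumes x: "x \<in> interior pre" and B: "0 \<le> B"
    and "\<And>w. w \<in> W \<Longrightarrow> f w \<le> B" "\<And>w. w \<in> W \<Longrightarrow> \<not> (\<forall>i. \<bar>(x - w) $ i\<bar> < 1) \<Longrightarrow> f w = 0"
  shows "sum f W \<le> K * B"
proof -
  have "sum f W = sum f {w \<in> W. \<forall>i. \<bar>(x - w) $ i\<bar> < 1}"
    using assms finite_W by (intro sum.mono_neutral_right) auto
  also have "\<dots> \<le> real (card {w \<in> W. \<forall>i. \<bar>(x - w) $ i\<bar> < 1}) * B"
    using assms by (intro sum_bounded_above) auto
  also have "\<dots> \<le> K * B" using card_near[OF x] B by (intro mult_right_mono) auto
  finally show ?thesis .
qed

lemma den_le:
  assumes "x \<in> interior pre"
  shows "den x \<le> K"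
  using sum_near_le[OF assms, of 1 "\<lambda>w. bump (x - w)", OF _ bump_le_1 bump_far(1)]
  unfolding den_def by simp

section \<open>The gradient of the test function against the graph energy\<close>

definition local_energy where
  "local_energy v = (\<integral>\<^sup>+ c. ennreal ((Max (g ` c) - Min (g ` c))\<^sup>2) * indicator {c. \<forall>x\<in>c. close v x} c
     \<partial>count_space (carpet_edges k a))"

text \<open>A square root of a sum rather than a maximum: it still bounds each nearby edge
  difference, and its squares can be summed over \<open>v\<close> directly.\<close>

definition osc where "osc v = sqrt (enn2real (local_energy v))"

lemma local_energy_le: "local_energy v \<le> ennreal e"
proof -
  have "local_energy v \<le> graph_energy (carpet_edges k a) g"
    unfolding local_energy_def graph_energy_def
    by (intro nn_integral_mono) (auto split: split_indicator)
  then show ?thesis using energy by (rule order_trans)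
qed

lemma osc_square: "ennreal ((osc v)\<^sup>2) = local_energy v"
proof -
  have "local_energy v < \<top>" using local_energy_le[of v] ennreal_less_top le_less_trans by blast
  then show ?thesis unfolding osc_def by simp
qed

lemma osc_nonneg: "0 \<le> osc v" unfolding osc_def by simp

lemma osc_le: "osc v \<le> sqrt e"
proof -
  have "ennreal ((osc v)\<^sup>2) \<le> ennreal e" unfolding osc_square by (rule local_energy_le)
  then have "(osc v)\<^sup>2 \<le> e" using e_nonneg by (simp add: ennreal_le_iff)
  then show ?thesis by (rule real_le_rsqrt)
qed

lemma edge_diff_le:
  assumes "x \<in> V" "y \<in> V" "dist x y = 1" "close v x" "close v y"
  shows "\<bar>g x - g y\<bar> \<le> osc v"
proof -
  let ?f = "\<lambda>c. ennreal ((Max (g ` c) - Min (g ` c))\<^sup>2) * indicator {c. \<forall>x\<in>c. close v x} c"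
  have "{x, y} \<in> carpet_edges k a" using assms unfolding carpet_edges_def by blast
  then have "?f {x, y} \<le> local_energy v" unfolding local_energy_def by (rule nn_integral_ge_point)
  moreover have "?f {x, y} = ennreal ((g x - g y)\<^sup>2)" unfolding graph_energy_edge using assms by simp
  ultimately have "ennreal ((g x - g y)\<^sup>2) \<le> ennreal ((osc v)\<^sup>2)" unfolding osc_square by simp
  then have "(g x - g y)\<^sup>2 \<le> (osc v)\<^sup>2" by (simp add: ennreal_le_iff)
  then show ?thesis using osc_nonneg[of v] by (simp add: abs_le_square_iff[symmetric])
qed

lemma close_diff_le:
  assumes "v \<in> V" "w \<in> V" "close v w"
  shows "\<bar>g w - g v\<bar> \<le> CARD('d) * osc v"
  using assms osc_nonneg edge_diff_le by (intro diff_close_vertices) auto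

text \<open>The product of d from the path length, 4 d^2 K from the gradients of the bumps, 2 from
  the two terms of the quotient rule, and 2 from the lower bound 9/16 for \<open>den\<close>
  weakened to 1/2.\<close>

definition grad_bound where "grad_bound = 16 * real CARD('d) ^ 3 * real K"

text \<open>Subtracting a constant \<open>c\<close> from \<open>g\<close> changes the average by a
  constant and leaves its gradient alone. With \<open>c\<close> the value at the cell centre only
  the differences \<open>g w - c\<close> over close vertices remain, and these are controlled by
  \<open>osc\<close>.\<close>

lemma norm_G_le:
  assumes x: "x \<in> interior pre"
  shows "norm (G x) \<le> grad_bound * osc (vtx x)"
proof (cases "active x")
  case False
  then show ?thesis using inactive_G osc_nonneg unfolding grad_bound_def by simp
next
  case True
  define d where "d = real CARD('d)"
  define m where "m = d * osc (vtx x)"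
  define B where "B = real K * (4 * d\<^sup>2)"
  define c where "c = g (vtx x)"
  have m: "0 \<le> m" and B: "0 \<le> B" unfolding m_def B_def d_def using osc_nonneg by auto
  have den: "9/16 \<le> den x" by (rule den_ge[OF x True])
  have diff: "\<bar>g w - c\<bar> \<le> m" if "w \<in> W" "\<forall>i. \<bar>(x - w) $ i\<bar> < 1" for w
    unfolding c_def m_def d_def using that W_V near_imp_close[OF x] vtx_interior[OF x]
    by (intro close_diff_le) auto
  have 1: "\<bar>num x - c * den x\<bar> \<le> m * den x"
  proof -
    have "num x - c * den x = (\<Sum>w\<in>W. (g w - c) * bump (x - w))"
      unfolding num_def den_def by (simp add: sum_distrib_left sum_subtractf left_diff_distrib)
    also have "\<bar>\<dots>\<bar> \<le> (\<Sum>w\<in>W. m * bump (x - w))"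
    proof (rule sum_norm_le[where 'a = real, unfolded real_norm_def])
      fix w assume w: "w \<in> W"
      show "\<bar>(g w - c) * bump (x - w)\<bar> \<le> m * bump (x - w)"
        using diff[OF w] bump_far(1)[of x w] bump_nonneg[of "x - w"]
        by (cases "\<forall>i. \<bar>(x - w) $ i\<bar> < 1") (auto simp: abs_mult intro!: mult_right_mono)
    qed
    finally show ?thesis unfolding den_def by (simp add: sum_distrib_left)
  qed
  have sum_norm: "(\<Sum>w\<in>W. norm (bump_gradient (x - w))) \<le> B"
    unfolding B_def d_def
  proof (rule sum_near_le[OF x])
    show "norm (bump_gradient (x - w)) \<le> 4 * (real CARD('d))\<^sup>2" for w by (rule norm_bump_gradient_le)
    show "norm (bump_gradient (x - w)) = 0" if "\<not> (\<forall>i. \<bar>(x - w) $ i\<bar> < 1)" for w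
      using that by (rule bump_far(3))
  qed simp
  have 2: "norm (num' x - c *\<^sub>R den' x) \<le> m * B"
  proof -
    have "num' x - c *\<^sub>R den' x = (\<Sum>w\<in>W. (g w - c) *\<^sub>R bump_gradient (x - w))"
      unfolding num'_def den'_def by (simp add: scaleR_sum_right sum_subtractf scaleR_left_diff_distrib)
    also have "norm \<dots> \<le> (\<Sum>w\<in>W. m * norm (bump_gradient (x - w)))"
    proof (rule sum_norm_le)
      fix w assume w: "w \<in> W"
      show "norm ((g w - c) *\<^sub>R bump_gradient (x - w)) \<le> m * norm (bump_gradient (x - w))"
        using diff[OF w] bump_far(2)[of x w]
        by (cases "\<forall>i. \<bar>(x - w) $ i\<bar> < 1") (auto intro!: mult_right_mono)
    qed
    also have "\<dots> = m * (\<Sum>w\<in>W. norm (bump_gradient (x - w)))" by (simp add: sum_distrib_left)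
    also have "\<dots> \<le> m * B" using m sum_norm by (intro mult_left_mono)
    finally show ?thesis .
  qed
  have 3: "norm (den' x) \<le> B"
  proof -
    have "norm (den' x) \<le> (\<Sum>w\<in>W. norm (bump_gradient (x - w)))"
      unfolding den'_def by (rule norm_sum)
    also note sum_norm
    finally show ?thesis .
  qed
  have "G x = (1 / (den x)\<^sup>2) *\<^sub>R (den x *\<^sub>R (num' x - c *\<^sub>R den' x) - (num x - c * den x) *\<^sub>R den' x)"
    unfolding G_def by (simp add: algebra_simps)
  also have "norm \<dots> = 1 / (den x)\<^sup>2 * norm (den x *\<^sub>R (num' x - c *\<^sub>R den' x) - (num x - c * den x) *\<^sub>R den' x)"
    by simp
  also have "\<dots> \<le> 1 / (den x)\<^sup>2 * (den x * (m * B) + m * den x * B)"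
  proof (intro mult_left_mono order_trans[OF norm_triangle_ineq4] add_mono)
    show "norm (den x *\<^sub>R (num' x - c *\<^sub>R den' x)) \<le> den x * (m * B)"
      using 2 den by (simp add: mult_left_mono)
    show "norm ((num x - c * den x) *\<^sub>R den' x) \<le> m * den x * B"
      using 1 3 B den m by (simp, intro mult_mono) auto
  qed simp
  also have "\<dots> = 2 * (m * B) / den x" using den by (simp add: field_simps power2_eq_square)
  also have "\<dots> \<le> 2 * (m * B) / (1/2)" using den m B by (intro divide_left_mono) auto
  also have "\<dots> = grad_bound * osc (vtx x)"
    unfolding m_def B_def grad_bound_def d_def by (simp add: power2_eq_square power3_eq_cube)
  finally show ?thesis .
qed

text \<open>Double counting: an edge contributes to the local energy of \<open>v\<close> only if
  \<open>v\<close> is close to its endpoint \<open>x\<close>, which happens for at most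
  \<open>K\<close> vertices.\<close>

lemma sum_local_energy_le: "(\<Sum>v\<in>W. local_energy v) \<le> ennreal (K * e)"
proof -
  let ?D = "\<lambda>c. ennreal ((Max (g ` c) - Min (g ` c))\<^sup>2)"
  let ?I = "\<lambda>v. indicator {c. \<forall>x\<in>c. close v x} :: (real^'d) set \<Rightarrow> ennreal"
  have "(\<Sum>v\<in>W. local_energy v) = (\<integral>\<^sup>+ c. (\<Sum>v\<in>W. ?D c * ?I v c) \<partial>count_space (carpet_edges k a))"
    unfolding local_energy_def by (subst nn_integral_sum) auto
  also have "\<dots> \<le> (\<integral>\<^sup>+ c. of_nat K * ?D c \<partial>count_space (carpet_edges k a))"
  proof (rule nn_integral_mono)
    fix c :: "(real^'d) set" assume "c \<in> space (count_space (carpet_edges k a))"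
    then obtain x y where c: "c = {x, y}" "x \<in> V" unfolding carpet_edges_def by auto
    have "(\<Sum>v\<in>W. ?I v c) \<le> (\<Sum>v\<in>W. if close x v then 1 else 0)"
      by (intro sum_mono) (auto simp: c close_sym split: split_indicator)
    also have "\<dots> = of_nat (card {v \<in> W. close x v})"
      using finite_W by (simp add: sum.If_cases Int_def)
    also have "\<dots> \<le> of_nat K"
    proof -
      have "card {v \<in> W. close x v} \<le> card {v \<in> V. close x v}"
        using W_V by (intro card_mono finite_close) auto
      then show ?thesis using card_close[OF c(2)] by (intro of_nat_mono) simp
    qed
    finally have "?D c * (\<Sum>v\<in>W. ?I v c) \<le> ?D c * of_nat K" by (intro mult_left_mono) auto
    then show "(\<Sum>v\<in>W. ?D c * ?I v c) \<le> of_nat K * ?D c"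
      by (simp add: sum_distrib_left mult.commute)
  qed
  also have "\<dots> = of_nat K * graph_energy (carpet_edges k a) g"
    unfolding graph_energy_def by (simp add: nn_integral_cmult)
  also have "\<dots> \<le> of_nat K * ennreal e" using energy by (intro mult_left_mono) auto
  also have "\<dots> = ennreal (K * e)" using e_nonneg by (simp add: ennreal_mult ennreal_of_nat_eq_real_of_nat)
  finally show ?thesis .
qed

text \<open>Cells have volume 1, so integrating the pointwise bound gives a sum of local energies.
  Closed cells overlap in faces, which can only enlarge the upper bound.\<close>

lemma nn_integral_G_le:
  "(\<integral>\<^sup>+x. ennreal (indicator (interior pre) x * (norm (G x))\<^sup>2) \<partial>lborel) \<le> ennreal (grad_bound\<^sup>2 * (K * e))"
proof -
  let ?Q = "\<lambda>v::real^'d. cbox (v - vec (1/2)) (v + vec (1/2))"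
  have "(\<integral>\<^sup>+x. ennreal (indicator (interior pre) x * (norm (G x))\<^sup>2) \<partial>lborel) \<le>
     (\<integral>\<^sup>+x. (\<Sum>v\<in>W. (ennreal (grad_bound\<^sup>2) * local_energy v) * indicator (?Q v) x) \<partial>lborel)"
  proof (rule nn_integral_mono)
    fix x
    show "ennreal (indicator (interior pre) x * (norm (G x))\<^sup>2) \<le>
       (\<Sum>v\<in>W. (ennreal (grad_bound\<^sup>2) * local_energy v) * indicator (?Q v) x)"
    proof (cases "x \<in> interior pre \<and> active x")
      case True
      have "(norm (G x))\<^sup>2 \<le> (grad_bound * osc (vtx x))\<^sup>2"
        using norm_G_le True by (intro power_mono) auto
      then have "ennreal ((norm (G x))\<^sup>2) \<le> ennreal (grad_bound\<^sup>2 * (osc (vtx x))\<^sup>2)"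
        by (intro ennreal_leI) (simp add: power_mult_distrib)
      also have "\<dots> = (ennreal (grad_bound\<^sup>2) * local_energy (vtx x)) * indicator (?Q (vtx x)) x"
      proof -
        have "vtx x $ i - 1/2 \<le> x $ i \<and> x $ i \<le> vtx x $ i + 1/2" for i
          using abs_diff_vtx[of x i] by linarith
        then have "x \<in> ?Q (vtx x)" by (simp add: mem_box_cart)
        then show ?thesis by (simp add: ennreal_mult osc_square)
      qed
      also have "\<dots> \<le> (\<Sum>v\<in>W. (ennreal (grad_bound\<^sup>2) * local_energy v) * indicator (?Q v) x)"
        using vtx_in_W True finite_W by (intro member_le_sum) auto
      finally show ?thesis using True by simp
    qed (auto simp: inactive_G)
  qed
  also have "\<dots> = (\<Sum>v\<in>W. ennreal (grad_bound\<^sup>2) * local_energy v)"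
  proof -
    have "emeasure lborel (?Q v) = 1" for v using emeasure_lborel_cube(1)[of "1/2" v] by simp
    then show ?thesis by (subst nn_integral_sum) (auto simp: nn_integral_cmult_indicator)
  qed
  also have "\<dots> = ennreal (grad_bound\<^sup>2) * (\<Sum>v\<in>W. local_energy v)" by (simp add: sum_distrib_left)
  also have "\<dots> \<le> ennreal (grad_bound\<^sup>2) * ennreal (K * e)"
    using sum_local_energy_le by (intro mult_left_mono) auto
  also have "\<dots> = ennreal (grad_bound\<^sup>2 * (K * e))" using e_nonneg by (simp add: ennreal_mult)
  finally show ?thesis .
qed

section \<open>The norms of the test function against those of \<open>g\<close>\<close>

lemma u_nonneg: "0 \<le> u x"
  unfolding u_def using num_nonneg den_nonneg by simp

text \<open>The factor 16/9 is the reciprocal of the lower bound for \<open>den\<close>; the cube of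
  side 2 around \<open>w\<close> contains the support of its bump.\<close>

lemma u_le: "u x \<le> 16/9 * (\<Sum>w\<in>F. g w * indicator (cbox (w - vec 1) (w + vec 1)) x)" (is "_ \<le> 16/9 * ?s")
proof -
  have s: "0 \<le> ?s" using g_nonneg by (intro sum_nonneg) auto
  show ?thesis
  proof (cases "x \<in> interior pre \<and> active x")
    case True
    have "num x = (\<Sum>w\<in>F. g w * bump (x - w))"
      unfolding num_def using F_W finite_W W_V g_zero by (intro sum.mono_neutral_right) auto
    also have "\<dots> \<le> ?s"
    proof (intro sum_mono mult_left_mono g_nonneg)
      fix w assume "w \<in> F"
      show "bump (x - w) \<le> indicator (cbox (w - vec 1) (w + vec 1)) x"
      proof (cases "bump (x - w) = 0")
        case False
        have "x \<in> cbox (w - vec 1) (w + vec 1)"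
          unfolding mem_box_cart
        proof
          fix i
          have "\<bar>(x - w) $ i\<bar> < 1" by (rule bump_nonzero_imp[OF False])
          then show "(w - vec 1) $ i \<le> x $ i \<and> x $ i \<le> (w + vec 1) $ i" by (simp add: abs_less_iff)
        qed
        then show ?thesis using bump_le_1 by simp
      qed simp
    qed
    finally have "num x / den x \<le> ?s / (9/16)" using den_ge True s by (intro frac_le) auto
    then show ?thesis unfolding u_def using True by simp
  next
    case False
    then have "u x = 0" unfolding u_def using inactive_zero[OF not_active_imp_not_near]
      by (cases "x \<in> interior pre") auto
    then show ?thesis using s by simp
  qed
qed

lemma u_bounded: "u x \<le> 16/9 * (\<Sum>w\<in>F. g w)"
proof -
  have "(\<Sum>w\<in>F. g w * indicator (cbox (w - vec 1) (w + vec 1)) x) \<le> (\<Sum>w\<in>F. g w)"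
    using g_nonneg by (intro sum_mono) (auto split: split_indicator)
  then show ?thesis using u_le[of x] by linarith
qed

lemma nn_integral_u_le: "(\<integral>\<^sup>+x. ennreal (u x) \<partial>lborel) \<le> ennreal (16/9 * 2 ^ CARD('d) * (\<Sum>w\<in>F. g w))"
proof -
  let ?Q = "\<lambda>w::real^'d. cbox (w - vec 1) (w + vec 1)"
  have "(\<integral>\<^sup>+x. ennreal (u x) \<partial>lborel) \<le> (\<integral>\<^sup>+x. (\<Sum>w\<in>F. ennreal (16/9 * g w) * indicator (?Q w) x) \<partial>lborel)"
  proof (rule nn_integral_mono)
    fix x
    have "ennreal (u x) \<le> ennreal (\<Sum>w\<in>F. 16/9 * (g w * indicator (?Q w) x))"
      using u_le[of x] by (intro ennreal_leI) (simp add: sum_distrib_left)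
    also have "\<dots> = (\<Sum>w\<in>F. ennreal (16/9 * (g w * indicator (?Q w) x)))"
      using g_nonneg by (intro sum_ennreal[symmetric]) auto
    also have "\<dots> = (\<Sum>w\<in>F. ennreal (16/9 * g w) * indicator (?Q w) x)"
      by (intro sum.cong) (auto split: split_indicator)
    finally show "ennreal (u x) \<le> (\<Sum>w\<in>F. ennreal (16/9 * g w) * indicator (?Q w) x)" .
  qed
  also have "\<dots> = (\<Sum>w\<in>F. ennreal (16/9 * g w) * ennreal (2 ^ CARD('d)))"
  proof -
    have "emeasure lborel (?Q w) = ennreal (2 ^ CARD('d))" for w
      using emeasure_lborel_cube(1)[of 1 w] by simp
    then show ?thesis by (subst nn_integral_sum) (auto simp: nn_integral_cmult_indicator)
  qed
  also have "\<dots> = (\<Sum>w\<in>F. ennreal (16/9 * 2 ^ CARD('d) * g w))"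
    using g_nonneg by (intro sum.cong) (auto simp: ennreal_mult[symmetric] mult_ac)
  also have "\<dots> = ennreal (16/9 * 2 ^ CARD('d) * (\<Sum>w\<in>F. g w))"
    using g_nonneg by (simp add: sum_ennreal sum_distrib_left)
  finally show ?thesis .
qed

text \<open>The single summand of \<open>v\<close> already gives 9/16 in the numerator, and
  \<open>den\<close> is at most \<open>K\<close>. The box is open so that it lies in the interior of
  the carpet.\<close>

lemma u_ge:
  assumes v: "v \<in> F" and x: "x \<in> box (v - vec (1/2)) (v + vec (1/2))"
  shows "9 / (16 * real K) * g v \<le> u x"
proof -
  let ?Q = "box (v - vec (1/2)) (v + vec (1/2))"
  have near: "\<bar>y $ i - v $ i\<bar> < 1/2" if "y \<in> ?Q" for y i
  proof -
    have "(v - vec (1/2)) $ i < y $ i \<and> y $ i < (v + vec (1/2)) $ i"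
      using that unfolding mem_box_cart by blast
    then have "v $ i - 1/2 < y $ i" "y $ i < v $ i + 1/2" by simp_all
    then show ?thesis by linarith
  qed
  have "?Q \<subseteq> pre"
  proof
    fix y assume "y \<in> ?Q"
    then show "y \<in> pre" using F_V v less_imp_le[OF near] by (intro cell_subset_pre_carpet[of v]) auto
  qed
  then have xi: "x \<in> interior pre" using x by (meson interior_maximal open_box subsetD)
  have "\<bar>x $ i - v $ i\<bar> < 3/2" for i using near[OF x, of i] by linarith
  then have "active x" unfolding active_def using v by blast
  then have den: "9/16 \<le> den x" by (rule den_ge[OF xi])
  have "9/16 \<le> bump (x - v)" using near[OF x] by (intro bump_ge) (auto intro: less_imp_le)
  then have "g v * (9/16) \<le> g v * bump (x - v)" using g_nonneg by (intro mult_left_mono) auto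
  also have "\<dots> \<le> num x" unfolding num_def using F_W v finite_W
    by (intro member_le_sum[of v W "\<lambda>v. g v * bump (x - v)"] mult_nonneg_nonneg g_nonneg bump_nonneg) auto
  finally have "g v * (9/16) / K \<le> num x / den x"
    using den den_le[OF xi] num_nonneg g_nonneg by (intro frac_le) auto
  then show ?thesis using xi unfolding u_def by simp
qed

lemma nn_integral_u_square_ge:
  "ennreal ((9 / (16 * real K))\<^sup>2 * (\<Sum>v\<in>F. (g v)\<^sup>2)) \<le> (\<integral>\<^sup>+x. ennreal ((u x)\<^sup>2) \<partial>lborel)"
proof -
  let ?c = "9 / (16 * real K)"
  let ?Q = "\<lambda>v::real^'d. box (v - vec (1/2)) (v + vec (1/2))"
  have "ennreal (?c\<^sup>2 * (\<Sum>v\<in>F. (g v)\<^sup>2)) = (\<Sum>v\<in>F. ennreal ((?c * g v)\<^sup>2))"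
  proof -
    have "(\<Sum>v\<in>F. ennreal ((?c * g v)\<^sup>2)) = ennreal (\<Sum>v\<in>F. (?c * g v)\<^sup>2)"
      by (rule sum_ennreal) simp
    then show ?thesis by (simp only: power_mult_distrib sum_distrib_left)
  qed
  also have "\<dots> = (\<integral>\<^sup>+x. (\<Sum>v\<in>F. ennreal ((?c * g v)\<^sup>2) * indicator (?Q v) x) \<partial>lborel)"
  proof -
    have "emeasure lborel (?Q v) = 1" for v using emeasure_lborel_cube(2)[of "1/2" v] by simp
    then show ?thesis by (subst nn_integral_sum) (auto simp: nn_integral_cmult_indicator)
  qed
  also have "\<dots> \<le> (\<integral>\<^sup>+x. ennreal ((u x)\<^sup>2) \<partial>lborel)"
  proof (rule nn_integral_mono)
    fix x
    show "(\<Sum>v\<in>F. ennreal ((?c * g v)\<^sup>2) * indicator (?Q v) x) \<le> ennreal ((u x)\<^sup>2)"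
    proof (cases "\<exists>v\<in>F. x \<in> ?Q v")
      case True
      then obtain v where v: "v \<in> F" "x \<in> ?Q v" by blast
      \<comment> \<open>Open unit boxes around distinct vertices are disjoint, so at most one
        summand survives at each point and its square can be compared with that of
        \<open>u\<close>.\<close>
      have uniq: "w = v" if "w \<in> F" "x \<in> ?Q w" for w
      proof -
        have "w $ i = v $ i" for i
        proof -
          have "(v - vec (1/2)) $ i < x $ i \<and> x $ i < (v + vec (1/2)) $ i"
            "(w - vec (1/2)) $ i < x $ i \<and> x $ i < (w + vec (1/2)) $ i"
            using that(2) v(2) unfolding mem_box_cart by blast+
          then have "v $ i - 1/2 < x $ i" "x $ i < v $ i + 1/2" "w $ i - 1/2 < x $ i" "x $ i < w $ i + 1/2"
            by simp_all
          then have "\<bar>w $ i - v $ i\<bar> < 1" by linarith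
          moreover have "w $ i - v $ i \<in> \<int>"
            using that(1) v(1) F_V by (intro vertices_diff_Ints) auto
          then obtain z :: int where z: "w $ i - v $ i = of_int z" by (metis Ints_cases)
          ultimately have "of_int \<bar>z\<bar> < (1::real)" by simp
          then have "z = 0" by linarith
          then show ?thesis using z by simp
        qed
        then show ?thesis by (simp add: vec_eq_iff)
      qed
      have "(\<Sum>w\<in>F. ennreal ((?c * g w)\<^sup>2) * indicator (?Q w) x) = (\<Sum>w\<in>{v}. ennreal ((?c * g w)\<^sup>2) * indicator (?Q w) x)"
      proof (rule sum.mono_neutral_right)
        show "\<forall>w\<in>F - {v}. ennreal ((?c * g w)\<^sup>2) * indicator (?Q w) x = 0"
        proof
          fix w assume "w \<in> F - {v}"
          then have "x \<notin> ?Q w" using uniq by blast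
          then show "ennreal ((?c * g w)\<^sup>2) * indicator (?Q w) x = 0" by simp
        qed
      qed (use finite_F v in auto)
      also have "\<dots> = ennreal ((?c * g v)\<^sup>2)" using v by simp
      also have "\<dots> \<le> ennreal ((u x)\<^sup>2)"
        using u_ge[OF v] g_nonneg by (intro ennreal_leI power_mono) auto
      finally show ?thesis .
    qed (auto simp: indicator_def intro!: sum.neutral)
  qed
  finally show ?thesis .
qed

lemma sobolev_energy_u_le: "sobolev_energy (interior pre) u \<le> ennreal (grad_bound\<^sup>2 * (K * e))"
proof -
  have [measurable]: "interior pre \<in> sets borel" by simp
  have int: "integrable lborel (\<lambda>x. indicator (interior pre) x * (norm (G x))\<^sup>2)"
    using nn_integral_G_le by (intro integrableI_nonneg) (auto simp: le_less_trans[OF _ ennreal_less_top])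
  have "ennreal (\<integral>x. indicator (interior pre) x * (norm (G x))\<^sup>2 \<partial>lborel) \<le> ennreal (grad_bound\<^sup>2 * (K * e))"
    using nn_integral_G_le int by (subst nn_integral_eq_integral[symmetric]) auto
  then have le: "(\<integral>x. indicator (interior pre) x * (norm (G x))\<^sup>2 \<partial>lborel) \<le> grad_bound\<^sup>2 * (K * e)"
    using e_nonneg by (simp add: ennreal_le_iff)
  have "square_integrable_on G (interior pre)"
    unfolding square_integrable_on_def set_borel_measurable_def set_integrable_def using int by simp
  moreover have "weak_gradient_on (interior pre) u G"
  proof (rule weak_gradient_of_gderiv)
    show "\<bar>u x\<bar> \<le> 16/9 * (\<Sum>w\<in>F. g w)" for x using u_nonneg[of x] u_bounded[of x] by simp
    show "norm (G x) \<le> grad_bound * sqrt e" if "x \<in> interior pre" for x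
    proof -
      have "0 \<le> grad_bound" unfolding grad_bound_def by simp
      then show ?thesis using norm_G_le[OF that] mult_left_mono[OF osc_le] by (meson order_trans)
    qed
  qed (auto intro: u_derivative)
  ultimately have "sobolev_energy (interior pre) u \<le>
      ennreal (1/2 * (LINT x:interior pre|lborel. (norm (G x))\<^sup>2))"
    unfolding sobolev_energy_def by (intro INF_lower) simp
  also have "\<dots> \<le> ennreal (grad_bound\<^sup>2 * (K * e))"
  proof (rule ennreal_leI)
    have "0 \<le> (\<integral>x. indicator (interior pre) x * (norm (G x))\<^sup>2 \<partial>lborel)"
      by (intro integral_nonneg_AE) auto
    then show "1/2 * (LINT x:interior pre|lborel. (norm (G x))\<^sup>2) \<le> grad_bound\<^sup>2 * (K * e)"
      unfolding set_lebesgue_integral_def using le by (simp only: real_scaleR_def)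
  qed
  finally show ?thesis .
qed

end

section \<open>The Faber--Krahn inequality on the graph\<close>

context carpet_params
begin

lemma closed_pre_carpet: "closed (pre :: (real^'d) set)"
proof -
  have "open (hole_line k a m)" for m unfolding hole_line_def by (intro open_UN) auto
  then have "closed ((\<lambda>x::real^'d. x $ i) -` (- hole_line k a m))" for i m
    by (intro closed_vimage continuous_intros) auto
  then have union: "closed (\<Union>i. (\<lambda>x::real^'d. x $ i) -` (- hole_line k a m))" for m
    by (intro closed_UN) auto
  have orthant: "closed (\<Inter>i. (\<lambda>x::real^'d. x $ i) -` {0..})"
    by (intro closed_INT ballI closed_vimage continuous_intros closed_atLeast)
  have eq: "(pre :: (real^'d) set) = (\<Inter>i. (\<lambda>x. x $ i) -` {0..}) \<inter>
      (\<Inter>m. \<Union>i. (\<lambda>x. x $ i) -` (- hole_line k a (Suc m)))"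
    by (auto simp: mem_pre_carpet_iff)
  show ?thesis unfolding eq by (intro closed_Int closed_INT ballI orthant union)
qed

text \<open>Cauchy-Schwarz on \<open>F\<close> bounds the squared L1 norm by |F| times the squared
  L2 norm. For \<open>t\<close> a large multiple of |F|^(2/ds) this term is absorbed by half of the
  left-hand side, leaving t times the energy.\<close>

lemma faber_krahn:
  assumes "has_spectral_dimension (pre :: (real^'d) set) ds" and ds: "0 < ds"
  shows "\<exists>C>0. \<forall>(g :: real^'d \<Rightarrow> real) F e.
     finite F \<longrightarrow> F \<noteq> {} \<longrightarrow> F \<subseteq> V \<longrightarrow> (\<forall>v. 0 \<le> g v) \<longrightarrow> (\<forall>v\<in>V - F. g v = 0) \<longrightarrow>
     graph_energy (carpet_edges k a) g \<le> ennreal e \<longrightarrow> 0 \<le> e \<longrightarrow>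
     (\<Sum>v\<in>F. (g v)\<^sup>2) \<le> C * real (card F) powr (2 / ds) * e"
proof -
  obtain P q c0 C0 where rbm: "reflecting_brownian_motion (pre :: (real^'d) set) P"
    and td: "transition_density pre P q" and c0: "0 < c0" "c0 \<le> C0"
    and diag: "\<And>x t. x \<in> pre \<Longrightarrow> t > 1 \<Longrightarrow> q t x x \<le> C0 * t powr (- ds / 2)"
    using assms(1) unfolding has_spectral_dimension_def by blast
  interpret reflecting_bm pre P q
    using closed_pre_carpet rbm td by unfold_locales
  obtain K0 where K0: "\<And>v::real^'d. v \<in> V \<Longrightarrow> card {w \<in> V. close v w} \<le> K0"
    using ex_card_close_le by blast
  \<comment> \<open>The successor makes \<open>K\<close> positive, as is needed to divide by it in
    \<open>c2\<close>.\<close>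
  define K where "K = Suc K0"
  have K: "card {w \<in> V. close v w} \<le> K" if "v \<in> V" for v :: "real^'d"
    using K0[OF that] unfolding K_def by simp
  define c1 where "c1 = 16/9 * (2::real) ^ CARD('d)"
  define c2 where "c2 = (9 / (16 * real K))\<^sup>2"
  define c3 where "c3 = (16 * real CARD('d) ^ 3 * real K)\<^sup>2 * real K"
  have pos: "0 < c1" "0 < c2" "0 < c3" "0 < C0"
    unfolding c1_def c2_def c3_def K_def using c0 by auto
  \<comment> \<open>The first summand is what the absorption requires; adding 2 ensures
    \<open>Kc * m > 1\<close>, hence t > 1.\<close>
  define Kc where "Kc = 2 * C0 * c1\<^sup>2 / c2 + 2"
  have Kc: "2 \<le> Kc" unfolding Kc_def using pos by simp
  show ?thesis
  proof (intro exI[of _ "2 * c3 / c2 * Kc powr (2 / ds)"] conjI allI impI)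
    show "0 < 2 * c3 / c2 * Kc powr (2 / ds)" using pos Kc by simp
    fix g :: "real^'d \<Rightarrow> real" and F e
    assume F: "finite F" "F \<noteq> {}" "F \<subseteq> V" and g: "\<forall>v. 0 \<le> g v" "\<forall>v\<in>V - F. g v = 0"
      and e: "graph_energy (carpet_edges k a) g \<le> ennreal e" "0 \<le> e"
    interpret tf: test_function k a g F e K
      using F g e K by unfold_locales auto
    define m where "m = real (card F)"
    define S2 where "S2 = (\<Sum>v\<in>F. (g v)\<^sup>2)"
    define S1 where "S1 = (\<Sum>v\<in>F. g v)"
    have m: "1 \<le> m" unfolding m_def using F card_gt_0_iff[of F] by linarith
    have S1: "0 \<le> S1" unfolding S1_def using g by (intro sum_nonneg) auto
    have S2: "0 \<le> S2" unfolding S2_def by (intro sum_nonneg) auto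
    have cs: "S1\<^sup>2 \<le> m * S2"
      unfolding S1_def S2_def m_def using sum_squared_le_sum_of_squares[of g F] by (simp add: mult.commute)
    \<comment> \<open>Chosen so that t^(-ds/2) = 1 / (Kc m), which cancels the factor
      \<open>m\<close> from Cauchy-Schwarz.\<close>
    define t where "t = (Kc * m) powr (2 / ds)"
    have Km: "1 < Kc * m" using Kc m by (smt (verit) mult_le_cancel_left1)
    have t: "1 < t" unfolding t_def using Km ds by (simp add: gr_one_powr)
    have tp: "t powr (- ds / 2) = 1 / (Kc * m)"
      unfolding t_def using Km ds by (simp add: powr_powr powr_minus_divide)
    define c where "c = C0 * t powr (- ds / 2)"
    have c: "0 \<le> c" unfolding c_def using pos by simp
    have "(\<integral>\<^sup>+x. ennreal ((tf.u x)\<^sup>2) \<partial>lborel) \<le> ennreal (t * (c3 * e) + c * (c1 * S1)\<^sup>2)"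
    proof (rule nash_inequality)
      show "(\<integral>\<^sup>+x. ennreal (tf.u x) \<partial>lborel) \<le> ennreal (c1 * S1)"
        using tf.nn_integral_u_le unfolding c1_def S1_def by simp
      show "sobolev_energy (interior pre) tf.u \<le> ennreal (c3 * e)"
        using tf.sobolev_energy_u_le unfolding c3_def tf.grad_bound_def by (simp add: mult.assoc)
      show "tf.u x \<le> 16/9 * (\<Sum>w\<in>F. g w)" for x by (rule tf.u_bounded)
      show "tf.u x = 0" if "x \<notin> interior pre" for x using that by (simp add: tf.u_def)
      show "q t x x \<le> c" if "x \<in> pre" for x unfolding c_def using that t by (rule diag)
    qed (use S1 pos e t c tf.u_nonneg in auto)
    with tf.nn_integral_u_square_ge
    have "ennreal (c2 * S2) \<le> ennreal (t * (c3 * e) + c * (c1 * S1)\<^sup>2)"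
      unfolding c2_def S2_def by (rule order_trans)
    then have "c2 * S2 \<le> t * (c3 * e) + c * (c1 * S1)\<^sup>2"
      using t pos e c by (subst (asm) ennreal_le_iff) auto
    also have "c * (c1 * S1)\<^sup>2 \<le> c2 / 2 * S2"
    proof -
      have "(c1 * S1)\<^sup>2 \<le> c1\<^sup>2 * (m * S2)"
        unfolding power_mult_distrib using cs by (rule mult_left_mono) simp
      then have "c * (c1 * S1)\<^sup>2 \<le> c * (c1\<^sup>2 * (m * S2))" using c by (rule mult_left_mono)
      also have "\<dots> = C0 * c1\<^sup>2 / Kc * S2" unfolding c_def tp using m Kc by (simp add: field_simps)
      also have "\<dots> \<le> c2 / 2 * S2"
      proof (rule mult_right_mono[OF _ S2])
        have "2 * C0 * c1\<^sup>2 / c2 \<le> Kc" unfolding Kc_def by simp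
        then show "C0 * c1\<^sup>2 / Kc \<le> c2 / 2" using pos Kc by (simp add: field_simps)
      qed
      finally show ?thesis .
    qed
    finally have "c2 * S2 \<le> 2 * t * c3 * e" by (simp add: field_simps)
    then have "S2 \<le> 2 * t * c3 * e / c2" using pos by (simp add: field_simps)
    also have "\<dots> = 2 * c3 / c2 * Kc powr (2 / ds) * m powr (2 / ds) * e"
      unfolding t_def using Kc m by (simp add: powr_mult field_simps)
    finally show "(\<Sum>v\<in>F. (g v)\<^sup>2) \<le> 2 * c3 / c2 * Kc powr (2 / ds) * real (card F) powr (2 / ds) * e"
      unfolding S2_def m_def .
  qed
qed

end

section \<open>The capacity estimate\<close>

text \<open>A sequence violating the bound grows geometrically: the exponent \<open>p > 1\<close> in
  \<open>m (j + 1) \<ge> (m j / (4\<^sup>j\<^sup>+\<^sup>1 C e))\<^sup>p\<close> beats the factor \<open>4\<^sup>j\<close>.\<close>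
lemma bounded_recursion_bound:
  fixes m :: "nat \<Rightarrow> real" and p C e B :: real
  assumes p: "1 < p" and C: "0 < C" "0 < e"
    and step: "\<And>j. m j * (1/4) ^ Suc j \<le> C * m (Suc j) powr (1 / p) * e"
    and m: "\<And>j. 0 \<le> m j" "\<And>j. m j \<le> B"
  shows "m 0 \<le> 4 powr (p / (p - 1)\<^sup>2) * (4 * C * e) powr (p / (p - 1))"
proof (rule ccontr)
  define \<zeta> where "\<zeta> = p / (p - 1)"
  \<comment> \<open>The threshold at which \<open>M powr (1 / \<zeta>)\<close> equals
    \<open>\<mu> * (4 * C * e)\<close>, exactly what starts the induction.\<close>
  define M where "M = 4 powr (p / (p - 1)\<^sup>2) * (4 * C * e) powr \<zeta>"
  define \<mu> where "\<mu> = (4::real) powr (1 / (p - 1))"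
  \<comment> \<open>The growth ratio solves \<open>l / 4 = l powr (1 / p)\<close>, and \<mu> is the
    common value. With it both sides of the recursion gain the same factor at each step.\<close>
  define l where "l = (4::real) powr \<zeta>"
  assume "\<not> m 0 \<le> 4 powr (p / (p - 1)\<^sup>2) * (4 * C * e) powr (p / (p - 1))"
  then have m0: "M < m 0" unfolding M_def \<zeta>_def by simp
  have \<zeta>: "0 < \<zeta>" "\<zeta> - 1 = 1 / (p - 1)" "\<zeta> / p = 1 / (p - 1)" "1 / \<zeta> = 1 - 1 / p"
    unfolding \<zeta>_def using p by (auto simp: field_simps)
  have M: "0 < M" unfolding M_def using C by simp
  have \<mu>: "0 < \<mu>" unfolding \<mu>_def by simp
  have l: "1 < l" unfolding l_def using \<zeta>(1) by (simp add: gr_one_powr)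
  have l4: "l / 4 = \<mu>" unfolding l_def \<mu>_def \<zeta>(2)[symmetric] by (simp add: powr_diff)
  have lp: "l powr (1 / p) = \<mu>" unfolding l_def \<mu>_def \<zeta>(3)[symmetric] by (simp add: powr_powr)
  have "M powr (1 / \<zeta>) = \<mu> * (4 * C * e)"
  proof -
    have "((4::real) powr (p / (p - 1)\<^sup>2)) powr (1 / \<zeta>) = \<mu>"
    proof -
      have "p / (p - 1)\<^sup>2 * (1 / \<zeta>) = 1 / (p - 1)"
        unfolding \<zeta>_def using p by (simp add: divide_simps power2_eq_square)
      then show ?thesis unfolding \<mu>_def powr_powr by (simp only:)
    qed
    moreover have "((4 * C * e) powr \<zeta>) powr (1 / \<zeta>) = 4 * C * e"
      using \<zeta>(1) C by (simp add: powr_powr)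
    ultimately show ?thesis unfolding M_def by (simp add: powr_mult)
  qed
  moreover have "M powr (1 / \<zeta>) \<le> m 0 powr (1 / \<zeta>)" using M m0 \<zeta>(1) by (intro powr_mono2) auto
  ultimately have "\<mu> * (4 * C * e) \<le> m 0 powr (1 - 1 / p)" by (simp only: \<zeta>(4))
  then have "\<mu> * (4 * C * e) * m 0 powr (1 / p) \<le> m 0 powr (1 - 1 / p) * m 0 powr (1 / p)"
    by (intro mult_right_mono) auto
  also have "\<dots> = m 0" using M m0 by (simp add: powr_add[symmetric])
  finally have key: "m 0 powr (1 / p) * \<mu> \<le> m 0 / (4 * C * e)"
    using C by (simp add: field_simps)
  have grow: "m 0 * l ^ j \<le> m j" for j
  proof (induction j)
    case (Suc j)
    have "(m 0 * l ^ Suc j) powr (1 / p) = m 0 powr (1 / p) * \<mu> ^ Suc j"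
    proof -
      have "(l ^ Suc j) powr (1 / p) = \<mu> ^ Suc j"
      proof -
        have "l ^ Suc j = l powr real (Suc j)" using l by (intro powr_realpow[symmetric]) simp
        moreover have "\<mu> ^ Suc j = \<mu> powr real (Suc j)" using \<mu> by (intro powr_realpow[symmetric])
        ultimately show ?thesis
          by (simp only: lp[symmetric] powr_powr mult.commute)
      qed
      then show ?thesis using m0 M l by (simp add: powr_mult)
    qed
    also have "\<dots> = (m 0 powr (1 / p) * \<mu>) * \<mu> ^ j" by simp
    also have "\<dots> \<le> m 0 / (4 * C * e) * \<mu> ^ j" using key \<mu> by (intro mult_right_mono) auto
    also have "\<dots> = m 0 * l ^ j * (1/4) ^ Suc j / (C * e)"
      unfolding l4[symmetric] by (simp add: power_divide field_simps)
    also have "\<dots> \<le> m j * (1/4) ^ Suc j / (C * e)"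
      using Suc C by (intro divide_right_mono mult_right_mono) auto
    also have "\<dots> \<le> m (Suc j) powr (1 / p)"
      using step[of j] C by (simp add: divide_le_eq mult_ac)
    finally have le: "(m 0 * l ^ Suc j) powr (1 / p) \<le> m (Suc j) powr (1 / p)" .
    show ?case
    proof (rule ccontr)
      assume "\<not> m 0 * l ^ Suc j \<le> m (Suc j)"
      then have "m (Suc j) powr (1 / p) < (m 0 * l ^ Suc j) powr (1 / p)"
        using m(1)[of "Suc j"] p by (intro powr_less_mono2) auto
      then show False using le by simp
    qed
  qed simp
  obtain n where "B / m 0 < l ^ n" using real_arch_pow[OF l] by blast
  then have "B < m 0 * l ^ n" using m0 M by (simp add: divide_less_eq mult.commute)
  then show False using grow[of n] m(2)[of n] by simp
qed

section \<open>Energy under contractions and scaling\<close>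

lemma graph_energy_mono:
  fixes f g :: "'a \<Rightarrow> real"
  assumes "\<And>c. c \<in> E \<Longrightarrow> \<exists>x y. c = {x, y}"
    and "\<And>x y. \<bar>g x - g y\<bar> \<le> \<bar>f x - f y\<bar>"
  shows "graph_energy E g \<le> graph_energy E f"
  unfolding graph_energy_def
proof (rule nn_integral_mono)
  fix c assume "c \<in> space (count_space E)"
  then have "c \<in> E" by simp
  then obtain x y where c: "c = {x, y}" using assms(1) by blast
  have "(g x - g y)\<^sup>2 \<le> (f x - f y)\<^sup>2" using assms(2) by (simp add: abs_le_square_iff)
  then show "ennreal ((Max (g ` c) - Min (g ` c))\<^sup>2) \<le> ennreal ((Max (f ` c) - Min (f ` c))\<^sup>2)"
    unfolding c graph_energy_edge by (rule ennreal_leI)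
qed

lemma graph_energy_scale:
  fixes f :: "'a \<Rightarrow> real"
  assumes "\<And>c. c \<in> E \<Longrightarrow> \<exists>x y. c = {x, y}"
  shows "graph_energy E (\<lambda>x. r * f x) = ennreal (r\<^sup>2) * graph_energy E f"
proof -
  have "graph_energy E (\<lambda>x. r * f x) =
      (\<integral>\<^sup>+ c. ennreal (r\<^sup>2) * ennreal ((Max (f ` c) - Min (f ` c))\<^sup>2) \<partial>count_space E)"
    unfolding graph_energy_def
  proof (rule nn_integral_cong)
    fix c assume "c \<in> space (count_space E)"
    then have "c \<in> E" by simp
    then obtain x y where c: "c = {x, y}" using assms by blast
    have "(r * f x - r * f y)\<^sup>2 = r\<^sup>2 * (f x - f y)\<^sup>2"
      by (simp add: power_mult_distrib[symmetric] right_diff_distrib)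
    then show "ennreal ((Max ((\<lambda>x. r * f x) ` c) - Min ((\<lambda>x. r * f x) ` c))\<^sup>2) =
        ennreal (r\<^sup>2) * ennreal ((Max (f ` c) - Min (f ` c))\<^sup>2)"
      unfolding c graph_energy_edge by (simp add: ennreal_mult)
  qed
  then show ?thesis unfolding graph_energy_def by (simp add: nn_integral_cmult)
qed

lemma carpet_edges_pairs: "c \<in> carpet_edges k a \<Longrightarrow> \<exists>x y. c = {x, y}"
  unfolding carpet_edges_def by blast

context carpet_params
begin

text \<open>Finite support makes the sizes of all level sets bounded by |F|. The final constant does
  not involve \<open>F\<close>; the bound serves only to contradict unlimited growth.\<close>

lemma capacity_finite_support:
  assumes "has_spectral_dimension (pre :: (real^'d) set) ds" and ds: "2 < ds"
    and \<zeta>: "\<zeta> = ds / (ds - 2)"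
  shows "\<exists>c>0. \<forall>(f :: real^'d \<Rightarrow> real) A F e.
     finite F \<longrightarrow> F \<subseteq> V \<longrightarrow> A \<subseteq> F \<longrightarrow> (\<forall>v\<in>V - F. f v = 0) \<longrightarrow> (\<forall>v\<in>A. f v = 1) \<longrightarrow>
     graph_energy (carpet_edges k a) f \<le> ennreal e \<longrightarrow> 0 < e \<longrightarrow> card A \<le> c * e powr \<zeta>"
proof -
  define p where "p = ds / 2"
  have p: "1 < p" "2 / ds = 1 / p" "\<zeta> = p / (p - 1)"
    unfolding p_def using ds \<zeta> by (auto simp: field_simps)
  obtain C where C: "C > 0" and FK: "\<And>(g :: real^'d \<Rightarrow> real) F e. finite F \<Longrightarrow> F \<noteq> {} \<Longrightarrow> F \<subseteq> V \<Longrightarrow>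
     (\<And>v. 0 \<le> g v) \<Longrightarrow> (\<And>v. v \<in> V - F \<Longrightarrow> g v = 0) \<Longrightarrow>
     graph_energy (carpet_edges k a) g \<le> ennreal e \<Longrightarrow> 0 \<le> e \<Longrightarrow>
     (\<Sum>v\<in>F. (g v)\<^sup>2) \<le> C * real (card F) powr (1 / p) * e"
    using faber_krahn[OF assms(1)] ds unfolding p(2) by (smt (verit))
  show ?thesis
  proof (intro exI[of _ "4 powr (p / (p - 1)\<^sup>2) * (4 * C) powr \<zeta>"] conjI allI impI)
    show "0 < 4 powr (p / (p - 1)\<^sup>2) * (4 * C) powr \<zeta>" using C by simp
    fix f :: "real^'d \<Rightarrow> real" and A F e
    assume F: "finite F" "F \<subseteq> V" "A \<subseteq> F" and f0: "\<forall>v\<in>V - F. f v = 0" and f1: "\<forall>v\<in>A. f v = 1"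
      and e: "graph_energy (carpet_edges k a) f \<le> ennreal e" "0 < e"
    define L where "L j = {v \<in> V. (1/2) ^ j \<le> f v}" for j :: nat
    define m where "m j = real (card (L j))" for j
    have LF: "L j \<subseteq> F" for j
    proof
      fix v assume v: "v \<in> L j"
      have "(0::real) < (1/2) ^ j" by simp
      also have "\<dots> \<le> f v" using v unfolding L_def by blast
      finally have "f v \<noteq> 0" by simp
      then show "v \<in> F" using v f0 unfolding L_def by blast
    qed
    have finL: "finite (L j)" for j using LF F(1) finite_subset by blast
    have LS: "L j \<subseteq> L (Suc j)" for j
    proof -
      have "(1/2::real) ^ Suc j \<le> (1/2) ^ j" by (rule power_decreasing) auto
      then show ?thesis unfolding L_def using order_trans by blast
    qed
    have AL: "A \<subseteq> L 0" using F f1 unfolding L_def by auto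
    have rec: "m j * (1/4) ^ Suc j \<le> C * m (Suc j) powr (1 / p) * e" for j
    proof (cases "L (Suc j) = {}")
      case True
      then have "L j = {}" using LS by blast
      then show ?thesis using C e unfolding m_def by simp
    next
      case False
      \<comment> \<open>Half of the height defining \<open>L j\<close>; its square is the factor
        4^-(j+1) in the recursion.\<close>
      define s where "s = (1/2::real) ^ Suc j"
      have s: "0 < s" "(1/2) ^ j = 2 * s" unfolding s_def by simp_all
      \<comment> \<open>Truncation of \<open>f\<close> at the heights s and 2s, shifted to start at
        0: it is a contraction of \<open>f\<close>, equals \<open>s\<close> on \<open>L j\<close>
        and vanishes outside \<open>L (Suc j)\<close>.\<close>
      define g where "g v = min (max (f v - s) 0) s" for v
      have g: "(\<Sum>v\<in>L (Suc j). (g v)\<^sup>2) \<le> C * real (card (L (Suc j))) powr (1 / p) * e"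
      proof (rule FK)
        show "finite (L (Suc j))" by (rule finL)
        show "L (Suc j) \<noteq> {}" by (rule False)
        show "L (Suc j) \<subseteq> V" unfolding L_def by auto
        show "0 \<le> g v" for v unfolding g_def using s by simp
        show "g v = 0" if "v \<in> V - L (Suc j)" for v
        proof -
          have "\<not> s \<le> f v" using that unfolding L_def s_def by blast
          then show ?thesis using s unfolding g_def by simp
        qed
        have "graph_energy (carpet_edges k a) g \<le> graph_energy (carpet_edges k a) f"
          by (intro graph_energy_mono carpet_edges_pairs) (auto simp: g_def)
        then show "graph_energy (carpet_edges k a) g \<le> ennreal e" using e(1) by (rule order_trans)
      qed (use e in simp)
      have "m j * s\<^sup>2 = (\<Sum>v\<in>L j. s\<^sup>2)" unfolding m_def by simp
      also have "\<dots> \<le> (\<Sum>v\<in>L j. (g v)\<^sup>2)"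
      proof (rule sum_mono)
        fix v assume "v \<in> L j"
        then have "2 * s \<le> f v" unfolding L_def s(2) by blast
        then have "g v = s" unfolding g_def using s(1) by simp
        then show "s\<^sup>2 \<le> (g v)\<^sup>2" by simp
      qed
      also have "\<dots> \<le> (\<Sum>v\<in>L (Suc j). (g v)\<^sup>2)" by (intro sum_mono2 finL LS) auto
      also note g
      also have "s\<^sup>2 = (1/4) ^ Suc j"
        unfolding s_def power2_eq_square power_mult_distrib[symmetric] by simp
      finally show ?thesis unfolding m_def .
    qed
    have "m 0 \<le> 4 powr (p / (p - 1)\<^sup>2) * (4 * C * e) powr (p / (p - 1))"
    proof (rule bounded_recursion_bound[OF p(1) C e(2) rec])
      show "m j \<le> real (card F)" for j unfolding m_def using LF F(1) by (simp add: card_mono)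
    qed (simp add: m_def)
    also have "(4 * C * e) powr (p / (p - 1)) = (4 * C) powr \<zeta> * e powr \<zeta>"
      unfolding p(3) using C e by (intro powr_mult)
    finally have "m 0 \<le> 4 powr (p / (p - 1)\<^sup>2) * (4 * C) powr \<zeta> * e powr \<zeta>" by (simp add: mult.assoc)
    moreover have "real (card A) \<le> m 0" unfolding m_def using card_mono[OF finL AL] by simp
    ultimately show "real (card A) \<le> 4 powr (p / (p - 1)\<^sup>2) * (4 * C) powr \<zeta> * e powr \<zeta>" by linarith
  qed
qed

lemma finite_superlevel:
  fixes f :: "real^'d \<Rightarrow> real"
  assumes "(f \<longlongrightarrow> 0) (inf at_infinity (principal V))" "0 < s"
  shows "finite {v \<in> V. s \<le> f v}"
proof -
  have "\<forall>\<^sub>F v in inf at_infinity (principal V). f v < s"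
    using assms by (rule order_tendstoD)
  then obtain b where b: "\<And>v. b \<le> norm v \<Longrightarrow> v \<in> V \<Longrightarrow> f v < s"
    unfolding eventually_inf_principal eventually_at_infinity by blast
  have "{v \<in> V. s \<le> f v} \<subseteq> {v \<in> V. \<forall>i. \<bar>v $ i - (0 :: real^'d) $ i\<bar> \<le> b}"
  proof
    fix v assume v: "v \<in> {v \<in> V. s \<le> f v}"
    then have "norm v < b" using b[of v] by (cases "b \<le> norm v") auto
    then have "\<bar>v $ i\<bar> \<le> b" for i using component_le_norm_cart[of v i] by linarith
    then show "v \<in> {v \<in> V. \<forall>i. \<bar>v $ i - (0 :: real^'d) $ i\<bar> \<le> b}" using v by simp
  qed
  then show ?thesis using finite_vertices_near finite_subset by blast
qed

text \<open>A function tending to 0 need not have finite support, but 2 max(f - 1/2, 0) does on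
  \<open>V\<close>. It is still 1 on \<open>A\<close>, and the doubling multiplies the energy bound
  by 4, whence the factor \<open>4 powr \<zeta>\<close>.\<close>

lemma capacity_bound:
  assumes "has_spectral_dimension (pre :: (real^'d) set) ds" and "2 < ds"
    and "\<zeta> = ds / (ds - 2)"
  shows "\<exists>c>0. \<forall>(f :: real^'d \<Rightarrow> real) A e.
     A \<subseteq> V \<longrightarrow> (f \<longlongrightarrow> 0) (inf at_infinity (principal V)) \<longrightarrow> (\<forall>v\<in>A. f v = 1) \<longrightarrow>
     graph_energy (carpet_edges k a) f \<le> ennreal e \<longrightarrow> 0 < e \<longrightarrow> finite A \<and> card A \<le> c * e powr \<zeta>"
proof -
  obtain c where c: "c > 0" and cap: "\<And>(f :: real^'d \<Rightarrow> real) A F e.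
     finite F \<Longrightarrow> F \<subseteq> V \<Longrightarrow> A \<subseteq> F \<Longrightarrow> \<forall>v\<in>V - F. f v = 0 \<Longrightarrow> \<forall>v\<in>A. f v = 1 \<Longrightarrow>
     graph_energy (carpet_edges k a) f \<le> ennreal e \<Longrightarrow> 0 < e \<Longrightarrow> card A \<le> c * e powr \<zeta>"
    using capacity_finite_support[OF assms] by blast
  show ?thesis
  proof (intro exI[of _ "c * 4 powr \<zeta>"] conjI allI impI)
    show "0 < c * 4 powr \<zeta>" using c by simp
    fix f :: "real^'d \<Rightarrow> real" and A e
    assume A: "A \<subseteq> V" and lim: "(f \<longlongrightarrow> 0) (inf at_infinity (principal V))"
      and f1: "\<forall>v\<in>A. f v = 1" and e: "graph_energy (carpet_edges k a) f \<le> ennreal e" "0 < e"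
    define F where "F = {v \<in> V. 1/2 \<le> f v}"
    have finF: "finite F" unfolding F_def using lim by (rule finite_superlevel) simp
    have AF: "A \<subseteq> F" unfolding F_def using A f1 by auto
    show "finite A" using finF AF by (rule finite_subset[rotated])
    define h where "h v = max (f v - 1/2) 0" for v
    have "graph_energy (carpet_edges k a) (\<lambda>v. 2 * h v) = ennreal (2\<^sup>2) * graph_energy (carpet_edges k a) h"
      by (intro graph_energy_scale carpet_edges_pairs)
    also have "\<dots> \<le> ennreal (2\<^sup>2) * graph_energy (carpet_edges k a) f"
      by (intro mult_left_mono graph_energy_mono carpet_edges_pairs) (auto simp: h_def)
    also have "\<dots> \<le> ennreal (2\<^sup>2) * ennreal e" using e by (intro mult_left_mono) auto
    also have "\<dots> = ennreal (4 * e)" using e by (simp add: ennreal_mult)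
    finally have "card A \<le> c * (4 * e) powr \<zeta>"
      using finF AF e(2) f1 by (intro cap[of F A "\<lambda>v. 2 * h v"]) (auto simp: F_def h_def)
    then show "card A \<le> c * 4 powr \<zeta> * e powr \<zeta>" using e by (simp add: powr_mult mult.assoc)
  qed
qed

end

theorem theorem5:
  fixes k a :: nat and ds \<zeta> :: real
  assumes "CARD('d::finite) \<ge> 2"
    and "1 \<le> a" and "a < k" and "even (a + k)"
    and "has_spectral_dimension (pre_carpet k a :: (real ^ 'd) set) ds"
    and "ds > 2"
    and "\<zeta> = ds / (ds - 2)"
  shows "\<exists>c1::real. c1 > 0 \<and>
    (\<forall>A \<subseteq> (carpet_vertices k a :: (real ^ 'd) set).
      emeasure (count_space UNIV) A
        \<le> ennreal c1 * ennreal_powr (resistance (carpet_vertices k a) (carpet_edges k a) A) (- \<zeta>))"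
proof -
  interpret carpet_params k a using assms by unfold_locales
  have \<zeta>: "\<zeta> > 0" using assms(6,7) by simp
  obtain c where c: "c > 0" and cap: "\<And>(f :: real^'d \<Rightarrow> real) A e.
     A \<subseteq> V \<Longrightarrow> (f \<longlongrightarrow> 0) (inf at_infinity (principal V)) \<Longrightarrow> \<forall>v\<in>A. f v = 1 \<Longrightarrow>
     graph_energy (carpet_edges k a) f \<le> ennreal e \<Longrightarrow> 0 < e \<Longrightarrow> finite A \<and> card A \<le> c * e powr \<zeta>"
    using capacity_bound[OF assms(5-7)] by blast
  show ?thesis
  \<comment> \<open>The infimum need not be attained, so a competitor of energy below twice the
    infimum is used; this costs \<open>2 powr \<zeta>\<close>.\<close>
  proof (intro exI[of _ "c * 2 powr \<zeta>"] conjI allI impI)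
    show "0 < c * 2 powr \<zeta>" using c by simp
    fix A :: "(real^'d) set" assume A: "A \<subseteq> V"
    define I where "I = (INF f \<in> {f. (\<forall>x\<in>A. f x = 1) \<and> (f \<longlongrightarrow> 0) (inf at_infinity (principal V))}.
      graph_energy (carpet_edges k a) f)"
    have R: "resistance V (carpet_edges k a) A = inverse I" unfolding resistance_def I_def ..
    have card_le: "finite A \<and> card A \<le> c * e powr \<zeta>" if "I < ennreal e" "0 < e" for e
    proof -
      from that(1) obtain f where f: "\<forall>x\<in>A. f x = 1" "(f \<longlongrightarrow> 0) (inf at_infinity (principal V))"
        "graph_energy (carpet_edges k a) f < ennreal e"
        unfolding I_def INF_less_iff by blast
      show ?thesis by (rule cap[OF A f(2,1) less_imp_le[OF f(3)] that(2)])
    qed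
    consider "I = 0" | "I = \<infinity>" | i where "I = ennreal i" "0 < i"
      by (cases I) (auto simp: less_le)
    then show "emeasure (count_space UNIV) A \<le>
        ennreal (c * 2 powr \<zeta>) * ennreal_powr (resistance V (carpet_edges k a) A) (- \<zeta>)"
    proof cases
      case 1
      \<comment> \<open>With infimum 0 every energy level is available. This one brings the bound
        down to 1/2, which forces \<open>A\<close> to be empty.\<close>
      define e where "e = (1 / (2 * c)) powr (1 / \<zeta>)"
      have e: "0 < e" "c * e powr \<zeta> = 1/2" unfolding e_def using c \<zeta> by (auto simp: powr_powr)
      then have "finite A \<and> real (card A) \<le> 1/2" using card_le[of e] 1 by simp
      then have "A = {}" by (cases "card A") auto
      then show ?thesis by simp
    next
      case 2
      \<comment> \<open>The resistance is 0 here, and its negative power is \<infinity>, so the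
        right-hand side is infinite.\<close>
      then show ?thesis unfolding R ennreal_powr_def using c \<zeta> by (simp add: ennreal_mult_top)
    next
      case (3 i)
      have A: "finite A" "card A \<le> c * (2 * i) powr \<zeta>"
        using card_le[of "2 * i"] 3 by (auto simp: ennreal_less_iff)
      have inv: "inverse I = ennreal (inverse i)" using 3 by (simp add: inverse_ennreal)
      have "ennreal_powr (inverse I) (- \<zeta>) = ennreal (i powr \<zeta>)"
        unfolding ennreal_powr_def inv using 3 \<zeta> by (simp add: powr_minus inverse_powr)
      then have "ennreal (c * 2 powr \<zeta>) * ennreal_powr (inverse I) (- \<zeta>) = ennreal (c * (2 * i) powr \<zeta>)"
        using c 3 by (simp add: powr_mult ennreal_mult[symmetric] mult.assoc)
      moreover have "emeasure (count_space UNIV) A = ennreal (card A)"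
        using A by (simp add: ennreal_of_nat_eq_real_of_nat)
      ultimately show ?thesis unfolding R using A(2) by (simp add: ennreal_leI)
    qed
  qed
qed

end
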